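(* Let the driver $f_\theta$ satisfy the well-posedness conditions (i)–(iv) listed in the context, let its specialization $g_\theta(t,m,z):=f_\theta(t,m,m,z)$ admit a unique implicit volatility function $\nu_\theta$, and let $(M_t)_{t\ge0}$ be the corresponding canonical Neural-Brownian Motion. Let $u\in C^{1,2}([0,T]\times\mathbb{R})$ be real-valued. Then $$du(t,M_t)=\mathcal{L}^\theta u(t,M_t)\,dt+\partial_xu(t,M_t)\,\nu_\theta(t,M_t)\,dW_t,$$ where $$\mathcal{L}^\theta u(t,x):=\Big(\partial_t+\tfrac12\nu_\theta(t,x)^2\partial_{xx}\Big)u(t,x).$$
   Context: $(\Omega,\mathcal{F},\mathbb{P})$ is a complete probability space, $T>0$ is fixed, $W$ is a one-dimensional standard Brownian motion on $[0,T]$, and $(\mathcal{F}_t)$ is its augmented natural filtration. The driver is a function $f_\theta:[0,T]\times\mathbb{R}\times\mathbb{R}\times\mathbb{R}\to\mathbb{R}$, $(t,x,y,z)\mapsto f_\theta(t,x,y,z)$, with parameter $\theta$. Neural expectation: for an adapted exogenous process $X$, times $s\le t\le T$ and an $\mathcal{F}_t$-measurable square-integrable $\xi$, $\mathcal{E}^\theta[\xi\mid\mathcal{F}_s]:=Y_s$, where $(Y,Z)$ is the unique adapted solution on $[s,t]$ of the BSDE $-dY_u=f_\theta(u,X_u,Y_u,Z_u)\,du-Z_u\,dW_u$, $Y_t=\xi$. When applied to a process $M$ itself, $X=M$ and $\xi=M_t$. Neural-Brownian Motion (NBM) with respect to $\mathcal{E}^\theta$: a one-dimensional Itô process $M$ with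 $M_0=0$, a.s. continuous paths, and $M_s=\mathcal{E}^\theta[M_t\mid\mathcal{F}_s]$ for all $0\le s\le t\le T$. A canonical NBM is an NBM with zero drift under $\mathbb{P}$. Under the hypotheses of the claim, the canonical NBM is, by the paper's representation theorem, identified with the unique strong solution of $dM_t=\nu_\theta(t,M_t)\,dW_t$, $M_0=0$. Well-posedness conditions: (i) $f_\theta$ is jointly measurable, and for a.e. $t$ continuous in $(x,y,z)$. (ii) There is $\mu\in\mathbb{R}$ with $(y_1-y_2)(f_\theta(t,x,y_1,z)-f_\theta(t,x,y_2,z))\le\mu|y_1-y_2|^2$ for all $t,x,z,y_1,y_2$. (iii) There are $\kappa:\mathbb{R}^+\to\mathbb{R}^+$ and $\alpha\ge0$ with $|f_\theta(t,x,y,z)|\le\kappa(|x|)+\kappa(|y|)+\frac{\alpha}{2}|z|^2$. (iv) The terminal value $\xi$ of the BSDE is bounded, and the exogenous process satisfies $\sup_{t\in[0,T]}|X_t|\le C_X<\infty$ a.s. for a constant $C_X$. Unique implicit volatility function: $g_\theta:[0,T]\times\mathbb{R}\times\mathbb{R}\to\mathbb{R}$ is of class $C^1$ and there is $\nu_\theta:[0,T]\times\mathbb{R}\to(0,\infty)$ such that for each $(t,x)$: (a) $z=\nu_\theta(t,x)$ is the unique positive real solution of $g_\theta(t,x,z)=0$; (b) $\partial_zg_\theta(t,x,\nu_\theta(t,x))\ne0$; (c) $|\nu_\theta(t,x)|\le C(1+|x|)$ with a constant $C>0$ independent of $(t,x)$. *)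

theory Defs
  imports "HOL-Probability.Probability"
begin

section \<open>Brownian motion and its augmented filtration\<close>

definition brownian_motion :: "'a measure \<Rightarrow> real \<Rightarrow> (real \<Rightarrow> 'a \<Rightarrow> real) \<Rightarrow> bool" where
  "brownian_motion P T W \<longleftrightarrow>
     (\<forall>t\<in>{0..T}. W t \<in> borel_measurable P) \<and>
     (AE \<omega> in P. W 0 \<omega> = 0) \<and>
     (AE \<omega> in P. continuous_on {0..T} (\<lambda>t. W t \<omega>)) \<and>
     (\<forall>s t. 0 \<le> s \<and> s < t \<and> t \<le> T \<longrightarrow>
        distributed P lborel (\<lambda>\<omega>. W t \<omega> - W s \<omega>)
          (\<lambda>x. ennreal (normal_density 0 (sqrt (t - s)) x))) \<and>
     (\<forall>(n::nat) \<tau>. mono_on {..n} \<tau> \<and> \<tau> ` {..n} \<subseteq> {0..T} \<longrightarrow>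
        prob_space.indep_vars P (\<lambda>_. borel) (\<lambda>i \<omega>. W (\<tau> (Suc i)) \<omega> - W (\<tau> i) \<omega>) {..<n})"

definition augmented_filtration :: "'a measure \<Rightarrow> (real \<Rightarrow> 'a \<Rightarrow> real) \<Rightarrow> real \<Rightarrow> 'a measure" where
  "augmented_filtration P W t =
     sigma (space P)
       ({W s -` A \<inter> space P | s A. s \<in> {0..t} \<and> A \<in> sets borel} \<union> null_sets P)"

definition adapted_on :: "(real \<Rightarrow> 'a measure) \<Rightarrow> real \<Rightarrow> real \<Rightarrow> (real \<Rightarrow> 'a \<Rightarrow> real) \<Rightarrow> bool" where
  "adapted_on F a b X \<longleftrightarrow> (\<forall>t\<in>{a..b}. X t \<in> borel_measurable (F t))"

text \<open>Paths are only assumed continuous almost surely, so progressive measurability is required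
  up to indistinguishability: an adapted process whose paths are continuous outside a null set
  need not be progressive literally.\<close>

definition progressive_on ::
  "'a measure \<Rightarrow> (real \<Rightarrow> 'a measure) \<Rightarrow> real \<Rightarrow> real \<Rightarrow> (real \<Rightarrow> 'a \<Rightarrow> real) \<Rightarrow> bool" where
  "progressive_on P F a b H \<longleftrightarrow>
     (\<exists>H'. (\<forall>t\<in>{a..b}. (\<lambda>(s, \<omega>). H' s \<omega>)
                 \<in> borel_measurable (restrict_space borel {a..t} \<Otimes>\<^sub>M F t)) \<and>
           (AE \<omega> in P. \<forall>t\<in>{a..b}. H t \<omega> = H' t \<omega>))"

section \<open>The Ito integral\<close>

definition conv_in_prob :: "'a measure \<Rightarrow> (nat \<Rightarrow> 'a \<Rightarrow> real) \<Rightarrow> ('a \<Rightarrow> real) \<Rightarrow> bool" where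
  "conv_in_prob P X Y \<longleftrightarrow>
     (\<forall>n. X n \<in> borel_measurable P) \<and> Y \<in> borel_measurable P \<and>
     (\<forall>\<epsilon>>0. (\<lambda>n. measure P {\<omega> \<in> space P. \<epsilon> < \<bar>X n \<omega> - Y \<omega>\<bar>}) \<longlonglongrightarrow> 0)"

text \<open>A list of triples \<open>(r, s, h)\<close> stands for the simple integrand that is the sum of the
  \<open>h \<cdot> 1\<close> over the intervals \<open>(r, s]\<close>, each \<open>h\<close> being bounded and known at time \<open>r\<close>.\<close>

type_synonym 'a simple_integrand = "(real \<times> real \<times> ('a \<Rightarrow> real)) list"

definition simple_integrand_on ::
  "'a measure \<Rightarrow> (real \<Rightarrow> 'a measure) \<Rightarrow> real \<Rightarrow> real \<Rightarrow> 'a simple_integrand \<Rightarrow> bool" where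
  "simple_integrand_on P F a b K \<longleftrightarrow>
     (\<forall>(r, s, h) \<in> set K. a \<le> r \<and> r \<le> s \<and> s \<le> b \<and>
        h \<in> borel_measurable (F r) \<and> (\<exists>C. \<forall>\<omega>\<in>space P. \<bar>h \<omega>\<bar> \<le> C))"

definition simple_process :: "'a simple_integrand \<Rightarrow> real \<Rightarrow> 'a \<Rightarrow> real" where
  "simple_process K t \<omega> = (\<Sum>(r, s, h) \<leftarrow> K. h \<omega> * indicator {r<..s} t)"

definition simple_integral ::
  "(real \<Rightarrow> 'a \<Rightarrow> real) \<Rightarrow> 'a simple_integrand \<Rightarrow> real \<Rightarrow> 'a \<Rightarrow> real" where
  "simple_integral W K t \<omega> = (\<Sum>(r, s, h) \<leftarrow> K. h \<omega> * (W (min s t) \<omega> - W (min r t) \<omega>))"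

text \<open>\<open>I\<close> is a continuous version of the process \<open>t \<mapsto> \<integral>\<^sub>a\<^sup>t H dW\<close> on \<open>[a, b]\<close>, for a progressive
  integrand that is almost surely square integrable in time. Continuity of \<open>I\<close> and the limit
  in probability at each fixed time determine \<open>I\<close> up to indistinguishability.\<close>

definition is_ito_integral ::
  "'a measure \<Rightarrow> (real \<Rightarrow> 'a measure) \<Rightarrow> (real \<Rightarrow> 'a \<Rightarrow> real) \<Rightarrow> real \<Rightarrow> real
    \<Rightarrow> (real \<Rightarrow> 'a \<Rightarrow> real) \<Rightarrow> (real \<Rightarrow> 'a \<Rightarrow> real) \<Rightarrow> bool" where
  "is_ito_integral P F W a b H I \<longleftrightarrow>
     progressive_on P F a b H \<and>
     (AE \<omega> in P. set_integrable lborel {a..b} (\<lambda>t. (H t \<omega>)\<^sup>2)) \<and>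
     adapted_on F a b I \<and>
     (AE \<omega> in P. continuous_on {a..b} (\<lambda>t. I t \<omega>)) \<and>
     (\<exists>K. (\<forall>n. simple_integrand_on P F a b (K n)) \<and>
        conv_in_prob P (\<lambda>n \<omega>. LBINT t:{a..b}. (simple_process (K n) t \<omega> - H t \<omega>)\<^sup>2) (\<lambda>\<omega>. 0) \<and>
        (\<forall>t\<in>{a..b}. conv_in_prob P (\<lambda>n. simple_integral W (K n) t) (I t)))"

text \<open>The stochastic differential \<open>dX = \<beta> dt + \<sigma> dW\<close> on \<open>[a, b]\<close>.\<close>

definition has_ito_differential ::
  "'a measure \<Rightarrow> (real \<Rightarrow> 'a measure) \<Rightarrow> (real \<Rightarrow> 'a \<Rightarrow> real) \<Rightarrow> real \<Rightarrow> real
    \<Rightarrow> (real \<Rightarrow> 'a \<Rightarrow> real) \<Rightarrow> (real \<Rightarrow> 'a \<Rightarrow> real) \<Rightarrow> (real \<Rightarrow> 'a \<Rightarrow> real) \<Rightarrow> bool" where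
  "has_ito_differential P F W a b X \<beta> \<sigma> \<longleftrightarrow>
     adapted_on F a b X \<and>
     (AE \<omega> in P. continuous_on {a..b} (\<lambda>t. X t \<omega>)) \<and>
     progressive_on P F a b \<beta> \<and>
     (AE \<omega> in P. set_integrable lborel {a..b} (\<lambda>t. \<beta> t \<omega>)) \<and>
     (\<exists>I. is_ito_integral P F W a b \<sigma> I \<and>
        (AE \<omega> in P. \<forall>t\<in>{a..b}. X t \<omega> = X a \<omega> + (LBINT s:{a..t}. \<beta> s \<omega>) + I t \<omega>))"

section \<open>BSDEs and the neural expectation\<close>

definition bsde_solution ::
  "'a measure \<Rightarrow> (real \<Rightarrow> 'a measure) \<Rightarrow> (real \<Rightarrow> 'a \<Rightarrow> real) \<Rightarrow> (real \<Rightarrow> real \<Rightarrow> real \<Rightarrow> real \<Rightarrow> real)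
    \<Rightarrow> (real \<Rightarrow> 'a \<Rightarrow> real) \<Rightarrow> real \<Rightarrow> real \<Rightarrow> ('a \<Rightarrow> real)
    \<Rightarrow> (real \<Rightarrow> 'a \<Rightarrow> real) \<Rightarrow> (real \<Rightarrow> 'a \<Rightarrow> real) \<Rightarrow> bool" where
  "bsde_solution P F W f X s t \<xi> Y Z \<longleftrightarrow>
     has_ito_differential P F W s t Y (\<lambda>u \<omega>. - f u (X u \<omega>) (Y u \<omega>) (Z u \<omega>)) Z \<and>
     (AE \<omega> in P. Y t \<omega> = \<xi> \<omega>)"

text \<open>The relation \<open>\<eta> = \<E>[\<xi> | \<F>\<^sub>s]\<close>. Uniqueness of BSDE solutions only makes sense within a
  class of pairs \<open>(Y, Z)\<close> (bounded and BMO, exponential moments, square integrable, ...), the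
  suitable one depending on the driver; among all adapted pairs it fails even for \<open>f = 0\<close>.
  The class on the interval \<open>[s, t]\<close> is the parameter \<open>S s t\<close>.\<close>

type_synonym 'a solution_class =
  "real \<Rightarrow> real \<Rightarrow> ((real \<Rightarrow> 'a \<Rightarrow> real) \<times> (real \<Rightarrow> 'a \<Rightarrow> real)) set"

definition is_neural_expectation ::
  "'a measure \<Rightarrow> (real \<Rightarrow> 'a measure) \<Rightarrow> (real \<Rightarrow> 'a \<Rightarrow> real) \<Rightarrow> (real \<Rightarrow> real \<Rightarrow> real \<Rightarrow> real \<Rightarrow> real)
    \<Rightarrow> 'a solution_class \<Rightarrow> (real \<Rightarrow> 'a \<Rightarrow> real) \<Rightarrow> real \<Rightarrow> real \<Rightarrow> ('a \<Rightarrow> real) \<Rightarrow> ('a \<Rightarrow> real) \<Rightarrow> bool"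
  where
  "is_neural_expectation P F W f S X s t \<xi> \<eta> \<longleftrightarrow>
     \<xi> \<in> borel_measurable (F t) \<and> integrable P (\<lambda>\<omega>. (\<xi> \<omega>)\<^sup>2) \<and> adapted_on F s t X \<and>
     (\<exists>Y Z. (Y, Z) \<in> S s t \<and> bsde_solution P F W f X s t \<xi> Y Z \<and>
        (\<forall>Y' Z'. (Y', Z') \<in> S s t \<and> bsde_solution P F W f X s t \<xi> Y' Z' \<longrightarrow>
           (AE \<omega> in P. (\<forall>u\<in>{s..t}. Y' u \<omega> = Y u \<omega>) \<and>
                       (AE u in lborel. u \<in> {s..t} \<longrightarrow> Z' u \<omega> = Z u \<omega>))) \<and>
        (AE \<omega> in P. \<eta> \<omega> = Y s \<omega>))"

section \<open>Neural-Brownian motion\<close>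

definition neural_brownian_motion ::
  "'a measure \<Rightarrow> (real \<Rightarrow> 'a measure) \<Rightarrow> (real \<Rightarrow> 'a \<Rightarrow> real) \<Rightarrow> real
    \<Rightarrow> (real \<Rightarrow> real \<Rightarrow> real \<Rightarrow> real \<Rightarrow> real) \<Rightarrow> 'a solution_class \<Rightarrow> (real \<Rightarrow> 'a \<Rightarrow> real) \<Rightarrow> bool" where
  "neural_brownian_motion P F W T f S M \<longleftrightarrow>
     (\<exists>\<beta> \<sigma>. has_ito_differential P F W 0 T M \<beta> \<sigma>) \<and>
     (AE \<omega> in P. M 0 \<omega> = 0) \<and>
     (AE \<omega> in P. continuous_on {0..T} (\<lambda>t. M t \<omega>)) \<and>
     (\<forall>s t. 0 \<le> s \<and> s \<le> t \<and> t \<le> T \<longrightarrow> is_neural_expectation P F W f S M s t (M t) (M s))"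

definition canonical_nbm ::
  "'a measure \<Rightarrow> (real \<Rightarrow> 'a measure) \<Rightarrow> (real \<Rightarrow> 'a \<Rightarrow> real) \<Rightarrow> real
    \<Rightarrow> (real \<Rightarrow> real \<Rightarrow> real \<Rightarrow> real \<Rightarrow> real) \<Rightarrow> 'a solution_class \<Rightarrow> (real \<Rightarrow> 'a \<Rightarrow> real) \<Rightarrow> bool" where
  "canonical_nbm P F W T f S M \<longleftrightarrow>
     neural_brownian_motion P F W T f S M \<and>
     (\<exists>\<sigma>. has_ito_differential P F W 0 T M (\<lambda>t \<omega>. 0) \<sigma>)"

text \<open>\<open>M\<close> solves \<open>dM = \<nu>(t, M) dW\<close>, \<open>M\<^sub>0 = 0\<close>; the solution is strong when \<open>F\<close> is the augmented
  filtration of \<open>W\<close>.\<close>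

definition volatility_sde_solution ::
  "'a measure \<Rightarrow> (real \<Rightarrow> 'a measure) \<Rightarrow> (real \<Rightarrow> 'a \<Rightarrow> real) \<Rightarrow> real
    \<Rightarrow> (real \<Rightarrow> real \<Rightarrow> real) \<Rightarrow> (real \<Rightarrow> 'a \<Rightarrow> real) \<Rightarrow> bool" where
  "volatility_sde_solution P F W T \<nu> M \<longleftrightarrow>
     (AE \<omega> in P. M 0 \<omega> = 0) \<and>
     has_ito_differential P F W 0 T M (\<lambda>t \<omega>. 0) (\<lambda>t \<omega>. \<nu> t (M t \<omega>))"

section \<open>Hypotheses on the driver\<close>

definition well_posed_driver :: "real \<Rightarrow> (real \<Rightarrow> real \<Rightarrow> real \<Rightarrow> real \<Rightarrow> real) \<Rightarrow> bool" where
  "well_posed_driver T f \<longleftrightarrow>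
     (\<lambda>(t, x, y, z). f t x y z) \<in> borel_measurable (restrict_space borel ({0..T} \<times> UNIV)) \<and>
     (AE t in lborel. t \<in> {0..T} \<longrightarrow> continuous_on UNIV (\<lambda>(x, y, z). f t x y z)) \<and>
     (\<exists>\<mu>. \<forall>t\<in>{0..T}. \<forall>x z y1 y2.
        (y1 - y2) * (f t x y1 z - f t x y2 z) \<le> \<mu> * \<bar>y1 - y2\<bar>\<^sup>2) \<and>
     (\<exists>\<kappa> \<alpha>. (\<forall>r\<ge>0. 0 \<le> \<kappa> r) \<and> 0 \<le> \<alpha> \<and>
        (\<forall>t\<in>{0..T}. \<forall>x y z. \<bar>f t x y z\<bar> \<le> \<kappa> \<bar>x\<bar> + \<kappa> \<bar>y\<bar> + \<alpha> / 2 * \<bar>z\<bar>\<^sup>2))"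

definition bounded_bsde_data ::
  "'a measure \<Rightarrow> (real \<Rightarrow> 'a measure) \<Rightarrow> real \<Rightarrow> ('a \<Rightarrow> real) \<Rightarrow> (real \<Rightarrow> 'a \<Rightarrow> real) \<Rightarrow> bool" where
  "bounded_bsde_data P F T \<xi> X \<longleftrightarrow>
     \<xi> \<in> borel_measurable (F T) \<and> (\<exists>C. AE \<omega> in P. \<bar>\<xi> \<omega>\<bar> \<le> C) \<and>
     adapted_on F 0 T X \<and> (\<exists>C. AE \<omega> in P. \<forall>t\<in>{0..T}. \<bar>X t \<omega>\<bar> \<le> C)"

text \<open>The boundedness condition concerns the data \<open>(\<xi>, X)\<close> of a BSDE with driver \<open>f\<close>. It must not
  be imposed on a canonical Neural-Brownian motion \<open>M\<close> with \<open>(\<xi>, X) = (M\<^sub>T, M)\<close>: a martingale with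
  continuous, strictly positive volatility \<open>\<nu>(t, M)\<close> is never bounded.\<close>

definition well_posed ::
  "'a measure \<Rightarrow> (real \<Rightarrow> 'a measure) \<Rightarrow> real \<Rightarrow> (real \<Rightarrow> real \<Rightarrow> real \<Rightarrow> real \<Rightarrow> real)
    \<Rightarrow> ('a \<Rightarrow> real) \<Rightarrow> (real \<Rightarrow> 'a \<Rightarrow> real) \<Rightarrow> bool" where
  "well_posed P F T f \<xi> X \<longleftrightarrow> well_posed_driver T f \<and> bounded_bsde_data P F T \<xi> X"

definition specialization ::
  "(real \<Rightarrow> real \<Rightarrow> real \<Rightarrow> real \<Rightarrow> real) \<Rightarrow> real \<Rightarrow> real \<Rightarrow> real \<Rightarrow> real" where
  "specialization f t m z = f t m m z"

definition C1_on :: "'v::real_normed_vector set \<Rightarrow> ('v \<Rightarrow> real) \<Rightarrow> bool" where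
  "C1_on D g \<longleftrightarrow>
     (\<exists>g' :: 'v \<Rightarrow> 'v \<Rightarrow>\<^sub>L real.
        (\<forall>p\<in>D. (g has_derivative blinfun_apply (g' p)) (at p within D)) \<and> continuous_on D g')"

definition unique_implicit_volatility ::
  "real \<Rightarrow> (real \<Rightarrow> real \<Rightarrow> real \<Rightarrow> real) \<Rightarrow> (real \<Rightarrow> real \<Rightarrow> real) \<Rightarrow> bool" where
  "unique_implicit_volatility T g \<nu> \<longleftrightarrow>
     C1_on ({0..T} \<times> UNIV) (\<lambda>(t, x, z). g t x z) \<and>
     (\<forall>t\<in>{0..T}. \<forall>x.
        0 < \<nu> t x \<and> g t x (\<nu> t x) = 0 \<and> (\<forall>z>0. g t x z = 0 \<longrightarrow> z = \<nu> t x) \<and>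
        deriv (\<lambda>z. g t x z) (\<nu> t x) \<noteq> 0) \<and>
     (\<exists>C>0. \<forall>t\<in>{0..T}. \<forall>x. \<bar>\<nu> t x\<bar> \<le> C * (1 + \<bar>x\<bar>))"

section \<open>The generator\<close>

text \<open>The time derivative is one-sided at \<open>0\<close> and \<open>T\<close>.\<close>

definition partial_t :: "real \<Rightarrow> (real \<Rightarrow> real \<Rightarrow> real) \<Rightarrow> real \<Rightarrow> real \<Rightarrow> real" where
  "partial_t T u t x = vector_derivative (\<lambda>s. u s x) (at t within {0..T})"

definition partial_x :: "(real \<Rightarrow> real \<Rightarrow> real) \<Rightarrow> real \<Rightarrow> real \<Rightarrow> real" where
  "partial_x u t x = deriv (\<lambda>y. u t y) x"

definition partial_xx :: "(real \<Rightarrow> real \<Rightarrow> real) \<Rightarrow> real \<Rightarrow> real \<Rightarrow> real" where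
  "partial_xx u t x = deriv (\<lambda>y. partial_x u t y) x"

definition C12 :: "real \<Rightarrow> (real \<Rightarrow> real \<Rightarrow> real) \<Rightarrow> bool" where
  "C12 T u \<longleftrightarrow>
     (\<forall>t\<in>{0..T}. \<forall>x.
        (\<lambda>s. u s x) differentiable (at t within {0..T}) \<and>
        (\<lambda>y. u t y) differentiable (at x) \<and>
        (\<lambda>y. partial_x u t y) differentiable (at x)) \<and>
     continuous_on ({0..T} \<times> UNIV) (\<lambda>(t, x). u t x) \<and>
     continuous_on ({0..T} \<times> UNIV) (\<lambda>(t, x). partial_t T u t x) \<and>
     continuous_on ({0..T} \<times> UNIV) (\<lambda>(t, x). partial_x u t x) \<and>
     continuous_on ({0..T} \<times> UNIV) (\<lambda>(t, x). partial_xx u t x)"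

definition nbm_generator ::
  "real \<Rightarrow> (real \<Rightarrow> real \<Rightarrow> real) \<Rightarrow> (real \<Rightarrow> real \<Rightarrow> real) \<Rightarrow> real \<Rightarrow> real \<Rightarrow> real" where
  "nbm_generator T \<nu> u t x = partial_t T u t x + 1 / 2 * (\<nu> t x)\<^sup>2 * partial_xx u t x"

end

theory Submission
  imports Defs
begin

text \<open>Continuity of \<open>\<nu>\<close> follows from uniqueness of the positive zero: \<open>g\<close> changes sign at \<open>\<nu>(t, x)\<close>, so by
  the intermediate value theorem nearby points have a zero nearby. Hence \<open>H = \<nu>(t, M)\<close> has continuous
  paths and everything can be computed along uniform grids. The candidate for the stochastic integral
  is \<open>J = u(t, M) - u(0, M\<^sub>0) - \<integral> L u(s, M) ds\<close>, and truncated left-endpoint step functions of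
  \<open>\<partial>\<^sub>x u \<cdot> \<nu>\<close> approximate it: a Taylor expansion along the grid leaves sums built from
  \<open>R = \<Delta>M - H \<Delta>W\<close> and \<open>(\<Delta>W)\<^sup>2 - \<Delta>t\<close>. Both are controlled in probability by one discrete
  Lenglart inequality, obtained from the isometry by switching the coefficients off when their
  accumulated variance becomes too large. Passing to almost surely convergent subsequences makes all
  remaining estimates pathwise, so that no moment bounds on \<open>M\<close> or on the derivatives of \<open>u\<close> are needed.\<close>

text \<open>What shapes the proof is how little is known about the martingale part of M: at each
  fixed time it is a limit in probability of simple integrals, and the jump times of those simple
  integrands have nothing to do with any grid. An increment of M over a grid interval therefore
  cannot be compared directly with H \<Delta>W. The comparison is made on a common refinement of the
  grid and the jump times, where the difference becomes a sum of Brownian increments with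
  predictable coefficients. Since a grid has finitely many nodes, the simple integrand may be chosen
  after the grid. H and the derivatives of u along M are bounded on each path but by no common
  constant. This is why the isometry is used only behind a switch that makes coefficients bounded.
  With J defined as a difference the integral equation is an identity, and the whole content lies in
  verifying that J satisfies \<open>is_ito_integral\<close>. The four remainders of the expansion
  are collected into one sequence of sums of absolute values, so that a single subsequence serves
  all of them.\<close>

section \<open>Continuity of the implicit volatility\<close>

lemma C1_on_imp_continuous_on: "C1_on D g \<Longrightarrow> continuous_on D g"
  unfolding C1_on_def using has_derivative_continuous continuous_on_eq_continuous_within by metis

text \<open>The slab is closed in time, so the argument is arranged to work at the end points 0 and
  T as well: it uses joint continuity of \<open>g\<close> and a derivative in the interior direction
  z only. Uniqueness of the positive zero then identifies the zero found nearby with the value of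
  \<nu> there.\<close>

lemma implicit_volatility_continuous_on:
  assumes "unique_implicit_volatility T g \<nu>"
  shows "continuous_on ({0..T} \<times> UNIV) (\<lambda>(t, x). \<nu> t x)"
proof -
  let ?D = "{0..T} \<times> (UNIV :: (real \<times> real) set)"
  let ?E = "{0..T} \<times> (UNIV :: real set)"
  have C1: "C1_on ?D (\<lambda>(t, x, z). g t x z)"
    and pos: "\<And>t x. t \<in> {0..T} \<Longrightarrow> 0 < \<nu> t x"
    and zero: "\<And>t x. t \<in> {0..T} \<Longrightarrow> g t x (\<nu> t x) = 0"
    and uniq: "\<And>t x z. t \<in> {0..T} \<Longrightarrow> 0 < z \<Longrightarrow> g t x z = 0 \<Longrightarrow> z = \<nu> t x"
    and dz: "\<And>t x. t \<in> {0..T} \<Longrightarrow> deriv (\<lambda>z. g t x z) (\<nu> t x) \<noteq> 0"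
    using assms unfolding unique_implicit_volatility_def by auto
  have cont: "continuous_on ?D (\<lambda>(t, x, z). g t x z)"
    by (rule C1_on_imp_continuous_on[OF C1])
  have cont_z: "continuous_on UNIV (g t x)" if "t \<in> {0..T}" for t x
  proof -
    have "continuous_on UNIV (\<lambda>z. (t, x, z))" by (intro continuous_intros)
    from continuous_on_compose2[OF cont this] that show ?thesis by (auto simp: image_subset_iff)
  qed
  have cont_tx: "continuous_on ?E (\<lambda>p. g (fst p) (snd p) z)" for z
  proof -
    have "continuous_on ?E (\<lambda>p. (fst p, snd p, z))" by (intro continuous_intros)
    from continuous_on_compose2[OF cont this] show ?thesis by (auto simp: image_subset_iff case_prod_unfold)
  qed
  have "\<exists>d>0. \<forall>q\<in>?E. dist q (t, x) < d \<longrightarrow> dist (\<nu> (fst q) (snd q)) (\<nu> t x) < e"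
    if t: "t \<in> {0..T}" and e: "0 < e" for t x e
  proof -
    let ?n = "\<nu> t x"
    \<comment> \<open>A nonzero \<open>deriv\<close> is informative only if the derivative exists.
      The derivative of \<open>g\<close> relative to the slab is restricted to the vertical line
      through \<open>(t, x)\<close>, on which it is an ordinary two-sided derivative in z.\<close>
    from C1 obtain g' where "\<forall>p\<in>?D. ((\<lambda>(t, x, z). g t x z) has_derivative blinfun_apply (g' p)) (at p within ?D)"
      unfolding C1_on_def by blast
    then have "((\<lambda>(t, x, z). g t x z) has_derivative blinfun_apply (g' (t, x, ?n))) (at (t, x, ?n) within ?D)"
      using t by blast
    moreover have "range (\<lambda>z. (t, x, z)) \<subseteq> ?D" using t by auto
    ultimately have "((\<lambda>(t, x, z). g t x z) has_derivative blinfun_apply (g' (t, x, ?n)))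
        (at (t, x, ?n) within range (\<lambda>z. (t, x, z)))"
      by (rule has_derivative_subset)
    moreover have "((\<lambda>z. (t, x, z)) has_derivative (\<lambda>h. (0, 0, h))) (at ?n)"
      by (auto intro!: derivative_eq_intros)
    ultimately have "((\<lambda>(t, x, z). g t x z) \<circ> (\<lambda>z. (t, x, z)) has_derivative
        (blinfun_apply (g' (t, x, ?n)) \<circ> (\<lambda>h. (0, 0, h)))) (at ?n)"
      by (intro diff_chain_within)
    then have "(\<lambda>z. g t x z) differentiable (at ?n)"
      unfolding differentiable_def by (auto simp: o_def)
    then have der: "((\<lambda>z. g t x z) has_field_derivative deriv (\<lambda>z. g t x z) ?n) (at ?n)"
      using DERIV_deriv_iff_real_differentiable by blast
    let ?d = "deriv (\<lambda>z. g t x z) ?n"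
    \<comment> \<open>Multiplying by the sign of the derivative leaves only the increasing
      case.\<close>
    define \<sigma> where "\<sigma> = sgn ?d"
    have \<sigma>: "\<sigma> \<noteq> 0" "\<sigma> * \<sigma> = 1" using dz[OF t, of x] by (auto simp: \<sigma>_def sgn_if)
    have ds: "((\<lambda>z. \<sigma> * g t x z) has_field_derivative \<sigma> * ?d) (at ?n)"
      using der by (auto intro!: derivative_eq_intros)
    have dpos: "0 < \<sigma> * ?d" using dz[OF t, of x] by (auto simp: \<sigma>_def sgn_if)
    from DERIV_pos_inc_right[OF ds dpos] zero[OF t] obtain d1 where
      d1: "d1 > 0" "\<And>h. h > 0 \<Longrightarrow> h < d1 \<Longrightarrow> 0 < \<sigma> * g t x (?n + h)" by auto
    from DERIV_pos_inc_left[OF ds dpos] zero[OF t] obtain d2 where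
      d2: "d2 > 0" "\<And>h. h > 0 \<Longrightarrow> h < d2 \<Longrightarrow> \<sigma> * g t x (?n - h) < 0" by auto
    \<comment> \<open>The radii \<open>d1\<close> and \<open>d2\<close> give the signs at the two
      ends, \<open>e\<close> gives the required closeness, and staying below \<nu> itself keeps the
      whole interval positive, where zeros are unique.\<close>
    define h where "h = min (min d1 d2) (min e ?n) / 2"
    have h: "h > 0" "h < d1" "h < d2" "h < e" "h < ?n"
      using d1(1) d2(1) e pos[OF t, of x] by (auto simp: h_def)
    have ch: "continuous_on ?E (\<lambda>p. \<sigma> * g (fst p) (snd p) z)" for z
      by (intro continuous_intros cont_tx)
    obtain r1 where r1: "r1 > 0" "\<And>q. q \<in> ?E \<Longrightarrow> dist q (t, x) < r1 \<Longrightarrow> 0 < \<sigma> * g (fst q) (snd q) (?n + h)"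
    proof -
      from ch[of "?n + h", unfolded continuous_on_iff, rule_format, of "(t, x)" "\<sigma> * g t x (?n + h)"]
      show ?thesis using t d1(2)[OF h(1,2)] that by (auto simp: dist_real_def abs_if split: if_splits) force
    qed
    obtain r2 where r2: "r2 > 0" "\<And>q. q \<in> ?E \<Longrightarrow> dist q (t, x) < r2 \<Longrightarrow> \<sigma> * g (fst q) (snd q) (?n - h) < 0"
    proof -
      from ch[of "?n - h", unfolded continuous_on_iff, rule_format, of "(t, x)" "- (\<sigma> * g t x (?n - h))"]
      show ?thesis using t d2(2)[OF h(1,3)] that by (auto simp: dist_real_def abs_if split: if_splits) force
    qed
    have "dist (\<nu> (fst q) (snd q)) ?n < e" if q: "q \<in> ?E" "dist q (t, x) < min r1 r2" for q
    proof -
      have tq: "fst q \<in> {0..T}" using q(1) by auto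
      have "continuous_on {?n - h..?n + h} (\<lambda>z. \<sigma> * g (fst q) (snd q) z)"
        by (intro continuous_intros continuous_on_subset[OF cont_z[OF tq]]) simp
      then have "\<exists>z. ?n - h \<le> z \<and> z \<le> ?n + h \<and> \<sigma> * g (fst q) (snd q) z = 0"
        by (intro IVT') (use r1(2)[of q] r2(2)[of q] q h(1) in auto)
      then obtain z where z: "?n - h \<le> z" "z \<le> ?n + h" "g (fst q) (snd q) z = 0" using \<sigma> by auto
      then have "z = \<nu> (fst q) (snd q)" using uniq[OF tq] h by auto
      then show ?thesis using z h by (auto simp: dist_real_def)
    qed
    then show ?thesis using r1(1) r2(1) by (intro exI[of _ "min r1 r2"]) auto
  qed
  then show ?thesis
    unfolding continuous_on_iff by (auto simp: case_prod_unfold)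
qed

section \<open>A Lenglart inequality for sums of independent noise\<close>

lemma (in prob_space) expectation_mult_indep_zero:
  fixes X Y :: "'a \<Rightarrow> real"
  assumes "indep_var borel X borel Y" "integrable M X" "integrable M Y" "expectation Y = 0"
  shows "integrable M (\<lambda>\<omega>. X \<omega> * Y \<omega>)" "expectation (\<lambda>\<omega>. X \<omega> * Y \<omega>) = 0"
  using indep_var_integrable[OF assms(1-3)] indep_var_lebesgue_integral[OF assms(1-3)] assms(4)
  by auto

locale noise_sequence = prob_space M for M :: "'a measure" +
  fixes G :: "nat \<Rightarrow> 'a measure" and \<xi> :: "nat \<Rightarrow> 'a \<Rightarrow> real" and v :: "nat \<Rightarrow> real" and N :: nat
  assumes subalg: "\<And>l. l \<le> N \<Longrightarrow> subalgebra M (G l)"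
    and G_mono: "\<And>l m. l \<le> m \<Longrightarrow> m \<le> N \<Longrightarrow> sets (G l) \<subseteq> sets (G m)"
    and noise_meas: "\<And>l. l < N \<Longrightarrow> \<xi> l \<in> borel_measurable (G (Suc l))"
    and v_nonneg: "\<And>l. 0 \<le> v l"
    and noise_null: "\<And>l \<omega>. l < N \<Longrightarrow> v l = 0 \<Longrightarrow> \<xi> l \<omega> = 0"
    and noise_indep: "\<And>l \<phi>. l < N \<Longrightarrow> 0 < v l \<Longrightarrow> \<phi> \<in> borel_measurable (G l) \<Longrightarrow>
      indep_var borel \<phi> borel (\<xi> l)"
    and noise_sq_integrable: "\<And>l. l < N \<Longrightarrow> 0 < v l \<Longrightarrow> integrable M (\<lambda>\<omega>. (\<xi> l \<omega>)\<^sup>2)"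
    and noise_mean: "\<And>l. l < N \<Longrightarrow> 0 < v l \<Longrightarrow> expectation (\<xi> l) = 0"
    and noise_var: "\<And>l. l < N \<Longrightarrow> 0 < v l \<Longrightarrow> expectation (\<lambda>\<omega>. (\<xi> l \<omega>)\<^sup>2) = v l"
begin

lemma measurable_G_mono:
  "f \<in> borel_measurable (G l) \<Longrightarrow> l \<le> m \<Longrightarrow> m \<le> N \<Longrightarrow> f \<in> borel_measurable (G m)"
  using G_mono[of l m] subalg[of l] subalg[of m] unfolding measurable_def subalgebra_def by auto

lemma measurable_G_M: "f \<in> borel_measurable (G l) \<Longrightarrow> l \<le> N \<Longrightarrow> f \<in> borel_measurable M"
  using subalg[of l] measurable_from_subalg by blast

text \<open>Adding the largest index last, the partial sum \<open>S\<close> and the new coefficient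
  are both known before the new noise, so the cross term has mean zero. An arbitrary index set
  \<open>A\<close> is allowed because the identity is applied to blocks of indices, which need not
  be intervals.\<close>

lemma isometry:
  assumes "A \<subseteq> {..<N}"
    and "\<And>l. l < N \<Longrightarrow> \<phi> l \<in> borel_measurable (G l)"
    and "\<And>l \<omega>. l < N \<Longrightarrow> \<omega> \<in> space M \<Longrightarrow> \<bar>\<phi> l \<omega>\<bar> \<le> C l"
  shows "integrable M (\<lambda>\<omega>. (\<Sum>l\<in>A. \<phi> l \<omega> * \<xi> l \<omega>)\<^sup>2)"
    and "expectation (\<lambda>\<omega>. (\<Sum>l\<in>A. \<phi> l \<omega> * \<xi> l \<omega>)\<^sup>2)
           = (\<Sum>l\<in>A. v l * expectation (\<lambda>\<omega>. (\<phi> l \<omega>)\<^sup>2))"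
proof -
  have "finite A" using assms(1) finite_subset by blast
  then have "integrable M (\<lambda>\<omega>. (\<Sum>l\<in>A. \<phi> l \<omega> * \<xi> l \<omega>)\<^sup>2) \<and>
    expectation (\<lambda>\<omega>. (\<Sum>l\<in>A. \<phi> l \<omega> * \<xi> l \<omega>)\<^sup>2)
           = (\<Sum>l\<in>A. v l * expectation (\<lambda>\<omega>. (\<phi> l \<omega>)\<^sup>2))"
    using assms(1)
  proof (induction A rule: finite_linorder_max_induct)
    case empty
    then show ?case by simp
  next
    case (insert b A)
    have bN: "b < N" and A: "A \<subseteq> {..<N}" using insert.prems by auto
    have bA: "b \<notin> A" using insert.hyps by auto
    define S where "S \<omega> = (\<Sum>l\<in>A. \<phi> l \<omega> * \<xi> l \<omega>)" for \<omega>
    from insert.IH A have IS: "integrable M (\<lambda>\<omega>. (S \<omega>)\<^sup>2)" and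
      ES: "expectation (\<lambda>\<omega>. (S \<omega>)\<^sup>2) = (\<Sum>l\<in>A. v l * expectation (\<lambda>\<omega>. (\<phi> l \<omega>)\<^sup>2))"
      by (auto simp: S_def)
    have sum_eq: "(\<Sum>l\<in>insert b A. \<phi> l \<omega> * \<xi> l \<omega>) = S \<omega> + \<phi> b \<omega> * \<xi> b \<omega>" for \<omega>
      using bA insert.hyps(1) by (simp add: S_def)
    have S_meas: "S \<in> borel_measurable (G b)"
      unfolding S_def
    proof (intro borel_measurable_sum borel_measurable_times)
      fix l assume "l \<in> A"
      then have "l < b" using insert.hyps by auto
      then show "\<phi> l \<in> borel_measurable (G b)" "\<xi> l \<in> borel_measurable (G b)"
        using assms(2)[of l] noise_meas[of l] bN by (auto intro: measurable_G_mono)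
    qed
    have [measurable]: "S \<in> borel_measurable M" "\<phi> b \<in> borel_measurable M"
      using S_meas assms(2)[OF bN] bN by (auto intro: measurable_G_M)
    show ?case
    proof (cases "v b = 0")
      case True
      then have "(\<Sum>l\<in>insert b A. \<phi> l \<omega> * \<xi> l \<omega>) = S \<omega>" for \<omega>
        using noise_null[OF bN True] unfolding sum_eq by simp
      then show ?thesis using IS ES True bA insert.hyps(1) by simp
    next
      case False
      then have vb: "0 < v b" using v_nonneg[of b] by simp
      have \<xi>b[measurable]: "\<xi> b \<in> borel_measurable M" 
        using noise_meas[OF bN] bN by (auto intro: measurable_G_M)
      have I\<xi>: "integrable M (\<xi> b)"
        by (rule square_integrable_imp_integrable[OF \<xi>b noise_sq_integrable[OF bN vb]])
      have I\<phi>2: "integrable M (\<lambda>\<omega>. (\<phi> b \<omega>)\<^sup>2)"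
        by (rule integrable_const_bound[of _ "(C b)\<^sup>2"])
          (use assms(3)[OF bN] in \<open>auto intro!: AE_I2 abs_le_square_iff[THEN iffD1]
            order_trans[OF _ abs_ge_self]\<close>)
      have IS1: "integrable M S"
        using IS by (rule square_integrable_imp_integrable[rotated]) simp
      \<comment> \<open>\<open>S\<close> and \<open>\<phi> b\<close> need not be independent of each
        other. Boundedness of the coefficient is what makes their product integrable.\<close>
      have IS\<phi>: "integrable M (\<lambda>\<omega>. S \<omega> * \<phi> b \<omega>)"
        by (rule Bochner_Integration.integrable_bound[of _ "\<lambda>\<omega>. C b * S \<omega>"])
          (use IS1 assms(3)[OF bN] in \<open>auto intro!: AE_I2 mult_right_mono simp: abs_mult mult.commute[of "\<bar>S _\<bar>"]
            intro: order_trans[OF _ abs_ge_self]\<close>)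
      have "indep_var borel (\<lambda>\<omega>. S \<omega> * \<phi> b \<omega>) borel (\<xi> b)"
        by (rule noise_indep[OF bN vb]) (use S_meas assms(2)[OF bN] in measurable)
      from expectation_mult_indep_zero[OF this IS\<phi> I\<xi> noise_mean[OF bN vb]]
      have cross: "integrable M (\<lambda>\<omega>. S \<omega> * \<phi> b \<omega> * \<xi> b \<omega>)" "expectation (\<lambda>\<omega>. S \<omega> * \<phi> b \<omega> * \<xi> b \<omega>) = 0"
        by auto
      have "indep_var borel (\<lambda>\<omega>. (\<phi> b \<omega>)) borel (\<xi> b)"
        by (rule noise_indep[OF bN vb assms(2)[OF bN]])
      from indep_var_compose[OF this, of "\<lambda>x. x\<^sup>2" borel "\<lambda>x. x\<^sup>2" borel]
      have ind2: "indep_var borel (\<lambda>\<omega>. (\<phi> b \<omega>)\<^sup>2) borel (\<lambda>\<omega>. (\<xi> b \<omega>)\<^sup>2)"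
        by (simp add: o_def)
      note sq = indep_var_integrable[OF ind2 I\<phi>2 noise_sq_integrable[OF bN vb]]
        indep_var_lebesgue_integral[OF ind2 I\<phi>2 noise_sq_integrable[OF bN vb]]
      have expand: "(\<Sum>l\<in>insert b A. \<phi> l \<omega> * \<xi> l \<omega>)\<^sup>2
          = (S \<omega>)\<^sup>2 + 2 * (S \<omega> * \<phi> b \<omega> * \<xi> b \<omega>) + (\<phi> b \<omega>)\<^sup>2 * (\<xi> b \<omega>)\<^sup>2" for \<omega>
        unfolding sum_eq by (simp add: power2_sum power_mult_distrib)
      show ?thesis
        unfolding expand using IS cross sq ES bA insert.hyps(1) noise_var[OF bN vb]
        by simp
    qed
  qed
  then show "integrable M (\<lambda>\<omega>. (\<Sum>l\<in>A. \<phi> l \<omega> * \<xi> l \<omega>)\<^sup>2)"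
    "expectation (\<lambda>\<omega>. (\<Sum>l\<in>A. \<phi> l \<omega> * \<xi> l \<omega>)\<^sup>2)
           = (\<Sum>l\<in>A. v l * expectation (\<lambda>\<omega>. (\<phi> l \<omega>)\<^sup>2))" by auto
qed

text \<open>Partial sums of nonnegative terms increase, so the terms that are kept form an initial
  segment, and their total is the last partial sum not exceeding \<delta>.\<close>

lemma stopped_sum_le:
  fixes a :: "nat \<Rightarrow> real"
  assumes "0 \<le> \<delta>" "\<And>l. 0 \<le> a l"
  shows "(\<Sum>l<n. if (\<Sum>j\<le>l. a j) \<le> \<delta> then a l else 0) \<le> \<delta>"
proof (induction n)
  case (Suc n)
  show ?case
  proof (cases "(\<Sum>j\<le>n. a j) \<le> \<delta>")
    case True
    have "(\<Sum>j\<le>l. a j) \<le> \<delta>" if "l \<le> n" for l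
      using True sum_mono2[of "{..n}" "{..l}" a] assms(2) that by auto
    then have "(\<Sum>l<Suc n. if (\<Sum>j\<le>l. a j) \<le> \<delta> then a l else 0) = (\<Sum>l\<le>n. a l)"
      unfolding lessThan_Suc_atMost by (intro sum.cong) auto
    then show ?thesis using True by simp
  qed (use Suc in simp)
qed (use assms in simp)

text \<open>A Lenglart-type inequality: the coefficients are switched off as soon as the accumulated
  variance exceeds \<open>\<delta>\<close>. Since \<open>\<Sum>\<^sub>j\<^sub>\<le>\<^sub>l h\<^sub>j\<^sup>2 v\<^sub>j\<close> is known at time \<open>l\<close>, this keeps the coefficients predictable.\<close>

lemma lenglart:
  assumes h: "\<And>l. l < N \<Longrightarrow> h l \<in> borel_measurable (G l)"
    and "0 < \<epsilon>" "0 < \<delta>" "finite J"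
  shows "prob {\<omega> \<in> space M. \<epsilon> < (\<Sum>j\<in>J. (\<Sum>l\<in>{l. l < N \<and> c l = j}. h l \<omega> * \<xi> l \<omega>)\<^sup>2)}
    \<le> prob {\<omega> \<in> space M. \<delta> < (\<Sum>l<N. (h l \<omega>)\<^sup>2 * v l)} + \<delta> / \<epsilon>"
proof -
  define Q where "Q l \<omega> = (\<Sum>j\<le>l. (h j \<omega>)\<^sup>2 * v j)" for l \<omega>
  \<comment> \<open>The second condition removes coefficients at degenerate steps: they do not count
    in \<open>Q\<close> and could be unbounded, while the noise they multiply is zero.\<close>
  define \<phi> where "\<phi> l \<omega> = (if Q l \<omega> \<le> \<delta> \<and> 0 < v l then h l \<omega> else 0)" for l \<omega>
  have Q_meas: "Q l \<in> borel_measurable (G l)" if "l < N" for l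
    unfolding Q_def
  proof (intro borel_measurable_sum borel_measurable_times borel_measurable_power borel_measurable_const)
    fix j assume "j \<in> {..l}"
    then show "h j \<in> borel_measurable (G l)" using h[of j] that by (auto intro: measurable_G_mono)
  qed
  have \<phi>_meas: "\<phi> l \<in> borel_measurable (G l)" if "l < N" for l
    unfolding \<phi>_def using Q_meas[OF that] h[OF that] by measurable
  \<comment> \<open>As \<open>Q l\<close> already contains the term of index l, a coefficient that
    is switched on has its square times \<open>v l\<close> below \<delta>. Stopping thus gives the
    deterministic bound required by the isometry.\<close>
  have \<phi>_bound: "\<bar>\<phi> l \<omega>\<bar> \<le> sqrt (\<delta> / v l)" for l \<omega>
  proof (cases "Q l \<omega> \<le> \<delta> \<and> 0 < v l")
    case True
    have "(h l \<omega>)\<^sup>2 * v l \<le> Q l \<omega>"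
      unfolding Q_def by (rule member_le_sum) (auto simp: v_nonneg)
    then have "(h l \<omega>)\<^sup>2 \<le> \<delta> / v l" using True by (simp add: field_simps)
    then show ?thesis using True by (simp add: \<phi>_def real_le_rsqrt)
  qed (use assms(3) v_nonneg in \<open>auto simp: \<phi>_def\<close>)
  \<comment> \<open>The labels \<open>c\<close> cut the indices into blocks. A constant label yields
    the square of the whole sum, an injective one yields the sum of the squared terms, and both
    versions are needed later.\<close>
  let ?L = "\<lambda>j. {l. l < N \<and> c l = j}"
  let ?S = "\<lambda>f \<omega>. \<Sum>j\<in>J. (\<Sum>l\<in>?L j. f l \<omega> * \<xi> l \<omega>)\<^sup>2"
  have L: "?L j \<subseteq> {..<N}" for j by auto
  note iso = isometry[OF L \<phi>_meas \<phi>_bound, simplified]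
  have I\<phi>2: "integrable M (\<lambda>\<omega>. (\<phi> l \<omega>)\<^sup>2)" if "l < N" for l
  proof (rule integrable_const_bound[of _ "\<delta> / v l"])
    show "AE \<omega> in M. norm ((\<phi> l \<omega>)\<^sup>2) \<le> \<delta> / v l"
      using \<phi>_bound[of l] v_nonneg[of l] assms(3) by (intro AE_I2) (simp add: sqrt_ge_absD)
    show "(\<lambda>\<omega>. (\<phi> l \<omega>)\<^sup>2) \<in> borel_measurable M"
      using measurable_G_M[OF \<phi>_meas[OF that]] that by auto
  qed
  have Int: "integrable M (?S \<phi>)" using iso(1) by auto
  have "expectation (?S \<phi>) = (\<Sum>j\<in>J. \<Sum>l\<in>?L j. v l * expectation (\<lambda>\<omega>. (\<phi> l \<omega>)\<^sup>2))"
    using iso by simp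
  also have "\<dots> = (\<Sum>l\<in>(\<Union>j\<in>J. ?L j). v l * expectation (\<lambda>\<omega>. (\<phi> l \<omega>)\<^sup>2))"
    by (rule sum.UNION_disjoint[symmetric]) (use assms(4) in auto)
  also have "\<dots> \<le> (\<Sum>l<N. v l * expectation (\<lambda>\<omega>. (\<phi> l \<omega>)\<^sup>2))"
    by (rule sum_mono2) (auto simp: v_nonneg)
  also have "\<dots> = expectation (\<lambda>\<omega>. \<Sum>l<N. v l * (\<phi> l \<omega>)\<^sup>2)"
    by (subst Bochner_Integration.integral_sum) (use I\<phi>2 in auto)
  also have "\<dots> \<le> expectation (\<lambda>\<omega>. \<delta>)"
  proof (rule integral_mono)
    fix \<omega>
    have "(\<Sum>l<N. v l * (\<phi> l \<omega>)\<^sup>2)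
      \<le> (\<Sum>l<N. if (\<Sum>j\<le>l. (h j \<omega>)\<^sup>2 * v j) \<le> \<delta> then (h l \<omega>)\<^sup>2 * v l else 0)"
      by (rule sum_mono) (auto simp: \<phi>_def Q_def v_nonneg)
    also have "\<dots> \<le> \<delta>"
      by (rule stopped_sum_le) (use assms(3) v_nonneg in auto)
    finally show "(\<Sum>l<N. v l * (\<phi> l \<omega>)\<^sup>2) \<le> \<delta>" .
  qed (use I\<phi>2 in auto)
  finally have E: "expectation (?S \<phi>) \<le> \<delta>" by (simp add: prob_space)
  have hM[measurable]: "h l \<in> borel_measurable M" "\<xi> l \<in> borel_measurable M" if "l < N" for l
    using that h[of l] noise_meas[of l] by (auto intro: measurable_G_M)
  have Sh[measurable]: "?S h \<in> borel_measurable M"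
    by (intro borel_measurable_sum borel_measurable_times borel_measurable_power) (auto intro: hM)
  have Qh[measurable]: "(\<lambda>\<omega>. \<Sum>l<N. (h l \<omega>)\<^sup>2 * v l) \<in> borel_measurable M"
    by (intro borel_measurable_sum borel_measurable_times borel_measurable_power) (auto intro: hM)
  \<comment> \<open>If the total variance stays below \<delta>, no coefficient with positive
    variance is ever switched off. The bad event is therefore covered by excess variance and by a
    large stopped sum, and Markov's inequality handles the latter.\<close>
  have "?S h \<omega> = ?S \<phi> \<omega>" if "(\<Sum>l<N. (h l \<omega>)\<^sup>2 * v l) \<le> \<delta>" for \<omega>
  proof (intro sum.cong refl arg_cong[where f="\<lambda>x. x\<^sup>2"])
    fix j l assume "l \<in> ?L j"
    then have l: "l < N" by simp
    have "Q l \<omega> \<le> (\<Sum>l<N. (h l \<omega>)\<^sup>2 * v l)"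
      unfolding Q_def by (rule sum_mono2) (use l v_nonneg in auto)
    then show "h l \<omega> * \<xi> l \<omega> = \<phi> l \<omega> * \<xi> l \<omega>"
      using that noise_null[OF l, of \<omega>] v_nonneg[of l] by (auto simp: \<phi>_def)
  qed
  then have "{\<omega> \<in> space M. \<epsilon> < ?S h \<omega>}
      \<subseteq> {\<omega> \<in> space M. \<delta> < (\<Sum>l<N. (h l \<omega>)\<^sup>2 * v l)} \<union> {\<omega> \<in> space M. \<epsilon> \<le> ?S \<phi> \<omega>}"
    by (auto simp: not_less intro: less_imp_le)
  then have "prob {\<omega> \<in> space M. \<epsilon> < ?S h \<omega>}
      \<le> prob ({\<omega> \<in> space M. \<delta> < (\<Sum>l<N. (h l \<omega>)\<^sup>2 * v l)} \<union> {\<omega> \<in> space M. \<epsilon> \<le> ?S \<phi> \<omega>})"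
    using borel_measurable_integrable[OF Int] by (intro finite_measure_mono) auto
  also have "\<dots> \<le> prob {\<omega> \<in> space M. \<delta> < (\<Sum>l<N. (h l \<omega>)\<^sup>2 * v l)} + prob {\<omega> \<in> space M. \<epsilon> \<le> ?S \<phi> \<omega>}"
    using borel_measurable_integrable[OF Int] by (intro measure_Un_le) auto
  also have "prob {\<omega> \<in> space M. \<epsilon> \<le> ?S \<phi> \<omega>} \<le> expectation (?S \<phi>) / \<epsilon>"
    using integral_Markov_inequality_measure[OF Int, of "{}" \<epsilon>] assms(2)
    by (auto simp: sum_nonneg)
  also have "\<dots> \<le> \<delta> / \<epsilon>" using E assms(2) by (simp add: divide_right_mono)
  finally show ?thesis by simp
qed

end

section \<open>Convergence in probability\<close>

context prob_space
begin

text \<open>The truncated first moment metrises convergence in probability. Replacing the family of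
  tail probabilities by one real sequence makes diagonal and subsequence arguments
  elementary.\<close>

lemma conv_in_prob_zero_iff:
  "conv_in_prob M X (\<lambda>\<omega>. 0) \<longleftrightarrow>
     (\<forall>n. X n \<in> borel_measurable M) \<and> (\<lambda>n. expectation (\<lambda>\<omega>. min 1 \<bar>X n \<omega>\<bar>)) \<longlonglongrightarrow> 0"
proof (cases "\<forall>n. X n \<in> borel_measurable M")
  case True
  then have [measurable]: "X n \<in> borel_measurable M" for n by simp
  have I: "integrable M (\<lambda>\<omega>. min 1 \<bar>X n \<omega>\<bar>)" for n
    by (rule integrable_const_bound[of _ 1]) auto
  have "(\<lambda>n. expectation (\<lambda>\<omega>. min 1 \<bar>X n \<omega>\<bar>)) \<longlonglongrightarrow> 0"
    if *: "\<And>\<epsilon>. \<epsilon> > 0 \<Longrightarrow> (\<lambda>n. prob {\<omega> \<in> space M. \<epsilon> < \<bar>X n \<omega>\<bar>}) \<longlonglongrightarrow> 0"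
  proof (rule tendstoI)
    fix e :: real assume e: "0 < e"
    from *[of "e / 2"] e have "\<forall>\<^sub>F n in sequentially. prob {\<omega> \<in> space M. e / 2 < \<bar>X n \<omega>\<bar>} < e / 2"
      by (intro order_tendstoD) auto
    then show "\<forall>\<^sub>F n in sequentially. dist (expectation (\<lambda>\<omega>. min 1 \<bar>X n \<omega>\<bar>)) 0 < e"
    proof eventually_elim
      case (elim n)
      let ?A = "{\<omega> \<in> space M. e / 2 < \<bar>X n \<omega>\<bar>}"
      have A: "integrable M (indicator ?A :: _ \<Rightarrow> real)"
        by (intro integrable_real_indicator) (auto simp: less_top[symmetric])
      have "expectation (\<lambda>\<omega>. min 1 \<bar>X n \<omega>\<bar>) \<le> expectation (\<lambda>\<omega>. e / 2 + indicator ?A \<omega>)"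
        by (rule integral_mono[OF I Bochner_Integration.integrable_add[OF integrable_const A]])
          (use e in \<open>auto simp: indicator_def\<close>)
      also have "\<dots> = e / 2 + prob ?A"
        by (subst Bochner_Integration.integral_add[OF integrable_const A])
          (auto simp: prob_space Int_def intro!: arg_cong[where f = prob])
      finally have "expectation (\<lambda>\<omega>. min 1 \<bar>X n \<omega>\<bar>) < e" using elim by simp
      moreover have "0 \<le> expectation (\<lambda>\<omega>. min 1 \<bar>X n \<omega>\<bar>)" by simp
      ultimately show ?case by simp
    qed
  qed
  moreover have "(\<lambda>n. prob {\<omega> \<in> space M. \<epsilon> < \<bar>X n \<omega>\<bar>}) \<longlonglongrightarrow> 0"
    if *: "(\<lambda>n. expectation (\<lambda>\<omega>. min 1 \<bar>X n \<omega>\<bar>)) \<longlonglongrightarrow> 0" and \<epsilon>: "0 < \<epsilon>" for \<epsilon>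
  proof (rule tendsto_sandwich[OF _ _ tendsto_const])
    show "(\<lambda>n. expectation (\<lambda>\<omega>. min 1 \<bar>X n \<omega>\<bar>) / min 1 \<epsilon>) \<longlonglongrightarrow> 0"
      using tendsto_divide[OF * tendsto_const[of "min 1 \<epsilon>"]] \<epsilon> by auto
    have "prob {\<omega> \<in> space M. \<epsilon> < \<bar>X n \<omega>\<bar>} \<le> prob {\<omega> \<in> space M. min 1 \<epsilon> \<le> min 1 \<bar>X n \<omega>\<bar>}" for n
      by (rule finite_measure_mono) auto
    also have "\<dots> n \<le> expectation (\<lambda>\<omega>. min 1 \<bar>X n \<omega>\<bar>) / min 1 \<epsilon>" for n
      by (rule integral_Markov_inequality_measure[of _ _ "{}"]) (use I \<epsilon> in auto)
    finally show "\<forall>\<^sub>F n in sequentially. prob {\<omega> \<in> space M. \<epsilon> < \<bar>X n \<omega>\<bar>}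
        \<le> expectation (\<lambda>\<omega>. min 1 \<bar>X n \<omega>\<bar>) / min 1 \<epsilon>" by simp
  qed auto
  ultimately show ?thesis
    using True unfolding conv_in_prob_def by auto
next
  case False
  then show ?thesis unfolding conv_in_prob_def by blast
qed

lemma conv_in_prob_minus: 
  assumes "\<And>n. X n \<in> borel_measurable M" "Y \<in> borel_measurable M"
  shows "conv_in_prob M X Y \<longleftrightarrow> conv_in_prob M (\<lambda>n \<omega>. X n \<omega> - Y \<omega>) (\<lambda>\<omega>. 0)"
  using assms unfolding conv_in_prob_def by auto

text \<open>Absolute values are taken inside so that the combined sequence dominates each summand. A
  subsequence along which it tends to zero then works for both at once.\<close>

lemma conv_in_prob_zero_add:
  assumes "conv_in_prob M X (\<lambda>\<omega>. 0)" "conv_in_prob M Y (\<lambda>\<omega>. 0)"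
  shows "conv_in_prob M (\<lambda>n \<omega>. \<bar>X n \<omega>\<bar> + \<bar>Y n \<omega>\<bar>) (\<lambda>\<omega>. 0)"
proof -
  have [measurable]: "X n \<in> borel_measurable M" "Y n \<in> borel_measurable M" for n
    using assms by (auto simp add: conv_in_prob_def)
  have I: "integrable M (\<lambda>\<omega>. min 1 \<bar>X n \<omega>\<bar>)" "integrable M (\<lambda>\<omega>. min 1 \<bar>Y n \<omega>\<bar>)" for n
    by (auto intro!: integrable_const_bound[of _ 1])
  have "(\<lambda>n. expectation (\<lambda>\<omega>. min 1 \<bar>\<bar>X n \<omega>\<bar> + \<bar>Y n \<omega>\<bar>\<bar>)) \<longlonglongrightarrow> 0"
  proof (rule tendsto_sandwich[OF _ _ tendsto_const])
    show "(\<lambda>n. expectation (\<lambda>\<omega>. min 1 \<bar>X n \<omega>\<bar>) + expectation (\<lambda>\<omega>. min 1 \<bar>Y n \<omega>\<bar>)) \<longlonglongrightarrow> 0"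
      using tendsto_add[of "\<lambda>n. expectation (\<lambda>\<omega>. min 1 \<bar>X n \<omega>\<bar>)" 0] assms
      unfolding conv_in_prob_zero_iff by fastforce
    have "expectation (\<lambda>\<omega>. min 1 \<bar>\<bar>X n \<omega>\<bar> + \<bar>Y n \<omega>\<bar>\<bar>)
        \<le> expectation (\<lambda>\<omega>. min 1 \<bar>X n \<omega>\<bar> + min 1 \<bar>Y n \<omega>\<bar>)" for n
      by (rule integral_mono) (use I in \<open>auto intro!: integrable_const_bound[of _ 1]\<close>)
    then show "\<forall>\<^sub>F n in sequentially. expectation (\<lambda>\<omega>. min 1 \<bar>\<bar>X n \<omega>\<bar> + \<bar>Y n \<omega>\<bar>\<bar>)
      \<le> expectation (\<lambda>\<omega>. min 1 \<bar>X n \<omega>\<bar>) + expectation (\<lambda>\<omega>. min 1 \<bar>Y n \<omega>\<bar>)"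
      using I by simp
  qed auto
  then show ?thesis unfolding conv_in_prob_zero_iff by auto
qed

lemma conv_in_prob_zero_sum:
  assumes "finite J" "\<And>j. j \<in> J \<Longrightarrow> conv_in_prob M (X j) (\<lambda>\<omega>. 0)"
  shows "conv_in_prob M (\<lambda>n \<omega>. \<Sum>j\<in>J. \<bar>X j n \<omega>\<bar>) (\<lambda>\<omega>. 0)"
  using assms
proof (induction J rule: finite_induct)
  case empty
  then show ?case by (simp add: conv_in_prob_def)
next
  case (insert j J)
  then have "conv_in_prob M (\<lambda>n \<omega>. \<bar>X j n \<omega>\<bar> + \<bar>\<Sum>j\<in>J. \<bar>X j n \<omega>\<bar>\<bar>) (\<lambda>\<omega>. 0)"
    by (intro conv_in_prob_zero_add) auto
  then show ?case using insert by simp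
qed

lemma conv_in_prob_zero_subseq:
  assumes "conv_in_prob M X (\<lambda>\<omega>. 0)"
  shows "\<exists>r::nat\<Rightarrow>nat. strict_mono r \<and> (AE \<omega> in M. (\<lambda>n. X (r n) \<omega>) \<longlonglongrightarrow> 0)"
proof -
  have [measurable]: "X n \<in> borel_measurable M" for n using assms by (auto simp add: conv_in_prob_def)
  have "(\<lambda>n. expectation (\<lambda>\<omega>. norm (min 1 \<bar>X n \<omega>\<bar>))) \<longlonglongrightarrow> 0"
    using assms unfolding conv_in_prob_zero_iff by simp
  moreover have "integrable M (\<lambda>\<omega>. min 1 \<bar>X n \<omega>\<bar>)" for n
    by (auto intro!: integrable_const_bound[of _ 1])
  ultimately obtain r where r: "strict_mono r" "AE \<omega> in M. (\<lambda>n. min 1 \<bar>X (r n) \<omega>\<bar>) \<longlonglongrightarrow> 0"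
    using tendsto_L1_AE_subseq[of M "\<lambda>n \<omega>. min 1 \<bar>X n \<omega>\<bar>"] by blast
  have "x \<longlonglongrightarrow> 0" if *: "(\<lambda>n. min 1 \<bar>x n :: real\<bar>) \<longlonglongrightarrow> 0" for x
  proof -
    have "\<forall>\<^sub>F n in sequentially. min 1 \<bar>x n\<bar> < 1" using * by (rule order_tendstoD) simp
    then have "\<forall>\<^sub>F n in sequentially. min 1 \<bar>x n\<bar> = \<bar>x n\<bar>" by eventually_elim auto
    then have "(\<lambda>n. \<bar>x n\<bar>) \<longlonglongrightarrow> 0" using * by (rule Lim_transform_eventually[rotated])
    then show ?thesis by (simp add: tendsto_rabs_zero_iff)
  qed
  then show ?thesis using r by auto
qed

text \<open>Convergence in probability amounts to almost sure convergence along a further subsequence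
  of every subsequence, which reduces limits in probability to limits along single paths.\<close>

lemma conv_in_prob_transfer:
  assumes X: "conv_in_prob M X (\<lambda>\<omega>. 0)"
    and Y: "\<And>n. Y n \<in> borel_measurable M" "Z \<in> borel_measurable M"
    and path: "AE \<omega> in M. \<forall>r. strict_mono r \<longrightarrow> (\<lambda>n. X (r n) \<omega>) \<longlonglongrightarrow> 0 \<longrightarrow> (\<lambda>n. Y (r n) \<omega>) \<longlonglongrightarrow> Z \<omega>"
  shows "conv_in_prob M Y Z"
proof -
  note [measurable] = Y
  let ?a = "\<lambda>n. expectation (\<lambda>\<omega>. min 1 \<bar>Y n \<omega> - Z \<omega>\<bar>)"
  have "\<exists>r'. strict_mono r' \<and> (\<lambda>n. ?a (r (r' n))) \<longlonglongrightarrow> 0" if r: "strict_mono r" for r :: "nat \<Rightarrow> nat"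
  proof -
    have "conv_in_prob M (\<lambda>n. X (r n)) (\<lambda>\<omega>. 0)"
      using X LIMSEQ_subseq_LIMSEQ[OF _ r] unfolding conv_in_prob_def by (auto simp: o_def)
    from conv_in_prob_zero_subseq[OF this] obtain r' where
      r': "strict_mono r'" "AE \<omega> in M. (\<lambda>n. X (r (r' n)) \<omega>) \<longlonglongrightarrow> 0" by blast
    have rr: "strict_mono (\<lambda>n. r (r' n))" using r r'(1) by (simp add: strict_mono_def)
    \<comment> \<open>The exceptional null set in \<open>path\<close> does not depend on the
      subsequence, which allows its use for a composite obtained only now by a probabilistic
      argument.\<close>
    have "AE \<omega> in M. (\<lambda>n. Y (r (r' n)) \<omega>) \<longlonglongrightarrow> Z \<omega>"
      using path r'(2) by eventually_elim (use rr in blast)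
    then have "(\<lambda>n. ?a (r (r' n))) \<longlonglongrightarrow> expectation (\<lambda>\<omega>. 0)"
    proof (intro integral_dominated_convergence[where w = "\<lambda>_. 1"])
      show "AE \<omega> in M. (\<lambda>n. min 1 \<bar>Y (r (r' n)) \<omega> - Z \<omega>\<bar>) \<longlonglongrightarrow> 0"
        if "AE \<omega> in M. (\<lambda>n. Y (r (r' n)) \<omega>) \<longlonglongrightarrow> Z \<omega>"
        using that
      proof eventually_elim
        case (elim \<omega>)
        then have "(\<lambda>n. min 1 \<bar>Y (r (r' n)) \<omega> - Z \<omega>\<bar>) \<longlonglongrightarrow> min 1 \<bar>Z \<omega> - Z \<omega>\<bar>"
          by (intro tendsto_intros)
        then show ?case by simp
      qed
    qed auto
    then show ?thesis using r'(1) by auto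
  qed
  moreover have "?a \<longlonglongrightarrow> 0" if *: "\<And>r::nat\<Rightarrow>nat. strict_mono r \<Longrightarrow> \<exists>r'. strict_mono r' \<and> (\<lambda>n. ?a (r (r' n))) \<longlonglongrightarrow> 0"
  proof (rule ccontr)
    assume "\<not> ?a \<longlonglongrightarrow> 0"
    then obtain e where e: "e > 0" "\<exists>\<^sub>F n in sequentially. \<not> dist (?a n) 0 < e"
      unfolding tendsto_iff frequently_def by auto
    then have inf: "infinite {n. \<not> dist (?a n) 0 < e}"
      unfolding frequently_cofinite[symmetric] cofinite_eq_sequentially by simp
    \<comment> \<open>Enumerating the infinitely many bad indices gives a subsequence none of whose
      further subsequences can converge to zero.\<close>
    define r where "r = enumerate {n. \<not> dist (?a n) 0 < e}"
    have r: "strict_mono r" "\<And>n. \<not> dist (?a (r n)) 0 < e"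
      using strict_mono_enumerate[OF inf] enumerate_in_set[OF inf] by (auto simp: r_def)
    obtain r' where "(\<lambda>n. ?a (r (r' n))) \<longlonglongrightarrow> 0" using *[OF r(1)] by blast
    then have "\<forall>\<^sub>F n in sequentially. dist (?a (r (r' n))) 0 < e" using e(1) by (rule tendstoD)
    then show False using r(2) by simp
  qed
  ultimately have "?a \<longlonglongrightarrow> 0" by blast
  then show ?thesis
    unfolding conv_in_prob_minus[OF Y] conv_in_prob_zero_iff by auto
qed

lemma conv_in_prob_AE_zero:
  assumes "\<And>n. Y n \<in> borel_measurable M" "AE \<omega> in M. (\<lambda>n. Y n \<omega>) \<longlonglongrightarrow> 0"
  shows "conv_in_prob M Y (\<lambda>\<omega>. 0)"
proof (rule conv_in_prob_transfer[where X = "\<lambda>_ _. 0"])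
  show "AE \<omega> in M. \<forall>r. strict_mono r \<longrightarrow> (\<lambda>n. 0) \<longlonglongrightarrow> (0::real) \<longrightarrow> (\<lambda>n. Y (r n) \<omega>) \<longlonglongrightarrow> 0"
    using assms(2) by eventually_elim (auto dest: LIMSEQ_subseq_LIMSEQ simp: o_def)
qed (use assms in \<open>auto simp: conv_in_prob_def\<close>)

text \<open>For each \<open>n\<close> take an \<open>m\<close> whose truncated moment is below
  \<open>1 / (n + 1)\<close>. This is how an approximating integrand is fitted to each grid.\<close>

lemma conv_in_prob_diagonal:
  assumes "\<And>n::nat. conv_in_prob M (X n) (\<lambda>\<omega>. 0)"
  shows "\<exists>m::nat\<Rightarrow>nat. conv_in_prob M (\<lambda>n. X n (m n)) (\<lambda>\<omega>. 0)"
proof -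
  let ?a = "\<lambda>n m. expectation (\<lambda>\<omega>. min 1 \<bar>X n m \<omega>\<bar>)"
  have "\<exists>m. ?a n m < 1 / real (Suc n)" for n
  proof -
    have "?a n \<longlonglongrightarrow> 0" using assms[of n] unfolding conv_in_prob_zero_iff by simp
    then have "\<forall>\<^sub>F m in sequentially. ?a n m < 1 / real (Suc n)" by (rule order_tendstoD) simp
    then show ?thesis by (auto simp: eventually_sequentially)
  qed
  then obtain m where m: "\<And>n. ?a n (m n) < 1 / real (Suc n)" by metis
  have "(\<lambda>n. ?a n (m n)) \<longlonglongrightarrow> 0"
  proof (rule tendsto_sandwich[OF _ _ tendsto_const])
    show "(\<lambda>n. 1 / real (Suc n)) \<longlonglongrightarrow> 0" by (rule LIMSEQ_Suc[OF lim_1_over_n])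
    show "\<forall>\<^sub>F n in sequentially. ?a n (m n) \<le> 1 / real (Suc n)"
      by (intro always_eventually allI less_imp_le m)
  qed auto
  moreover have "X n (m n) \<in> borel_measurable M" for n using assms[of n] by (auto simp: conv_in_prob_def)
  ultimately show ?thesis unfolding conv_in_prob_zero_iff by blast
qed

text \<open>The hypothesis has the form of the Lenglart inequality. Because \<delta> is free, it can
  be tied to \<epsilon> so that the quotient is half the tolerance, after which only the convergence
  of \<open>V\<close> is needed.\<close>

lemma conv_in_prob_dominated:
  assumes V: "conv_in_prob M V (\<lambda>\<omega>. 0)" and Y: "\<And>n. Y n \<in> borel_measurable M"
    and dom: "\<And>n \<epsilon> \<delta>. 0 < \<epsilon> \<Longrightarrow> 0 < \<delta> \<Longrightarrow>
      prob {\<omega> \<in> space M. \<epsilon> < \<bar>Y n \<omega>\<bar>} \<le> prob {\<omega> \<in> space M. \<delta> < \<bar>V n \<omega>\<bar>} + \<delta> / \<epsilon>"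
  shows "conv_in_prob M Y (\<lambda>\<omega>. 0)"
  unfolding conv_in_prob_def
proof (intro conjI allI impI)
  fix \<epsilon> :: real assume \<epsilon>: "0 < \<epsilon>"
  show "(\<lambda>n. prob {\<omega> \<in> space M. \<epsilon> < \<bar>Y n \<omega> - 0\<bar>}) \<longlonglongrightarrow> 0"
  proof (rule tendstoI)
    fix e :: real assume e: "0 < e"
    define \<delta> where "\<delta> = \<epsilon> * e / 2"
    have \<delta>: "0 < \<delta>" using \<epsilon> e by (simp add: \<delta>_def)
    have "\<forall>\<^sub>F n in sequentially. prob {\<omega> \<in> space M. \<delta> < \<bar>V n \<omega> - 0\<bar>} < e / 2"
      using V \<delta> e unfolding conv_in_prob_def by (intro order_tendstoD(2)[where y = 0]) auto
    then show "\<forall>\<^sub>F n in sequentially. dist (prob {\<omega> \<in> space M. \<epsilon> < \<bar>Y n \<omega> - 0\<bar>}) 0 < e"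
    proof eventually_elim
      case (elim n)
      have "\<delta> / \<epsilon> = e / 2" using \<epsilon> by (simp add: \<delta>_def)
      then show ?case using elim dom[OF \<epsilon> \<delta>, of n] by simp
    qed
  qed
qed (use Y in auto)

end

section \<open>Independence of Brownian increments\<close>

locale wiener = prob_space P + complete_measure P for P :: "'a measure" +
  fixes T :: real and W :: "real \<Rightarrow> 'a \<Rightarrow> real" and F :: "real \<Rightarrow> 'a measure"
  assumes T_pos: "0 < T" and bm: "brownian_motion P T W" and F_def: "F = augmented_filtration P W"
begin

lemma W_measurable: "t \<in> {0..T} \<Longrightarrow> W t \<in> borel_measurable P"
  and W_zero: "AE \<omega> in P. W 0 \<omega> = 0"
  and W_continuous: "AE \<omega> in P. continuous_on {0..T} (\<lambda>t. W t \<omega>)"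
  and W_normal: "0 \<le> s \<Longrightarrow> s < t \<Longrightarrow> t \<le> T \<Longrightarrow> distributed P lborel (\<lambda>\<omega>. W t \<omega> - W s \<omega>)
          (\<lambda>x. ennreal (normal_density 0 (sqrt (t - s)) x))"
  and W_indep: "mono_on {..n} \<tau> \<Longrightarrow> \<tau> ` {..n} \<subseteq> {0..T} \<Longrightarrow>
        indep_vars (\<lambda>_. borel) (\<lambda>i \<omega>. W (\<tau> (Suc i)) \<omega> - W (\<tau> i) \<omega>) {..<n}"
  using bm unfolding brownian_motion_def by auto

abbreviation "history t \<equiv> {W s -` A \<inter> space P | s A. s \<in> {0..t} \<and> A \<in> sets borel}"

lemma history_subset: "history t \<union> null_sets P \<subseteq> Pow (space P)"
  using sets.sets_into_space by blast

lemma space_F [simp]: "space (F t) = space P"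
  unfolding F_def augmented_filtration_def by (rule space_measure_of[OF history_subset])

lemma sets_F: "sets (F t) = sigma_sets (space P) (history t \<union> null_sets P)"
  unfolding F_def augmented_filtration_def using history_subset by simp

lemma null_sets_F: "A \<in> null_sets P \<Longrightarrow> A \<in> sets (F t)"
  unfolding sets_F by (auto intro: sigma_sets.Basic)

lemma F_mono: "s \<le> t \<Longrightarrow> sets (F s) \<subseteq> sets (F t)"
  unfolding sets_F by (intro sigma_sets_subseteq Un_mono Collect_mono) force+

lemma F_subset: "t \<le> T \<Longrightarrow> sets (F t) \<subseteq> sets P"
  unfolding sets_F by (rule sets.sigma_sets_subset) (auto intro!: measurable_sets[OF W_measurable])

lemma subalgebra_F: "t \<le> T \<Longrightarrow> subalgebra P (F t)"
  using F_subset unfolding subalgebra_def by simp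

lemma measurable_F_mono: "f \<in> borel_measurable (F s) \<Longrightarrow> s \<le> t \<Longrightarrow> f \<in> borel_measurable (F t)"
  using F_mono[of s t] unfolding measurable_def by auto

lemma measurable_F_P: "f \<in> borel_measurable (F s) \<Longrightarrow> s \<le> T \<Longrightarrow> f \<in> borel_measurable P"
  using subalgebra_F measurable_from_subalg by blast

lemma W_adapted: "0 \<le> s \<Longrightarrow> s \<le> t \<Longrightarrow> W s \<in> borel_measurable (F t)"
  by (rule measurableI) (auto simp: sets_F intro!: sigma_sets.Basic)

text \<open>Completeness makes every subset of a null set measurable, and augmentation places null
  sets in each \<open>F t\<close>. Hence a change on a null set preserves measurability even with
  respect to the past.\<close>

lemma measurable_AE_cong:
  assumes N: "space N = space P" "null_sets P \<subseteq> sets N"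
    and Y: "Y \<in> borel_measurable N" and eq: "AE \<omega> in P. X \<omega> = (Y \<omega> :: real)"
  shows "X \<in> borel_measurable N"
proof (rule measurableI)
  fix A :: "real set" assume A: "A \<in> sets borel"
  let ?D = "{\<omega> \<in> space P. X \<omega> \<noteq> Y \<omega>}"
  have D: "?D \<in> null_sets P" using eq unfolding AE_iff_null_sets .
  then have "X -` A \<inter> ?D \<in> null_sets P" by (rule complete2[rotated]) auto
  then have "((Y -` A \<inter> space N) - ?D) \<union> (X -` A \<inter> ?D) \<in> sets N"
    using N(2) D measurable_sets[OF Y A] by (intro sets.Un sets.Diff) auto
  also have "((Y -` A \<inter> space N) - ?D) \<union> (X -` A \<inter> ?D) = X -` A \<inter> space N" using N(1) by auto
  finally show "X -` A \<inter> space N \<in> sets N" .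
qed simp

lemma measurable_F_AE_cong:
  "Y \<in> borel_measurable (F t) \<Longrightarrow> AE \<omega> in P. X \<omega> = (Y \<omega> :: real) \<Longrightarrow> X \<in> borel_measurable (F t)"
  by (rule measurable_AE_cong[of "F t"]) (auto simp: null_sets_F)

lemma measurable_P_AE_cong:
  "Y \<in> borel_measurable P \<Longrightarrow> AE \<omega> in P. X \<omega> = (Y \<omega> :: real) \<Longrightarrow> X \<in> borel_measurable P"
  by (rule measurable_AE_cong[of P]) auto

lemma measurable_F_AE_LIMSEQ:
  fixes X :: "nat \<Rightarrow> 'a \<Rightarrow> real"
  assumes "\<And>n. X n \<in> borel_measurable (F t)" "AE \<omega> in P. (\<lambda>n. X n \<omega>) \<longlonglongrightarrow> Y \<omega>"
  shows "Y \<in> borel_measurable (F t)"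
proof (rule measurable_F_AE_cong)
  \<comment> \<open>\<open>lim\<close> is total and measurable whatever value it takes on divergent
    sequences, and it agrees with \<open>Y\<close> almost surely.\<close>
  show "(\<lambda>\<omega>. lim (\<lambda>n. X n \<omega>)) \<in> borel_measurable (F t)"
    by (rule borel_measurable_lim_metric) (rule assms)
  show "AE \<omega> in P. Y \<omega> = lim (\<lambda>n. X n \<omega>)"
    using assms(2) by eventually_elim (simp add: limI)
qed

text \<open>Since W starts at 0 almost surely, its values at finitely many times up to s are partial
  sums of earlier increments. The claim thus reduces to independence of increments along one finite
  partition ending with the interval from s to t.\<close>

lemma finite_history_indep:
  assumes s: "0 \<le> s" "s < t" "t \<le> T" and R: "finite R" "R \<subseteq> {0..s}"
    and A: "\<And>r. r \<in> R \<Longrightarrow> A r \<in> sets borel" and B: "B \<in> sets borel"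
  shows "prob ({\<omega> \<in> space P. \<forall>r\<in>R. W r \<omega> \<in> A r} \<inter> ((\<lambda>\<omega>. W t \<omega> - W s \<omega>) -` B \<inter> space P))
    = prob {\<omega> \<in> space P. \<forall>r\<in>R. W r \<omega> \<in> A r} * prob ((\<lambda>\<omega>. W t \<omega> - W s \<omega>) -` B \<inter> space P)"
proof -
  \<comment> \<open>Adjoining 0 makes the partial sums start at W 0, and adjoining s makes the last
    node before t equal to s.\<close>
  define R' where "R' = R \<union> {0, s}"
  define p where "p = sorted_list_of_set R'"
  define k where "k = length p"
  have fin: "finite R'" using R by (simp add: R'_def)
  have sp: "set p = R'" "sorted p" "distinct p" using fin by (auto simp: p_def)
  have R'_sub: "R' \<subseteq> {0..s}" using R s by (auto simp: R'_def)
  have k: "0 < k" using sp(1) by (auto simp: k_def R'_def)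
  have p0: "p ! 0 = 0"
  proof -
    obtain i where i: "i < k" "p ! i = 0" using sp(1) unfolding k_def in_set_conv_nth[symmetric]
      by (metis R'_def UnI2 in_set_conv_nth insertI1)
    have "p ! 0 \<le> p ! i" using sorted_nth_mono[OF sp(2), of 0 i] i by (simp add: k_def)
    moreover have "p ! 0 \<in> R'" using k sp(1) by (auto simp: k_def)
    ultimately show ?thesis using i R'_sub by force
  qed
  have pk: "p ! (k - 1) = s"
  proof -
    obtain i where i: "i < k" "p ! i = s" 
      by (metis R'_def UnI2 in_set_conv_nth insertI1 insertI2 k_def sp(1))
    have "p ! i \<le> p ! (k - 1)" using sorted_nth_mono[OF sp(2), of i "k - 1"] i by (simp add: k_def)
    moreover have "p ! (k - 1) \<in> R'" using k sp(1) by (auto simp: k_def)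
    ultimately show ?thesis using i R'_sub by force
  qed
  \<comment> \<open>The \<open>k\<close> nodes of \<open>R'\<close> have indices 0 to
    \<open>k - 1\<close>, and t is appended at index \<open>k\<close>. The increment of index
    \<open>k - 1\<close> is therefore the one from s to t.\<close>
  define \<tau> where "\<tau> i = (if i < k then p ! i else t)" for i
  have \<tau>_in: "\<tau> i \<in> {0..T}" for i
  proof (cases "i < k")
    case True
    then have "p ! i \<in> R'" using sp(1) by (auto simp: k_def)
    then show ?thesis using True R'_sub s by (auto simp: \<tau>_def)
  qed (use s in \<open>auto simp: \<tau>_def\<close>)
  have mono: "mono_on {..k} \<tau>"
  proof (rule mono_onI)
    fix i j assume ij: "i \<in> {..k}" "j \<in> {..k}" "i \<le> j"
    have "p ! i \<le> t" if "i < k"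
    proof -
      have "p ! i \<in> R'" using sp(1) that by (auto simp: k_def)
      then show ?thesis using R'_sub s by auto
    qed
    then show "\<tau> i \<le> \<tau> j" using ij sorted_nth_mono[OF sp(2), of i j] by (auto simp: \<tau>_def k_def)
  qed
  define D where "D i \<omega> = W (\<tau> (Suc i)) \<omega> - W (\<tau> i) \<omega>" for i \<omega>
  have "indep_vars (\<lambda>_. borel) D {..<k}"
    unfolding D_def by (rule W_indep[OF mono]) (use \<tau>_in in auto)
  from indep_var_restrict[OF this, of "{..<k-1}" "{k-1}"]
  have ind: "indep_var (PiM {..<k-1} (\<lambda>_. borel)) (\<lambda>\<omega>. restrict (\<lambda>i. D i \<omega>) {..<k-1})
      (PiM {k-1} (\<lambda>_. borel)) (\<lambda>\<omega>. restrict (\<lambda>i. D i \<omega>) {k-1})"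
    using k by auto
  have Dk: "D (k-1) = (\<lambda>\<omega>. W t \<omega> - W s \<omega>)"
    using k pk by (auto simp: D_def \<tau>_def fun_eq_iff)
  \<comment> \<open>\<open>E\<close> is the history event read off the increment vector: the sum of
    the first \<open>j\<close> increments represents W at \<open>p ! j\<close>. The largest relevant
    \<open>j\<close> is \<open>k - 1\<close>, so the increment from s to t never enters.\<close>
  define E where "E = {f \<in> space (PiM {..<k-1} (\<lambda>_. borel :: real measure)).
      \<forall>j\<in>{j. j < k \<and> p ! j \<in> R}. (\<Sum>i<j. f i) \<in> A (p ! j)}"
  have E: "E \<in> sets (PiM {..<k-1} (\<lambda>_. borel))"
    unfolding E_def
  proof (rule sets.sets_Collect_finite_All)
    fix j assume j: "j \<in> {j. j < k \<and> p ! j \<in> R}"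
    have "(\<lambda>f. \<Sum>i<j. f i) \<in> borel_measurable (PiM {..<k-1} (\<lambda>_. borel :: real measure))"
      by (intro borel_measurable_sum measurable_component_singleton) (use j in auto)
    from measurable_sets[OF this A] j
    show "{f \<in> space (PiM {..<k-1} (\<lambda>_. borel)). (\<Sum>i<j. f i) \<in> A (p ! j)}
        \<in> sets (PiM {..<k-1} (\<lambda>_. borel))"
      by (auto simp: vimage_def Int_def conj_commute)
  qed auto
  let ?V = "\<lambda>\<omega>. restrict (\<lambda>i. D i \<omega>) {..<k-1}"
  let ?H = "{\<omega> \<in> space P. \<forall>r\<in>R. W r \<omega> \<in> A r}"
  let ?C = "(\<lambda>\<omega>. W t \<omega> - W s \<omega>) -` B \<inter> space P"
  \<comment> \<open>Passing to the indicator of \<open>E\<close> replaces vectors by real random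
    variables, for which the product rule is applied with the set \<open>{1}\<close>.\<close>
  have "indep_var borel ((indicator E :: _ \<Rightarrow> real) \<circ> ?V) borel ((\<lambda>f. f (k-1)) \<circ> (\<lambda>\<omega>. restrict (\<lambda>i. D i \<omega>) {k-1}))"
    by (rule indep_var_compose[OF ind]) (use E in \<open>auto intro: measurable_component_singleton\<close>)
  then have ind': "indep_var borel (\<lambda>\<omega>. indicator E (?V \<omega>) :: real) borel (D (k-1))" by (simp add: o_def)
  have VM: "(\<lambda>\<omega>. indicator E (?V \<omega>) :: real) \<in> borel_measurable P" and DM: "D (k-1) \<in> borel_measurable P"
    using ind' unfolding indep_var_eq by auto
  have VEeq: "?V -` E \<inter> space P = (\<lambda>\<omega>. indicator E (?V \<omega>) :: real) -` {1} \<inter> space P"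
    by (auto simp: indicator_def)
  have Vsp: "?V \<omega> \<in> space (PiM {..<k-1} (\<lambda>_. borel :: real measure))" for \<omega>
    by (auto simp: space_PiM)
  have AEeq: "AE \<omega> in P. \<omega> \<in> ?H \<longleftrightarrow> \<omega> \<in> ?V -` E \<inter> space P"
    using W_zero
  proof eventually_elim
    case (elim \<omega>)
    have "(\<Sum>i<j. ?V \<omega> i) = W (p ! j) \<omega>" if "j < k" for j
    proof -
      have "(\<Sum>i<j. ?V \<omega> i) = (\<Sum>i<j. W (\<tau> (Suc i)) \<omega> - W (\<tau> i) \<omega>)"
        using that by (intro sum.cong) (auto simp: D_def)
      also have "\<dots> = W (\<tau> j) \<omega> - W (\<tau> 0) \<omega>" by (rule sum_lessThan_telescope)
      finally show ?thesis using that p0 elim by (simp add: \<tau>_def)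
    qed
    then have "?V \<omega> \<in> E \<longleftrightarrow> (\<forall>j<k. p ! j \<in> R \<longrightarrow> W (p ! j) \<omega> \<in> A (p ! j))"
      using Vsp[of \<omega>] unfolding E_def by auto
    also have "\<dots> \<longleftrightarrow> (\<forall>r\<in>set p. r \<in> R \<longrightarrow> W r \<omega> \<in> A r)"
      by (auto simp: k_def all_set_conv_all_nth)
    also have "\<dots> \<longleftrightarrow> (\<forall>r\<in>R. W r \<omega> \<in> A r)" by (auto simp: sp(1) R'_def)
    finally show ?case by auto
  qed
  have VE: "?V -` E \<inter> space P \<in> events" unfolding VEeq by (rule measurable_sets[OF VM]) simp
  have H: "?H \<in> events"
  proof (rule in_sets_AE[OF _ VE])
    show "AE \<omega> in P. \<omega> \<in> ?V -` E \<inter> space P \<longleftrightarrow> \<omega> \<in> ?H"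
      using AEeq by eventually_elim blast
  qed blast
  have C: "?C \<in> events" using measurable_sets[OF DM B] unfolding Dk .
  have VC: "?V -` E \<inter> space P \<inter> ?C
      = (\<lambda>\<omega>. (indicator E (?V \<omega>) :: real, D (k-1) \<omega>)) -` ({1} \<times> B) \<inter> space P"
    unfolding VEeq Dk by auto
  have "prob (?H \<inter> ?C) = prob ((?V -` E \<inter> space P) \<inter> ?C)"
  proof (rule finite_measure_eq_AE)
    show "AE \<omega> in P. \<omega> \<in> ?H \<inter> ?C \<longleftrightarrow> \<omega> \<in> (?V -` E \<inter> space P) \<inter> ?C"
      using AEeq by eventually_elim blast
  qed (intro sets.Int H VE C)+
  also have "\<dots> = prob (?V -` E \<inter> space P) * prob ?C"
    unfolding VC unfolding VEeq Dk[symmetric] by (rule indep_varD[OF ind' _ B]) simp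
  also have "prob (?V -` E \<inter> space P) = prob ?H"
  proof (rule finite_measure_eq_AE[OF _ VE H])
    show "AE \<omega> in P. \<omega> \<in> ?V -` E \<inter> space P \<longleftrightarrow> \<omega> \<in> ?H"
      using AEeq by eventually_elim blast
  qed
  finally show ?thesis .
qed

text \<open>Cylinder events over finitely many times up to s, together with the null sets, are
  stable under intersection and their sigma algebra contains \<open>F s\<close>. Independence on
  this family extends by the Dynkin argument; null sets must be included because the filtration is
  augmented.\<close>

lemma increment_indep:
  assumes s: "0 \<le> s" "s < t" "t \<le> T" and \<phi>: "\<phi> \<in> borel_measurable (F s)"
  shows "indep_var borel \<phi> borel (\<lambda>\<omega>. W t \<omega> - W s \<omega>)"
proof -
  let ?\<xi> = "\<lambda>\<omega>. W t \<omega> - W s \<omega>"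
  define C where "C = {{\<omega> \<in> space P. \<forall>r\<in>R. W r \<omega> \<in> A r} | R A.
      finite R \<and> R \<subseteq> {0..s} \<and> (\<forall>r. A r \<in> sets (borel :: real measure))}"
  let ?B = "{?\<xi> -` A \<inter> space P | A. A \<in> sets borel}"
  have \<xi>: "?\<xi> \<in> borel_measurable P" using W_measurable s by auto
  have C_events: "C \<subseteq> events"
  proof
    fix a assume "a \<in> C"
    then obtain R A where a: "a = {\<omega> \<in> space P. \<forall>r\<in>R. W r \<omega> \<in> A r}" "finite R" "R \<subseteq> {0..s}"
      "\<forall>r. A r \<in> sets (borel :: real measure)" by (auto simp: C_def)
    show "a \<in> events"
      unfolding a(1)
    proof (rule sets.sets_Collect_finite_All)
      fix r assume "r \<in> R"
      then have "W r \<in> borel_measurable P" using a(3) s by (intro W_measurable) auto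
      from measurable_sets[OF this, of "A r"] a(4)
      show "{\<omega> \<in> space P. W r \<omega> \<in> A r} \<in> events" by (simp add: vimage_def Int_def conj_commute)
    qed (use a in auto)
  qed
  have "indep_set (C \<union> null_sets P) ?B"
  proof (rule indep_setI)
    show "C \<union> null_sets P \<subseteq> events" using C_events by auto
    show "?B \<subseteq> events" using \<xi> by auto
    fix a b assume a: "a \<in> C \<union> null_sets P" and b: "b \<in> ?B"
    then obtain B where B: "B \<in> sets borel" "b = ?\<xi> -` B \<inter> space P" by auto
    from a show "prob (a \<inter> b) = prob a * prob b"
    proof
      assume "a \<in> C"
      then obtain R A where a: "a = {\<omega> \<in> space P. \<forall>r\<in>R. W r \<omega> \<in> A r}" "finite R" "R \<subseteq> {0..s}"
        "\<forall>r. A r \<in> sets (borel :: real measure)" unfolding C_def by auto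
      show ?thesis unfolding a(1) B(2) by (rule finite_history_indep[OF s a(2,3) _ B(1)]) (simp add: a(4))
    next
      assume "a \<in> null_sets P"
      moreover have "b \<in> events" using \<open>?B \<subseteq> events\<close> b by auto
      ultimately have "a \<inter> b \<in> null_sets P" by (rule null_set_Int2)
      then show ?thesis using \<open>a \<in> null_sets P\<close> by (simp add: measure_eq_0_null_sets)
    qed
  qed
  moreover have "Int_stable (C \<union> null_sets P)"
  proof (rule Int_stableI)
    fix a b assume ab: "a \<in> C \<union> null_sets P" "b \<in> C \<union> null_sets P"
    show "a \<inter> b \<in> C \<union> null_sets P"
    proof (cases "a \<in> C \<and> b \<in> C")
      case True
      then obtain R A R' A' where
        a: "a = {\<omega> \<in> space P. \<forall>r\<in>R. W r \<omega> \<in> A r}" "finite R" "R \<subseteq> {0..s}" "\<forall>r. A r \<in> sets (borel :: real measure)"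
        and b: "b = {\<omega> \<in> space P. \<forall>r\<in>R'. W r \<omega> \<in> A' r}" "finite R'" "R' \<subseteq> {0..s}" "\<forall>r. A' r \<in> sets (borel :: real measure)"
        unfolding C_def by auto
      define A'' where "A'' r = (if r \<in> R then A r else UNIV) \<inter> (if r \<in> R' then A' r else UNIV)" for r
      have "a \<inter> b = {\<omega> \<in> space P. \<forall>r\<in>R \<union> R'. W r \<omega> \<in> A'' r}"
        unfolding a(1) b(1) A''_def by auto
      moreover have "\<forall>r. A'' r \<in> sets (borel :: real measure)" using a b by (auto simp: A''_def)
      ultimately have "a \<inter> b \<in> C" 
        unfolding C_def by (intro CollectI exI[of _ "R \<union> R'"] exI[of _ A'']) (simp add: a(2,3) b(2,3))
      then show ?thesis by simp
    next
      case False
      then have "a \<in> null_sets P \<or> b \<in> null_sets P" using ab by blast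
      moreover have "a \<in> events" "b \<in> events" using ab C_events by auto
      ultimately have "a \<inter> b \<in> null_sets P" using null_set_Int1 null_set_Int2 by blast
      then show ?thesis by simp
    qed
  qed
  moreover have "Int_stable ?B"
  proof (rule Int_stableI)
    fix a b assume "a \<in> ?B" "b \<in> ?B"
    then obtain A A' where "A \<in> sets borel" "a = ?\<xi> -` A \<inter> space P" "A' \<in> sets borel" "b = ?\<xi> -` A' \<inter> space P"
      by auto
    then show "a \<inter> b \<in> ?B" by (intro CollectI exI[of _ "A \<inter> A'"]) auto
  qed
  ultimately have ind: "indep_set (sigma_sets (space P) (C \<union> null_sets P)) (sigma_sets (space P) ?B)"
    by (rule indep_set_sigma_sets)
  have "history s \<subseteq> C"
  proof
    fix a assume "a \<in> history s"
    then obtain r A where "a = W r -` A \<inter> space P" "r \<in> {0..s}" "A \<in> sets borel" by auto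
    then have "a = {\<omega> \<in> space P. \<forall>q\<in>{r}. W q \<omega> \<in> A}" by auto
    then show "a \<in> C" unfolding C_def using \<open>r \<in> {0..s}\<close> \<open>A \<in> sets borel\<close>
      by (intro CollectI exI[of _ "{r}"] exI[of _ "\<lambda>_. A"]) auto
  qed
  then have "sets (F s) \<subseteq> sigma_sets (space P) (C \<union> null_sets P)"
    unfolding sets_F by (intro sigma_sets_mono) auto
  moreover have "sigma_sets (space P) {\<phi> -` A \<inter> space P | A. A \<in> sets borel} \<subseteq> sets (F s)"
    using sets.sigma_sets_subset[of "{\<phi> -` A \<inter> space P | A. A \<in> sets borel}" "F s"]
      measurable_sets[OF \<phi>] by auto
  ultimately have "indep_set (sigma_sets (space P) {\<phi> -` A \<inter> space P | A. A \<in> sets borel})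
      (sigma_sets (space P) ?B)"
    using ind unfolding indep_sets2_eq by blast
  then show ?thesis
    unfolding indep_var_eq using \<xi> measurable_F_P[OF \<phi>] s by auto
qed

lemma increment_moments:
  assumes s: "0 \<le> s" "s < t" "t \<le> T"
  defines "\<xi> \<equiv> \<lambda>\<omega>. W t \<omega> - W s \<omega>"
  shows "integrable P \<xi>" "expectation \<xi> = 0"
    "integrable P (\<lambda>\<omega>. (\<xi> \<omega>)\<^sup>2)" "expectation (\<lambda>\<omega>. (\<xi> \<omega>)\<^sup>2) = t - s"
    "integrable P (\<lambda>\<omega>. (\<xi> \<omega>) ^ 4)" "expectation (\<lambda>\<omega>. (\<xi> \<omega>) ^ 4) = 3 * (t - s)\<^sup>2"
proof -
  let ?\<sigma> = "sqrt (t - s)"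
  have \<sigma>: "0 < ?\<sigma>" "?\<sigma>\<^sup>2 = t - s" using s by auto
  note D = W_normal[OF s, folded \<xi>_def]
  have I: "integrable P (\<lambda>\<omega>. \<xi> \<omega> ^ k)" for k
    using distributed_integrable[OF D, of "\<lambda>x. x ^ k"] integrable_normal_moment[OF \<sigma>(1), of 0 k] by simp
  have E: "expectation (\<lambda>\<omega>. \<xi> \<omega> ^ k) = (\<integral>x. normal_density 0 ?\<sigma> x * x ^ k \<partial>lborel)" for k
    using distributed_integral[OF D, of "\<lambda>x. x ^ k"] by simp
  have \<xi>M: "\<xi> \<in> borel_measurable P" using W_measurable s by (auto simp: \<xi>_def)
  show "integrable P \<xi>" "integrable P (\<lambda>\<omega>. (\<xi> \<omega>)\<^sup>2)" "integrable P (\<lambda>\<omega>. (\<xi> \<omega>) ^ 4)"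
    using I[of 1] I[of 2] I[of 4] by auto
  show "expectation \<xi> = 0" by (rule normal_distributed_expectation[OF \<sigma>(1) D])
  show "expectation (\<lambda>\<omega>. (\<xi> \<omega>)\<^sup>2) = t - s"
    using E[of 2] integral_normal_moment_even[OF \<sigma>(1), of 0 1] \<sigma> by (simp add: fact_numeral)
  have "expectation (\<lambda>\<omega>. (\<xi> \<omega>) ^ 4) = fact 4 / ((2 / (t - s))\<^sup>2 * fact 2)"
    using E[of 4] integral_normal_moment_even[OF \<sigma>(1), of 0 2] \<sigma> by simp
  then show "expectation (\<lambda>\<omega>. (\<xi> \<omega>) ^ 4) = 3 * (t - s)\<^sup>2"
    using s by (simp add: fact_numeral power_divide)
qed

end

section \<open>Grids and refinements\<close>

text \<open>Stopping the grid of the whole interval at t, instead of subdividing up to t anew, keeps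
  the nodes below t the same for all t. One simple integrand built on the full grid then has the sum
  over the stopped grid as its integral up to t. The denominator \<open>Suc n\<close> avoids an
  empty grid.\<close>

definition grid :: "real \<Rightarrow> real \<Rightarrow> nat \<Rightarrow> nat \<Rightarrow> real" where
  "grid T t n i = min (T * real i / real (Suc n)) t"

lemma grid_mono: "0 \<le> T \<Longrightarrow> mono (grid T t n)"
  unfolding grid_def by (intro monoI min.mono divide_right_mono mult_left_mono) auto

lemma grid_0: "0 \<le> t \<Longrightarrow> grid T t n 0 = 0"
  by (simp add: grid_def)

lemma grid_last: "t \<le> T \<Longrightarrow> grid T t n (Suc n) = t"
  by (simp add: grid_def)

lemma grid_le: "grid T t n i \<le> t"
  by (simp add: grid_def)

lemma grid_in: "0 \<le> T \<Longrightarrow> t \<in> {0..T} \<Longrightarrow> grid T t n i \<in> {0..T}"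
  by (auto simp: grid_def min_le_iff_disj)

lemma grid_step: "0 \<le> T \<Longrightarrow> grid T t n (Suc i) - grid T t n i \<le> T / real (Suc n)"
proof -
  assume "0 \<le> T"
  have "T * real (Suc i) / real (Suc n) = T * real i / real (Suc n) + T / real (Suc n)"
    by (simp add: distrib_left add_divide_distrib)
  moreover have "0 \<le> T / real (Suc n)" using \<open>0 \<le> T\<close> by simp
  ultimately show ?thesis unfolding grid_def by linarith
qed

lemma mesh_tendsto_0: "(\<lambda>n. T / real (Suc n)) \<longlonglongrightarrow> 0"
  by (rule LIMSEQ_Suc[OF lim_const_over_n])

lemma power2_add_le: "(x + y)\<^sup>2 \<le> 2 * x\<^sup>2 + 2 * (y :: real)\<^sup>2"
  using sum_squares_bound[of x y] by (simp add: power2_sum)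

lemma modulus_of_continuity:
  fixes \<phi> :: "'a::metric_space \<Rightarrow> 'b::metric_space"
  assumes "compact S" "continuous_on S \<phi>"
  obtains \<omega> :: "real \<Rightarrow> real" where
    "\<And>x y d. x \<in> S \<Longrightarrow> y \<in> S \<Longrightarrow> dist x y \<le> d \<Longrightarrow> dist (\<phi> x) (\<phi> y) \<le> \<omega> d"
    "\<And>d. 0 \<le> \<omega> d"
    "\<And>D :: nat \<Rightarrow> real. D \<longlonglongrightarrow> 0 \<Longrightarrow> (\<lambda>n. \<omega> (D n)) \<longlonglongrightarrow> 0"
proof -
  \<comment> \<open>Adjoining 0 keeps the set nonempty when \<open>S\<close> is empty or
    \<open>d\<close> is negative, and makes the supremum nonnegative for every
    \<open>d\<close>.\<close>
  define A where "A d = insert 0 {dist (\<phi> x) (\<phi> y) | x y. x \<in> S \<and> y \<in> S \<and> dist x y \<le> d}" for d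
  have "bounded (\<phi> ` S)" using assms compact_continuous_image compact_imp_bounded by blast
  then obtain B where B: "\<And>x y. x \<in> S \<Longrightarrow> y \<in> S \<Longrightarrow> dist (\<phi> x) (\<phi> y) \<le> B"
    unfolding bounded_two_points by blast
  have bdd: "bdd_above (A d)" for d
    by (rule bdd_aboveI[of _ "max 0 B"]) (auto simp: A_def le_max_iff_disj B)
  have uc: "uniformly_continuous_on S \<phi>" by (rule compact_uniformly_continuous[OF assms(2,1)])
  show thesis
  proof
    show "dist (\<phi> x) (\<phi> y) \<le> Sup (A d)" if "x \<in> S" "y \<in> S" "dist x y \<le> d" for x y d
      by (rule cSup_upper[OF _ bdd]) (use that in \<open>auto simp: A_def\<close>)
    show nonneg: "0 \<le> Sup (A d)" for d
      by (rule cSup_upper[OF _ bdd]) (simp add: A_def)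
    fix D :: "nat \<Rightarrow> real" assume D: "D \<longlonglongrightarrow> 0"
    show "(\<lambda>n. Sup (A (D n))) \<longlonglongrightarrow> 0"
    proof (rule tendstoI)
      fix e :: real assume e: "0 < e"
      from uc[unfolded uniformly_continuous_on_def, rule_format, of "e / 2"] e obtain d where
        d: "0 < d" "\<And>x y. x \<in> S \<Longrightarrow> y \<in> S \<Longrightarrow> dist x y < d \<Longrightarrow> dist (\<phi> x) (\<phi> y) < e / 2"
        by (metis dist_commute half_gt_zero)
      from order_tendstoD(2)[OF D d(1)]
      show "\<forall>\<^sub>F n in sequentially. dist (Sup (A (D n))) 0 < e"
      proof eventually_elim
        case (elim n)
        have "Sup (A (D n)) \<le> e / 2"
          by (rule cSup_least) (use elim e d(2) in \<open>auto simp: A_def intro!: less_imp_le\<close>)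
        then show ?case using nonneg[of "D n"] e by simp
      qed
    qed
  qed
qed

lemma grid_oscillation:
  fixes \<phi> :: "real \<Rightarrow> real"
  assumes "0 \<le> T" "t \<in> {0..T}" "continuous_on {0..T} \<phi>"
  obtains \<eta> where "\<eta> \<longlonglongrightarrow> 0" "\<And>n. 0 \<le> \<eta> n"
    "\<And>n i s. s \<in> {grid T t n i..grid T t n (Suc i)} \<Longrightarrow> \<bar>\<phi> s - \<phi> (grid T t n i)\<bar> \<le> \<eta> n"
proof -
  obtain \<omega> where \<omega>: "\<And>x y d. x \<in> {0..T} \<Longrightarrow> y \<in> {0..T} \<Longrightarrow> dist x y \<le> d \<Longrightarrow> dist (\<phi> x) (\<phi> y) \<le> \<omega> d"
    "\<And>d. 0 \<le> \<omega> d" "\<And>D :: nat \<Rightarrow> real. D \<longlonglongrightarrow> 0 \<Longrightarrow> (\<lambda>n. \<omega> (D n)) \<longlonglongrightarrow> 0"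
    using modulus_of_continuity[OF compact_Icc assms(3)] by blast
  show thesis
  proof (rule that[of "\<lambda>n. \<omega> (T / real (Suc n))"])
    fix n i s assume s: "s \<in> {grid T t n i..grid T t n (Suc i)}"
    have "s \<in> {0..T}" using s grid_in[OF assms(1,2), of n i] grid_in[OF assms(1,2), of n "Suc i"] by auto
    moreover have "dist s (grid T t n i) \<le> T / real (Suc n)"
      using s grid_step[OF assms(1), of t n i] by (auto simp: dist_real_def)
    ultimately show "\<bar>\<phi> s - \<phi> (grid T t n i)\<bar> \<le> \<omega> (T / real (Suc n))"
      using \<omega>(1)[OF _ grid_in[OF assms(1,2)]] by (simp add: dist_real_def)
  qed (use \<omega> mesh_tendsto_0 in auto)
qed

section \<open>Enumerated nodes and elementary facts on simple integrands\<close>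

text \<open>The enumeration is continued by its last value beyond \<open>N\<close>. It becomes a
  total monotone sequence with values in the set, as the noise lemmas require, and stays strict
  where the indices matter.\<close>

lemma finite_set_enumeration:
  fixes Q :: "real set"
  assumes "finite Q" "Q \<noteq> {}"
  obtains p :: "nat \<Rightarrow> real" and N where "mono p" "strict_mono_on {..N} p" "p ` {..N} = Q" "range p = Q"
proof -
  let ?l = "sorted_list_of_set Q"
  define N where "N = card Q - 1"
  define p where "p i = ?l ! min i N" for i
  have len: "length ?l = Suc N" using assms by (simp add: N_def card_gt_0_iff)
  have l: "sorted ?l" "distinct ?l" "set ?l = Q" using assms by auto
  have mono: "mono p"
    by (rule monoI) (use len in \<open>auto simp: p_def intro!: sorted_nth_mono[OF l(1)]\<close>)
  have img: "p ` {..N} = Q"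
  proof -
    have "p ` {..N} = (\<lambda>i. ?l ! i) ` {..<length ?l}" using len
      by (intro image_cong) (auto simp: p_def lessThan_Suc_atMost)
    also have "\<dots> = set ?l" by (auto simp: in_set_conv_nth)
    finally show ?thesis using l(3) by simp
  qed
  have inj: "inj_on p {..N}"
    by (rule inj_onI) (use len l(2) in \<open>auto simp: p_def nth_eq_iff_index_eq\<close>)
  show thesis
  proof (rule that[OF mono _ img])
    show "strict_mono_on {..N} p"
    proof (rule strict_mono_onI)
      fix r s assume "r \<in> {..N}" "s \<in> {..N}" "r < s"
      then show "p r < p s" using monoD[OF mono, of r s] inj_onD[OF inj, of r s] by force
    qed
    have "p i = p (min i N)" for i by (simp add: p_def)
    then have "range p \<subseteq> p ` {..N}" by (metis atMost_iff image_eqI image_subsetI min.cobounded2)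
    then show "range p = Q" using img by auto
  qed
qed

text \<open>Telescoping, phrased by values of the nodes instead of indices, because the end points
  of a simple integrand are known only as members of the range of \<open>p\<close>.\<close>

lemma sum_increments_between:
  fixes f :: "real \<Rightarrow> real" and p :: "nat \<Rightarrow> real"
  assumes p: "strict_mono_on {..N} p" and ab: "a \<in> p ` {..N}" "b \<in> p ` {..N}" "a \<le> b"
  shows "(\<Sum>l | l < N \<and> a \<le> p l \<and> p l < b. f (p (Suc l)) - f (p l)) = f b - f a"
proof -
  obtain j k where jk: "a = p j" "j \<le> N" "b = p k" "k \<le> N" using ab by auto
  have le: "p x \<le> p y \<longleftrightarrow> x \<le> y" if "x \<le> N" "y \<le> N" for x y
    using strict_mono_on_less_eq[OF p, of x y] that by auto
  have "{l. l < N \<and> a \<le> p l \<and> p l < b} = {j..<k}"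
    using jk le by (auto simp: not_le[symmetric])
  moreover have "j \<le> k" using ab(3) jk le by auto
  ultimately show ?thesis using sum_Suc_diff'[of j k "\<lambda>l. f (p l)"] jk by simp
qed

lemma sum_indicator_grid:
  fixes p :: "nat \<Rightarrow> real"
  assumes "mono p"
  shows "(\<Sum>l<N. indicator {p l<..p (Suc l)} s :: real) = indicator {p 0<..p N} s"
proof (induction N)
  case (Suc N)
  have "p 0 \<le> p N" "p N \<le> p (Suc N)" using assms by (auto intro: monoD)
  then show ?case using Suc by (auto simp: indicator_def)
qed simp

lemma simple_integrand_on_Cons:
  "simple_integrand_on P F a b ((r, s, h) # K) \<longleftrightarrow> a \<le> r \<and> r \<le> s \<and> s \<le> b \<and>
     h \<in> borel_measurable (F r) \<and> (\<exists>C. \<forall>\<omega>\<in>space P. \<bar>h \<omega>\<bar> \<le> C) \<and> simple_integrand_on P F a b K"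
  by (simp add: simple_integrand_on_def)

lemma simple_process_Cons:
  "simple_process ((r, s, h) # K) t \<omega> = h \<omega> * indicator {r<..s} t + simple_process K t \<omega>"
  by (simp add: simple_process_def)

lemma simple_integral_Cons:
  "simple_integral W ((r, s, h) # K) t \<omega> = h \<omega> * (W (min s t) \<omega> - W (min r t) \<omega>) + simple_integral W K t \<omega>"
  by (simp add: simple_integral_def)

lemma simple_process_measurable: "(\<lambda>s. simple_process K s \<omega>) \<in> borel_measurable borel"
proof (induction K)
  case (Cons a K)
  obtain r s h where a: "a = (r, s, h)" by (cases a)
  have "(\<lambda>t. h \<omega> * indicator {r<..s} t + simple_process K t \<omega>) \<in> borel_measurable borel"
    using Cons by measurable
  then show ?case by (simp add: simple_process_def a)
qed (simp add: simple_process_def)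

lemma simple_process_bounded: "\<exists>B. \<forall>t. \<bar>simple_process K t \<omega>\<bar> \<le> B"
proof (induction K)
  case (Cons a K)
  obtain r s h where a: "a = (r, s, h)" by (cases a)
  obtain B where B: "\<And>t. \<bar>simple_process K t \<omega>\<bar> \<le> B" using Cons by auto
  have "\<bar>simple_process (a # K) t \<omega>\<bar> \<le> \<bar>h \<omega>\<bar> + B" for t
    using B[of t] unfolding a by (auto simp: simple_process_def indicator_def intro: order_trans[OF abs_triangle_ineq])
  then show ?case by blast
qed (auto simp: simple_process_def)

lemma continuous_on_Icc_bounded:
  fixes \<phi> :: "real \<Rightarrow> real"
  assumes "continuous_on {a..b} \<phi>"
  obtains B where "0 \<le> B" "\<And>s. s \<in> {a..b} \<Longrightarrow> \<bar>\<phi> s\<bar> \<le> B"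
proof -
  have "bounded (\<phi> ` {a..b})"
    using assms compact_continuous_image compact_imp_bounded by blast
  then obtain B where "\<forall>x\<in>\<phi> ` {a..b}. norm x \<le> B" by (auto simp: bounded_iff)
  then show thesis by (intro that[of "max 0 B"]) (auto simp: le_max_iff_disj)
qed

lemma set_integrable_simple_process_diff:
  assumes "continuous_on {a..b} \<phi>"
  shows "set_integrable lborel {a..b} (\<lambda>s. (simple_process K s \<omega> - \<phi> s)\<^sup>2)"
proof -
  obtain B where B: "\<And>s. s \<in> {a..b} \<Longrightarrow> \<bar>\<phi> s\<bar> \<le> B"
    using continuous_on_Icc_bounded[OF assms] by blast
  obtain C where C: "\<And>t. \<bar>simple_process K t \<omega>\<bar> \<le> C" using simple_process_bounded[of K \<omega>] by blast
  have [measurable]: "(\<lambda>s. simple_process K s \<omega>) \<in> borel_measurable borel" by (rule simple_process_measurable)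
  have [measurable]: "(\<lambda>s. indicator {a..b} s *\<^sub>R \<phi> s) \<in> borel_measurable borel"
    by (rule borel_measurable_continuous_on_indicator[OF _ assms]) simp
  have "(\<lambda>s. indicator {a..b} s *\<^sub>R (simple_process K s \<omega> - \<phi> s)\<^sup>2)
      = (\<lambda>s. indicator {a..b} s * (simple_process K s \<omega> - indicator {a..b} s *\<^sub>R \<phi> s)\<^sup>2)"
    by (auto simp: indicator_def)
  moreover have "\<dots> \<in> borel_measurable borel" by measurable
  ultimately show ?thesis
    unfolding set_integrable_def
  proof (intro integrableI_bounded_set[where A = "{a..b}" and B = "(C + B)\<^sup>2"])
    show "AE s\<in>{a..b} in lborel. norm (indicator {a..b} s *\<^sub>R (simple_process K s \<omega> - \<phi> s)\<^sup>2) \<le> (C + B)\<^sup>2"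
    proof (intro AE_I2 impI)
      fix s assume s: "s \<in> {a..b}"
      then have "\<bar>simple_process K s \<omega> - \<phi> s\<bar> \<le> C + B" using B[OF s] C[of s] by linarith
      then have "\<bar>simple_process K s \<omega> - \<phi> s\<bar>\<^sup>2 \<le> (C + B)\<^sup>2" by (intro power_mono) auto
      then show "norm (indicator {a..b} s *\<^sub>R (simple_process K s \<omega> - \<phi> s)\<^sup>2) \<le> (C + B)\<^sup>2" using s by simp
    qed
  qed (auto simp: emeasure_lborel_Icc_eq)
qed

section \<open>Brownian increments and their centred squares as noise\<close>

context wiener
begin

lemma brownian_noise:
  assumes "mono p" "range p \<subseteq> {0..T}"
  shows "noise_sequence P (\<lambda>l. F (p l)) (\<lambda>l \<omega>. W (p (Suc l)) \<omega> - W (p l) \<omega>) (\<lambda>l. p (Suc l) - p l) N"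
proof
  have p: "0 \<le> p l" "p l \<le> T" "p l \<le> p (Suc l)" for l
    using assms(2) monoD[OF assms(1), of l "Suc l"] by (auto simp: image_subset_iff)
  show "subalgebra P (F (p l))" for l using p by (intro subalgebra_F)
  show "sets (F (p l)) \<subseteq> sets (F (p m))" if "l \<le> m" for l m
    using that assms(1) by (intro F_mono) (auto intro: monoD)
  show "(\<lambda>\<omega>. W (p (Suc l)) \<omega> - W (p l) \<omega>) \<in> borel_measurable (F (p (Suc l)))" for l
    by (intro borel_measurable_diff W_adapted) (auto simp: p)
  show "0 \<le> p (Suc l) - p l" for l using p by simp
  fix l assume "0 < p (Suc l) - p l"
  then have l: "0 \<le> p l" "p l < p (Suc l)" "p (Suc l) \<le> T" using p by auto
  show "indep_var borel \<phi> borel (\<lambda>\<omega>. W (p (Suc l)) \<omega> - W (p l) \<omega>)"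
    if "\<phi> \<in> borel_measurable (F (p l))" for \<phi> by (rule increment_indep[OF l that])
  show "integrable P (\<lambda>\<omega>. (W (p (Suc l)) \<omega> - W (p l) \<omega>)\<^sup>2)"
    "expectation (\<lambda>\<omega>. W (p (Suc l)) \<omega> - W (p l) \<omega>) = 0"
    "expectation (\<lambda>\<omega>. (W (p (Suc l)) \<omega> - W (p l) \<omega>)\<^sup>2) = p (Suc l) - p l"
    using increment_moments[OF l] by auto
qed auto

text \<open>For a step of length d the fourth moment gives the variance
  \<open>3 * d^2 - 2 * d^2 + d^2 = 2 * d^2\<close>. Being quadratic in d, it sums over a grid to a
  multiple of the mesh, which is the source of the convergence of the quadratic variation.\<close>

lemma brownian_square_noise:
  assumes "mono p" "range p \<subseteq> {0..T}"
  shows "noise_sequence P (\<lambda>l. F (p l)) (\<lambda>l \<omega>. (W (p (Suc l)) \<omega> - W (p l) \<omega>)\<^sup>2 - (p (Suc l) - p l))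
    (\<lambda>l. 2 * (p (Suc l) - p l)\<^sup>2) N"
proof
  have p: "0 \<le> p l" "p l \<le> T" "p l \<le> p (Suc l)" for l
    using assms(2) monoD[OF assms(1), of l "Suc l"] by (auto simp: image_subset_iff)
  show "subalgebra P (F (p l))" for l using p by (intro subalgebra_F)
  show "sets (F (p l)) \<subseteq> sets (F (p m))" if "l \<le> m" for l m
    using that assms(1) by (intro F_mono) (auto intro: monoD)
  show "(\<lambda>\<omega>. (W (p (Suc l)) \<omega> - W (p l) \<omega>)\<^sup>2 - (p (Suc l) - p l)) \<in> borel_measurable (F (p (Suc l)))" for l
    by (intro borel_measurable_diff borel_measurable_power W_adapted borel_measurable_const) (auto simp: p)
  fix l assume "0 < 2 * (p (Suc l) - p l)\<^sup>2"
  then have "p l \<noteq> p (Suc l)" by auto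
  then have l: "0 \<le> p l" "p l < p (Suc l)" "p (Suc l) \<le> T" using p[of l] p[of "Suc l"] by auto
  let ?\<xi> = "\<lambda>\<omega>. W (p (Suc l)) \<omega> - W (p l) \<omega>" and ?d = "p (Suc l) - p l"
  note mom = increment_moments[OF l]
  show "indep_var borel \<phi> borel (\<lambda>\<omega>. (?\<xi> \<omega>)\<^sup>2 - ?d)"
    if "\<phi> \<in> borel_measurable (F (p l))" for \<phi>
    using indep_var_compose[OF increment_indep[OF l that], of "\<lambda>x. x" borel "\<lambda>x. x\<^sup>2 - ?d" borel]
    by (simp add: o_def)
  have expand: "((?\<xi> \<omega>)\<^sup>2 - ?d)\<^sup>2 = ?\<xi> \<omega> ^ 4 + (- 2 * ?d) * (?\<xi> \<omega>)\<^sup>2 + ?d\<^sup>2" for \<omega>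
  proof -
    have "(x\<^sup>2 - d)\<^sup>2 = x ^ 4 + (- 2 * d) * x\<^sup>2 + d\<^sup>2" for x d :: real
      by (simp add: power2_eq_square power4_eq_xxxx algebra_simps)
    then show ?thesis .
  qed
  have I: "integrable P (\<lambda>\<omega>. (- 2 * ?d) * (?\<xi> \<omega>)\<^sup>2)" by (intro integrable_mult_right mom)
  show "integrable P (\<lambda>\<omega>. ((?\<xi> \<omega>)\<^sup>2 - ?d)\<^sup>2)"
    unfolding expand by (intro Bochner_Integration.integrable_add I mom) simp
  have "expectation (\<lambda>\<omega>. (?\<xi> \<omega>)\<^sup>2 - ?d) = expectation (\<lambda>\<omega>. (?\<xi> \<omega>)\<^sup>2) - expectation (\<lambda>_. ?d)"
    by (rule Bochner_Integration.integral_diff[OF mom(3)]) simp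
  then show "expectation (\<lambda>\<omega>. (?\<xi> \<omega>)\<^sup>2 - ?d) = 0" using mom by (simp add: prob_space)
  have "expectation (\<lambda>\<omega>. ((?\<xi> \<omega>)\<^sup>2 - ?d)\<^sup>2)
      = expectation (\<lambda>\<omega>. ?\<xi> \<omega> ^ 4) + expectation (\<lambda>\<omega>. (- 2 * ?d) * (?\<xi> \<omega>)\<^sup>2) + expectation (\<lambda>_. ?d\<^sup>2)"
    unfolding expand
    by (subst Bochner_Integration.integral_add, (intro Bochner_Integration.integrable_add mom I integrable_const)+,
      subst Bochner_Integration.integral_add, (intro mom I refl)+)
  also have "\<dots> = 3 * ?d\<^sup>2 + (- 2 * ?d) * ?d + ?d\<^sup>2"
    using mom by (simp only: integral_mult_right_zero) (simp add: prob_space)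
  also have "\<dots> = 2 * ?d\<^sup>2" by (simp add: power2_eq_square algebra_simps)
  finally show "expectation (\<lambda>\<omega>. ((?\<xi> \<omega>)\<^sup>2 - ?d)\<^sup>2) = 2 * ?d\<^sup>2" .
qed auto

end

lemma set_integrable_const:
  fixes c :: real
  assumes "A \<in> sets M" "emeasure M A < \<infinity>"
  shows "set_integrable M A (\<lambda>_. c)"
  unfolding set_integrable_def using assms by (auto intro: integrable_real_indicator)

section \<open>Common refinements of a grid and a simple integrand\<close>

context wiener
begin

text \<open>The simple integrand \<open>K\<close> is constant, with value \<open>k l\<close>, on each interval \<open>(p l, p (l + 1)]\<close> of a
  grid \<open>p\<close> finer than \<open>\<tau>\<close>; the interval with index \<open>l\<close> lies in the one of \<open>\<tau>\<close> with index \<open>b l\<close>.\<close>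

definition grid_refinement where
  "grid_refinement K \<tau> N p N' b k \<longleftrightarrow> mono p \<and> range p \<subseteq> {0..T} \<and>
    (\<forall>l<N'. k l \<in> borel_measurable (F (p l))) \<and>
    (\<forall>l<N'. \<forall>s\<in>{p l<..p (Suc l)}. \<forall>\<omega>. simple_process K s \<omega> = k l \<omega>) \<and>
    (\<forall>l<N'. b l < N \<and> \<tau> (b l) \<le> p l \<and> p (Suc l) \<le> \<tau> (Suc (b l))) \<and>
    (\<forall>i<N. \<forall>\<omega>. simple_integral W K (\<tau> (Suc i)) \<omega> - simple_integral W K (\<tau> i) \<omega>
       = (\<Sum>l | l < N' \<and> b l = i. k l \<omega> * (W (p (Suc l)) \<omega> - W (p l) \<omega>))) \<and>
    (\<forall>i<N. \<forall>\<omega>. W (\<tau> (Suc i)) \<omega> - W (\<tau> i) \<omega>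
       = (\<Sum>l | l < N' \<and> b l = i. W (p (Suc l)) \<omega> - W (p l) \<omega>))"

text \<open>The nodes are the grid points together with all jump times of \<open>K\<close> up to the
  last grid point. No jump time lies strictly between neighbouring nodes, so \<open>K\<close> is
  constant there.\<close>

lemma ex_grid_refinement:
  assumes K: "simple_integrand_on P F 0 T K" and \<tau>: "mono \<tau>" "range \<tau> \<subseteq> {0..T}" "\<tau> 0 = 0"
  shows "\<exists>p N' b k. grid_refinement K \<tau> N p N' b k"
proof -
  define t where "t = \<tau> N"
  define E where "E = (\<Union>(r, s, h)\<in>set K. {r, s})"
  define Q where "Q = {q \<in> \<tau> ` {..N} \<union> E. q \<le> t}"
  have Kd: "0 \<le> r" "r \<le> s" "s \<le> T" "h \<in> borel_measurable (F r)" if "(r, s, h) \<in> set K" for r s h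
    using K that unfolding simple_integrand_on_def by auto
  have t: "0 \<le> t" "t \<le> T" using \<tau>(2) by (auto simp: t_def image_subset_iff)
  have \<tau>_mono: "i \<le> j \<Longrightarrow> \<tau> i \<le> \<tau> j" for i j using \<tau>(1) by (rule monoD)
  have finQ: "finite Q" unfolding Q_def E_def by auto
  have \<tau>Q: "\<tau> i \<in> Q" if "i \<le> N" for i
    using that \<tau>_mono[OF that] by (auto simp: Q_def t_def)
  have E_iff: "x \<in> E \<longleftrightarrow> (\<exists>r s h. (r, s, h) \<in> set K \<and> (x = r \<or> x = s))" for x
    unfolding E_def by auto
  have EQ: "r \<le> t \<Longrightarrow> r \<in> Q" "s \<le> t \<Longrightarrow> s \<in> Q" if "(r, s, h) \<in> set K" for r s h
  proof -
    have "r \<in> E" "s \<in> E" using that unfolding E_iff by blast+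
    then show "r \<le> t \<Longrightarrow> r \<in> Q" "s \<le> t \<Longrightarrow> s \<in> Q" by (simp_all add: Q_def)
  qed
  have Q_nonneg: "0 \<le> q" if "q \<in> Q" for q
  proof -
    from that have "q \<in> range \<tau> \<or> q \<in> E" by (auto simp: Q_def)
    then show ?thesis
    proof
      assume "q \<in> E"
      then obtain r s h where "(r, s, h) \<in> set K" "q = r \<or> q = s" unfolding E_iff by blast
      then show ?thesis using Kd(1,2)[of r s h] by auto
    qed (use \<tau>(2) in auto)
  qed
  have Q_le: "q \<le> t" if "q \<in> Q" for q using that by (simp add: Q_def)
  have Q_ne: "Q \<noteq> {}" using \<tau>Q[of 0] by auto
  obtain p :: "nat \<Rightarrow> real" and N' where p: "mono p" "strict_mono_on {..N'} p" "p ` {..N'} = Q" "range p = Q"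
    by (rule finite_set_enumeration[OF finQ Q_ne])
  have p_Q: "p l \<in> Q" for l using p(4) by blast
  have p_less: "p l < p (Suc l)" if "l < N'" for l
    using strict_mono_onD[OF p(2), of l "Suc l"] that by auto
  have no_between: "q \<le> p l \<or> p (Suc l) \<le> q" if "q \<in> Q" "l < N'" for q l
  proof -
    have "q \<in> range p" using that p(4) by simp
    then obtain j where "q = p j" by blast
    then show ?thesis using monoD[OF p(1), of j l] monoD[OF p(1), of "Suc l" j] by (cases "j \<le> l") auto
  qed
  have p_le_t: "p l \<le> t" "0 \<le> p l" for l using p_Q Q_le Q_nonneg by auto
  have tele: "(\<Sum>l | l < N' \<and> a \<le> p l \<and> p l < c. f (p (Suc l)) - f (p l)) = f c - f a"
    if "a \<in> Q" "c \<in> Q" "a \<le> c" for a c and f :: "real \<Rightarrow> real"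
    by (rule sum_increments_between[OF p(2)]) (use that p(3) in auto)
  \<comment> \<open>Simple integrands live on half-open intervals \<open>(r, s]\<close>, so their
    value on \<open>(p l, p (l + 1)]\<close> is governed by the left node through
    \<open>r \<le> p l < s\<close>. In particular only values known at time \<open>p l\<close>
    enter.\<close>
  define k where "k l \<omega> = (\<Sum>(r, s, h)\<leftarrow>K. h \<omega> * (if r \<le> p l \<and> p l < s then 1 else 0))" for l \<omega>
  \<comment> \<open>The coarse grid may repeat nodes. The least index selects a nondegenerate coarse
    interval containing \<open>p l\<close>, and degenerate ones receive no fine steps.\<close>
  define b where "b l = (LEAST i. p l < \<tau> (Suc i))" for l
  have pl_t: "p l < t" if "l < N'" for l using p_less[OF that] p_le_t(1)[of "Suc l"] by simp
  have b: "b l < N" "\<tau> (b l) \<le> p l" "p l < \<tau> (Suc (b l))" if l: "l < N'" for l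
  proof -
    \<comment> \<open>For \<open>N = 0\<close> the refined interval would be the point 0, which
      leaves no node strictly below its end.\<close>
    have N: "N \<noteq> 0" using pl_t[OF l] p_le_t(2)[of l] \<tau>(3) by (cases N) (auto simp: t_def)
    then have ex: "p l < \<tau> (Suc (N - 1))" using pl_t[OF l] by (simp add: t_def)
    show "p l < \<tau> (Suc (b l))" unfolding b_def by (rule LeastI[of _ "N - 1"]) (rule ex)
    have "b l \<le> N - 1" unfolding b_def by (rule Least_le) (rule ex)
    then show "b l < N" using N by simp
    show "\<tau> (b l) \<le> p l"
    proof (cases "b l")
      case (Suc j)
      then have "\<not> p l < \<tau> (Suc j)" unfolding b_def by (intro not_less_Least) simp
      then show ?thesis using Suc by simp
    qed (use \<tau>(3) p_le_t in simp)
  qed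
  have b_iff: "b l = i \<longleftrightarrow> \<tau> i \<le> p l \<and> p l < \<tau> (Suc i)" if l: "l < N'" for l i
  proof
    assume i: "\<tau> i \<le> p l \<and> p l < \<tau> (Suc i)"
    have "\<not> Suc (b l) \<le> i" "\<not> Suc i \<le> b l"
      using i b[OF l] \<tau>_mono[of "Suc (b l)" i] \<tau>_mono[of "Suc i" "b l"] by linarith+
    then show "b l = i" by simp
  qed (use b[OF l] in auto)
  have blocks: "{l. l < N' \<and> b l = i} = {l. l < N' \<and> \<tau> i \<le> p l \<and> p l < \<tau> (Suc i)}" for i
    using b_iff by auto
  have int_eq: "simple_integral W K x \<omega> = (\<Sum>l | l < N' \<and> p l < x. k l \<omega> * (W (p (Suc l)) \<omega> - W (p l) \<omega>))"
    if x: "x \<in> Q" for x \<omega>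
  proof -
    have *: "h \<omega> * (W (min s x) \<omega> - W (min r x) \<omega>) = (\<Sum>l | l < N' \<and> p l < x.
        h \<omega> * (if r \<le> p l \<and> p l < s then 1 else 0) * (W (p (Suc l)) \<omega> - W (p l) \<omega>))"
      if "(r, s, h) \<in> set K" for r s h
    proof -
      \<comment> \<open>A jump time up to t is itself a node, and a later one is replaced by x,
        again a node. Dropping jump times beyond t therefore loses nothing.\<close>
      have Q: "min r x \<in> Q" "min s x \<in> Q" "min r x \<le> min s x"
        using EQ[OF that] x Q_le[OF x] Kd[OF that] by (auto simp: min_def)
      have "W (min s x) \<omega> - W (min r x) \<omega>
          = (\<Sum>l | l < N' \<and> min r x \<le> p l \<and> p l < min s x. W (p (Suc l)) \<omega> - W (p l) \<omega>)"
        using tele[OF Q, of "\<lambda>q. W q \<omega>"] by simp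
      also have "{l. l < N' \<and> min r x \<le> p l \<and> p l < min s x}
          = {l \<in> {l. l < N' \<and> p l < x}. r \<le> p l \<and> p l < s}" by auto
      also have "(\<Sum>l\<in>\<dots>. W (p (Suc l)) \<omega> - W (p l) \<omega>)
          = (\<Sum>l | l < N' \<and> p l < x. if r \<le> p l \<and> p l < s then W (p (Suc l)) \<omega> - W (p l) \<omega> else 0)"
        by (rule sum.inter_filter) simp
      finally show ?thesis
        by (auto simp: sum_distrib_left intro!: sum.cong)
    qed
    have "(\<Sum>(r, s, h)\<leftarrow>K'. h \<omega> * (W (min s x) \<omega> - W (min r x) \<omega>)) = (\<Sum>l | l < N' \<and> p l < x.
        (\<Sum>(r, s, h)\<leftarrow>K'. h \<omega> * (if r \<le> p l \<and> p l < s then 1 else 0)) * (W (p (Suc l)) \<omega> - W (p l) \<omega>))"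
      if "set K' \<subseteq> set K" for K'
      using that
    proof (induction K')
      case (Cons a K')
      obtain r s h where a: "a = (r, s, h)" by (cases a)
      show ?case using Cons *[of r s h] by (simp add: a distrib_right sum.distrib)
    qed simp
    from this[of K] show ?thesis unfolding simple_integral_def k_def by simp
  qed
  have "grid_refinement K \<tau> N p N' b k"
    unfolding grid_refinement_def
  proof (intro conjI allI impI ballI)
    show "range p \<subseteq> {0..T}" using p_le_t t(2) by (auto intro: order_trans[OF p_le_t(1)])
    fix l assume l: "l < N'"
    have "(\<lambda>\<omega>. \<Sum>(r, s, h)\<leftarrow>K'. h \<omega> * (if r \<le> p l \<and> p l < s then 1 else 0)) \<in> borel_measurable (F (p l))"
      if "set K' \<subseteq> set K" for K'
      using that
    proof (induction K')
      case (Cons a K')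
      obtain r s h where a: "a = (r, s, h)" by (cases a)
      have "(\<lambda>\<omega>. h \<omega> * (if r \<le> p l \<and> p l < s then 1 else 0)) \<in> borel_measurable (F (p l))"
      proof (cases "r \<le> p l \<and> p l < s")
        case True
        then show ?thesis using measurable_F_mono[OF Kd(4)[of r s h], of "p l"] Cons(2) a by simp
      next
        case False
        then show ?thesis by (simp only: if_False mult_zero_right borel_measurable_const)
      qed
      then show ?case using Cons by (simp add: a)
    qed simp
    from this[of K] show "k l \<in> borel_measurable (F (p l))" unfolding k_def by simp
    show "b l < N" "\<tau> (b l) \<le> p l" using b[OF l] by auto
    show "p (Suc l) \<le> \<tau> (Suc (b l))"
      using no_between[OF \<tau>Q[of "Suc (b l)"] l] b[OF l] by auto
    fix s' \<omega> assume s': "s' \<in> {p l<..p (Suc l)}"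
    have "indicator {r<..s} s' = (if r \<le> p l \<and> p l < s then 1 else 0 :: real)" if "(r, s, h) \<in> set K" for r s h
    proof -
      have "r < s' \<longleftrightarrow> r \<le> p l"
      proof (cases "r \<le> t")
        case True
        then show ?thesis using no_between[OF EQ(1)[OF that True] l] s' by auto
      qed (use s' p_le_t(1)[of l] p_le_t(1)[of "Suc l"] in auto)
      moreover have "s' \<le> s \<longleftrightarrow> p l < s" if "r \<le> p l"
      proof (cases "s \<le> t")
        case True
        show ?thesis using no_between[OF EQ(2)[OF \<open>(r, s, h) \<in> set K\<close> True] l] s' by auto
      qed (use s' p_le_t(1)[of l] p_le_t(1)[of "Suc l"] in auto)
      ultimately show ?thesis by (auto simp: indicator_def)
    qed
    then show "simple_process K s' \<omega> = k l \<omega>"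
      unfolding simple_process_def k_def by (intro arg_cong[where f = sum_list] map_cong) auto
  next
    fix i \<omega> assume i: "i < N"
    have Q: "\<tau> i \<in> Q" "\<tau> (Suc i) \<in> Q" "\<tau> i \<le> \<tau> (Suc i)" using \<tau>Q i \<tau>_mono[of i "Suc i"] by auto
    show "W (\<tau> (Suc i)) \<omega> - W (\<tau> i) \<omega> = (\<Sum>l | l < N' \<and> b l = i. W (p (Suc l)) \<omega> - W (p l) \<omega>)"
      unfolding blocks using tele[OF Q, of "\<lambda>q. W q \<omega>"] by simp
    have split: "{l. l < N' \<and> p l < \<tau> (Suc i)} = {l. l < N' \<and> p l < \<tau> i} \<union> {l. l < N' \<and> b l = i}"
      unfolding blocks using Q(3) by auto
    have "(\<Sum>l | l < N' \<and> p l < \<tau> (Suc i). f l) = (\<Sum>l | l < N' \<and> p l < \<tau> i. f l) + (\<Sum>l | l < N' \<and> b l = i. f l)"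
      for f :: "nat \<Rightarrow> real"
      unfolding split unfolding blocks by (rule sum.union_disjoint) auto
    then show "simple_integral W K (\<tau> (Suc i)) \<omega> - simple_integral W K (\<tau> i) \<omega>
       = (\<Sum>l | l < N' \<and> b l = i. k l \<omega> * (W (p (Suc l)) \<omega> - W (p l) \<omega>))"
      unfolding int_eq[OF Q(1)] int_eq[OF Q(2)] by simp
  qed (use p(1) in auto)
  then show ?thesis by blast
qed

text \<open>On a fine step the difference between the simple integral and its left-point
  approximation is \<open>(k l - H (b l))\<close> times the Brownian increment. Weighted with
  \<open>G (b l)\<close> this coefficient is known at \<open>p l\<close>, since the coarse node lies
  to its left. Labels of coarse steps are passed to fine steps by composing with
  \<open>b\<close>.\<close>

lemma grid_refinement_lenglart:
  assumes ref: "grid_refinement K \<tau> N p N' b k"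
    and \<tau>: "mono \<tau>" "range \<tau> \<subseteq> {0..T}"
    and G: "\<And>i. i < N \<Longrightarrow> G i \<in> borel_measurable (F (\<tau> i))"
    and H: "\<And>i. i < N \<Longrightarrow> H i \<in> borel_measurable (F (\<tau> i))"
    and pos: "0 < \<epsilon>" "0 < \<delta>" "finite J"
  shows "prob {\<omega> \<in> space P. \<epsilon> < (\<Sum>j\<in>J. (\<Sum>i | i < N \<and> c i = j. G i \<omega> *
      (simple_integral W K (\<tau> (Suc i)) \<omega> - simple_integral W K (\<tau> i) \<omega> - H i \<omega> * (W (\<tau> (Suc i)) \<omega> - W (\<tau> i) \<omega>)))\<^sup>2)}
    \<le> prob {\<omega> \<in> space P. \<delta> < (\<Sum>l<N'. (G (b l) \<omega> * (k l \<omega> - H (b l) \<omega>))\<^sup>2 * (p (Suc l) - p l))} + \<delta> / \<epsilon>"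
proof -
  have p: "mono p" "range p \<subseteq> {0..T}"
    and k: "\<And>l. l < N' \<Longrightarrow> k l \<in> borel_measurable (F (p l))"
    and b: "\<And>l. l < N' \<Longrightarrow> b l < N" "\<And>l. l < N' \<Longrightarrow> \<tau> (b l) \<le> p l"
    and I: "\<And>i \<omega>. i < N \<Longrightarrow> simple_integral W K (\<tau> (Suc i)) \<omega> - simple_integral W K (\<tau> i) \<omega>
       = (\<Sum>l | l < N' \<and> b l = i. k l \<omega> * (W (p (Suc l)) \<omega> - W (p l) \<omega>))"
    and dW: "\<And>i \<omega>. i < N \<Longrightarrow> W (\<tau> (Suc i)) \<omega> - W (\<tau> i) \<omega>
       = (\<Sum>l | l < N' \<and> b l = i. W (p (Suc l)) \<omega> - W (p l) \<omega>)"
    using ref unfolding grid_refinement_def by auto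
  interpret noise_sequence P "\<lambda>l. F (p l)" "\<lambda>l \<omega>. W (p (Suc l)) \<omega> - W (p l) \<omega>" "\<lambda>l. p (Suc l) - p l" N'
    by (rule brownian_noise[OF p])
  let ?D = "\<lambda>i \<omega>. simple_integral W K (\<tau> (Suc i)) \<omega> - simple_integral W K (\<tau> i) \<omega> - H i \<omega> * (W (\<tau> (Suc i)) \<omega> - W (\<tau> i) \<omega>)"
  let ?w = "\<lambda>l \<omega>. W (p (Suc l)) \<omega> - W (p l) \<omega>"
  define h where "h l \<omega> = G (b l) \<omega> * (k l \<omega> - H (b l) \<omega>)" for l \<omega>
  have h: "h l \<in> borel_measurable (F (p l))" if "l < N'" for l
    unfolding h_def using b[OF that] G[of "b l"] H[of "b l"] k[OF that]
    by (intro borel_measurable_times borel_measurable_diff) (auto intro: measurable_F_mono)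
  have "(\<Sum>i | i < N \<and> c i = j. G i \<omega> * ?D i \<omega>)
    = (\<Sum>l | l < N' \<and> c (b l) = j. h l \<omega> * ?w l \<omega>)" for j \<omega>
  proof -
    have "(\<Sum>l | l < N' \<and> c (b l) = j. h l \<omega> * ?w l \<omega>)
      = (\<Sum>i | i < N \<and> c i = j. \<Sum>l | l \<in> {l. l < N' \<and> c (b l) = j} \<and> b l = i. h l \<omega> * ?w l \<omega>)"
      by (rule sum.group[symmetric]) (use b in auto)
    also have "\<dots> = (\<Sum>i | i < N \<and> c i = j. G i \<omega> * ?D i \<omega>)"
    proof (rule sum.cong[OF refl])
      fix i assume i: "i \<in> {i. i < N \<and> c i = j}"
      have "{l. l \<in> {l. l < N' \<and> c (b l) = j} \<and> b l = i} = {l. l < N' \<and> b l = i}" using i by auto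
      then have "(\<Sum>l | l \<in> {l. l < N' \<and> c (b l) = j} \<and> b l = i. h l \<omega> * ?w l \<omega>)
        = (\<Sum>l | l < N' \<and> b l = i. G i \<omega> * (k l \<omega> * ?w l \<omega>
            - H i \<omega> * ?w l \<omega>))"
        by (intro sum.cong) (auto simp: h_def algebra_simps)
      also have "\<dots> = G i \<omega> * ((\<Sum>l | l < N' \<and> b l = i. k l \<omega> * ?w l \<omega>)
            - H i \<omega> * (\<Sum>l | l < N' \<and> b l = i. ?w l \<omega>))"
        by (simp add: sum_distrib_left[symmetric] sum_subtractf[of "\<lambda>l. k l \<omega> * _ l"])
      finally show "(\<Sum>l | l \<in> {l. l < N' \<and> c (b l) = j} \<and> b l = i. h l \<omega> * ?w l \<omega>)
        = G i \<omega> * ?D i \<omega>"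
        using i by (simp add: I dW)
    qed
    finally show ?thesis by simp
  qed
  then show ?thesis
    using lenglart[OF h pos, of "\<lambda>l. c (b l)"] by (simp add: h_def)
qed

text \<open>Splitting \<open>k l\<close> minus the coarse value of \<phi> at \<phi> s separates the
  L2 error of the simple integrand from the oscillation of \<phi>. The factors 2 come from
  \<open>power2_add_le\<close>. The half-open fine intervals tile a part of \<open>{0..T}\<close>,
  so the local integrals add up to at most the global one.\<close>

lemma grid_refinement_variance_le:
  assumes ref: "grid_refinement K \<tau> N p N' b k"
    and \<phi>: "continuous_on {0..T} \<phi>"
    and \<eta>: "\<And>i s. i < N \<Longrightarrow> s \<in> {\<tau> i..\<tau> (Suc i)} \<Longrightarrow> \<bar>\<phi> s - \<phi> (\<tau> i)\<bar> \<le> \<eta>"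
    and \<gamma>: "\<And>i. i < N \<Longrightarrow> \<bar>g i\<bar> \<le> \<gamma>"
  shows "(\<Sum>l<N'. (g (b l) * (k l \<omega> - \<phi> (\<tau> (b l))))\<^sup>2 * (p (Suc l) - p l))
    \<le> \<gamma>\<^sup>2 * (2 * (LBINT s:{0..T}. (simple_process K s \<omega> - \<phi> s)\<^sup>2) + 2 * \<eta>\<^sup>2 * T)"
proof -
  have p: "mono p" "range p \<subseteq> {0..T}"
    and k: "\<And>l s. l < N' \<Longrightarrow> s \<in> {p l<..p (Suc l)} \<Longrightarrow> simple_process K s \<omega> = k l \<omega>"
    and b: "\<And>l. l < N' \<Longrightarrow> b l < N" "\<And>l. l < N' \<Longrightarrow> \<tau> (b l) \<le> p l" "\<And>l. l < N' \<Longrightarrow> p (Suc l) \<le> \<tau> (Suc (b l))"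
    using ref unfolding grid_refinement_def by auto
  have pin: "0 \<le> p l" "p l \<le> T" "p l \<le> p (Suc l)" for l
    using p(2) monoD[OF p(1), of l "Suc l"] by (auto simp: image_subset_iff)
  let ?I = "\<lambda>l. {p l<..p (Suc l)}"
  let ?e = "\<lambda>l. (k l \<omega> - \<phi> (\<tau> (b l)))\<^sup>2"
  let ?D = "\<lambda>s. (simple_process K s \<omega> - \<phi> s)\<^sup>2"
  let ?f = "\<lambda>s. 2 * ?D s + 2 * \<eta>\<^sup>2"
  have ID: "set_integrable lborel {0..T} ?D" by (rule set_integrable_simple_process_diff[OF \<phi>])
  have If: "set_integrable lborel {0..T} ?f"
    by (intro set_integral_add set_integrable_mult_right ID set_integrable_const) (auto simp: emeasure_lborel_Icc_eq)
  have If': "set_integrable lborel (?I l) ?f" for l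
    by (rule set_integrable_subset[OF If]) (use pin[of l] pin[of "Suc l"] in auto)
  have "(\<Sum>l<N'. (g (b l) * (k l \<omega> - \<phi> (\<tau> (b l))))\<^sup>2 * (p (Suc l) - p l))
     \<le> (\<Sum>l<N'. \<gamma>\<^sup>2 * (LBINT s:(?I l). ?f s))"
  proof (rule sum_mono)
    fix l assume "l \<in> {..<N'}"
    then have l: "l < N'" by simp
    have pt: "?e l \<le> ?f s" if s: "s \<in> (?I l)" for s
    proof -
      have "\<bar>\<phi> s - \<phi> (\<tau> (b l))\<bar> \<le> \<eta>" using \<eta>[OF b(1)[OF l], of s] s b(2,3)[OF l] by auto
      then have "\<bar>\<phi> s - \<phi> (\<tau> (b l))\<bar>\<^sup>2 \<le> \<eta>\<^sup>2" by (intro power_mono) auto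
      moreover note power2_add_le[of "simple_process K s \<omega> - \<phi> s" "\<phi> s - \<phi> (\<tau> (b l))"]
      ultimately show ?thesis using k[OF l s] by simp
    qed
    have "?e l * (p (Suc l) - p l) = (LBINT s:(?I l). ?e l)"
      using pin[of l] by (simp add: set_integral_const)
    also have "\<dots> \<le> (LBINT s:(?I l). ?f s)"
    proof (rule set_integral_mono[OF _ If' pt])
      show "set_integrable lborel (?I l) (\<lambda>s. ?e l)"
        using pin[of l] by (intro set_integrable_const) auto
    qed
    finally have 1: "?e l * (p (Suc l) - p l) \<le> (LBINT s:(?I l). ?f s)" .
    have "\<bar>g (b l)\<bar>\<^sup>2 \<le> \<gamma>\<^sup>2" using \<gamma>[OF b(1)[OF l]] by (intro power_mono) auto
    then have "(g (b l))\<^sup>2 * (?e l * (p (Suc l) - p l)) \<le> \<gamma>\<^sup>2 * (LBINT s:(?I l). ?f s)"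
      using pin[of l] by (intro mult_mono 1) auto
    then show "(g (b l) * (k l \<omega> - \<phi> (\<tau> (b l))))\<^sup>2 * (p (Suc l) - p l) \<le> \<gamma>\<^sup>2 * (LBINT s:(?I l). ?f s)"
      by (simp add: power_mult_distrib mult.assoc)
  qed
  also have "\<dots> = \<gamma>\<^sup>2 * (\<Sum>l<N'. LBINT s:(?I l). ?f s)" by (simp add: sum_distrib_left)
  also have "(\<Sum>l<N'. LBINT s:(?I l). ?f s) = (LBINT s. \<Sum>l<N'. indicator (?I l) s *\<^sub>R ?f s)"
    unfolding set_lebesgue_integral_def
    by (rule Bochner_Integration.integral_sum[symmetric]) (use If' in \<open>simp add: set_integrable_def\<close>)
  also have "\<dots> \<le> (LBINT s:{0..T}. ?f s)"
    unfolding set_lebesgue_integral_def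
  proof (rule integral_mono)
    show "integrable lborel (\<lambda>s. \<Sum>l<N'. indicator (?I l) s *\<^sub>R ?f s)"
      by (intro Bochner_Integration.integrable_sum) (use If' in \<open>simp add: set_integrable_def\<close>)
    show "integrable lborel (\<lambda>s. indicator {0..T} s *\<^sub>R ?f s)" using If by (simp add: set_integrable_def)
    fix s
    have "(\<Sum>l<N'. indicator (?I l) s *\<^sub>R ?f s) = indicator {p 0<..p N'} s * ?f s"
      by (simp add: sum_distrib_right[symmetric] sum_indicator_grid[OF p(1)])
    also have "\<dots> \<le> indicator {0..T} s * ?f s"
      using pin(1)[of 0] pin(2)[of N'] by (intro mult_right_mono) (auto simp: indicator_def)
    finally show "(\<Sum>l<N'. indicator (?I l) s *\<^sub>R ?f s) \<le> indicator {0..T} s *\<^sub>R ?f s" by simp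
  qed
  also have "(LBINT s:{0..T}. ?f s) = 2 * (LBINT s:{0..T}. ?D s) + 2 * \<eta>\<^sup>2 * T"
    using ID T_pos by (subst set_integral_add) (auto simp: set_integral_const emeasure_lborel_Icc_eq intro!: set_integrable_const)
  finally show ?thesis by (simp add: mult_left_mono)
qed

end

section \<open>Remainder of the Riemann approximation\<close>

context wiener
begin

definition continuous_adapted :: "(real \<Rightarrow> 'a \<Rightarrow> real) \<Rightarrow> bool" where
  "continuous_adapted X \<longleftrightarrow> adapted_on F 0 T X \<and> (AE \<omega> in P. continuous_on {0..T} (\<lambda>t. X t \<omega>))"

lemma continuous_adaptedD:
  assumes "continuous_adapted X"
  shows "t \<in> {0..T} \<Longrightarrow> X t \<in> borel_measurable (F t)"
    and "t \<in> {0..T} \<Longrightarrow> X t \<in> borel_measurable P"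
    and "AE \<omega> in P. continuous_on {0..T} (\<lambda>t. X t \<omega>)"
  using assms measurable_F_P[of "X t" t] unfolding continuous_adapted_def adapted_on_def by auto

lemma continuous_adapted_comp:
  assumes "continuous_adapted X" "continuous_on ({0..T} \<times> UNIV) (\<lambda>(t, x). \<phi> t x)"
  shows "continuous_adapted (\<lambda>t \<omega>. \<phi> t (X t \<omega>))"
  unfolding continuous_adapted_def adapted_on_def
proof (intro conjI ballI)
  fix t assume t: "t \<in> {0..T}"
  have "continuous_on UNIV (\<lambda>x. (\<lambda>(t, x). \<phi> t x) (t, x))"
    by (rule continuous_on_compose2[OF assms(2)]) (use t in \<open>auto intro!: continuous_intros\<close>)
  then have "\<phi> t \<in> borel_measurable borel" by (intro borel_measurable_continuous_onI) simp
  then show "(\<lambda>\<omega>. \<phi> t (X t \<omega>)) \<in> borel_measurable (F t)"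
    by (rule measurable_compose[OF continuous_adaptedD(1)[OF assms(1) t]])
next
  show "AE \<omega> in P. continuous_on {0..T} (\<lambda>t. \<phi> t (X t \<omega>))"
    using continuous_adaptedD(3)[OF assms(1)]
  proof eventually_elim
    case (elim \<omega>)
    have "continuous_on {0..T} (\<lambda>t. (\<lambda>(t, x). \<phi> t x) (t, X t \<omega>))"
      by (rule continuous_on_compose2[OF assms(2)]) (auto intro!: continuous_intros elim)
    then show ?case by simp
  qed
qed

lemma continuous_adapted_mult:
  "continuous_adapted X \<Longrightarrow> continuous_adapted Y \<Longrightarrow> continuous_adapted (\<lambda>t \<omega>. X t \<omega> * Y t \<omega>)"
  unfolding continuous_adapted_def adapted_on_def
  by (auto intro!: borel_measurable_times) (auto elim!: AE_mp intro!: AE_I2 continuous_on_mult)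

text \<open>No cancellation is exploited: the errors are made small in sum over all nodes
  beforehand, so a crude bound controls their differences and the squares of these.\<close>

lemma sum_increments_le:
  fixes e :: "nat \<Rightarrow> real"
  shows "(\<Sum>i<n. \<bar>e (Suc i) - e i\<bar>) \<le> 2 * (\<Sum>i\<le>n. \<bar>e i\<bar>)"
    "(\<Sum>i<n. (e (Suc i) - e i)\<^sup>2) \<le> (2 * (\<Sum>i\<le>n. \<bar>e i\<bar>))\<^sup>2"
proof -
  have "(\<Sum>i<n. \<bar>e (Suc i) - e i\<bar>) \<le> (\<Sum>i<n. \<bar>e (Suc i)\<bar>) + (\<Sum>i<n. \<bar>e i\<bar>)"
    unfolding sum.distrib[symmetric] by (rule sum_mono) auto
  also have "(\<Sum>i<n. \<bar>e (Suc i)\<bar>) = (\<Sum>i\<in>Suc ` {..<n}. \<bar>e i\<bar>)" by (simp add: sum.reindex)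
  also have "\<dots> \<le> (\<Sum>i\<le>n. \<bar>e i\<bar>)" by (rule sum_mono2) auto
  also have "(\<Sum>i<n. \<bar>e i\<bar>) \<le> (\<Sum>i\<le>n. \<bar>e i\<bar>)" by (rule sum_mono2) auto
  finally show 1: "(\<Sum>i<n. \<bar>e (Suc i) - e i\<bar>) \<le> 2 * (\<Sum>i\<le>n. \<bar>e i\<bar>)" by simp
  have "(\<Sum>i<n. (e (Suc i) - e i)\<^sup>2) = (\<Sum>i<n. \<bar>e (Suc i) - e i\<bar> * \<bar>e (Suc i) - e i\<bar>)"
    by (simp add: power2_eq_square flip: abs_mult)
  also have "\<dots> \<le> (\<Sum>i<n. \<bar>e (Suc i) - e i\<bar> * (\<Sum>i<n. \<bar>e (Suc i) - e i\<bar>))"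
  proof (intro sum_mono mult_left_mono)
    show "\<bar>e (Suc i) - e i\<bar> \<le> (\<Sum>i<n. \<bar>e (Suc i) - e i\<bar>)" if "i \<in> {..<n}" for i
      using that by (intro member_le_sum[of i "{..<n}" "\<lambda>i. \<bar>e (Suc i) - e i\<bar>"]) auto
  qed simp
  also have "\<dots> = (\<Sum>i<n. \<bar>e (Suc i) - e i\<bar>)\<^sup>2" by (simp add: sum_distrib_right power2_eq_square)
  also have "\<dots> \<le> (2 * (\<Sum>i\<le>n. \<bar>e i\<bar>))\<^sup>2" by (intro power_mono 1 sum_nonneg) auto
  finally show "(\<Sum>i<n. (e (Suc i) - e i)\<^sup>2) \<le> (2 * (\<Sum>i\<le>n. \<bar>e i\<bar>))\<^sup>2" .
qed

text \<open>The integral process is only known as a limit in probability of simple integrals at each fixed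
  time. Choosing the approximating integrand depending on the grid makes the errors at all grid
  points sum up to something negligible.\<close>

lemma ito_integral_remainder:
  assumes I: "is_ito_integral P F W 0 T H I" and H: "continuous_adapted H" and g: "continuous_adapted g"
    and M: "AE \<omega> in P. \<forall>t\<in>{0..T}. M t \<omega> = M 0 \<omega> + I t \<omega>" "\<And>t. t \<in> {0..T} \<Longrightarrow> M t \<in> borel_measurable P"
    and t: "t \<in> {0..T}"
  defines "R \<equiv> \<lambda>n i \<omega>. M (grid T t n (Suc i)) \<omega> - M (grid T t n i) \<omega>
      - H (grid T t n i) \<omega> * (W (grid T t n (Suc i)) \<omega> - W (grid T t n i) \<omega>)"
  shows "conv_in_prob P (\<lambda>n \<omega>. \<Sum>i<Suc n. g (grid T t n i) \<omega> * R n i \<omega>) (\<lambda>\<omega>. 0)"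
    and "conv_in_prob P (\<lambda>n \<omega>. \<Sum>i<Suc n. (g (grid T t n i) \<omega> * R n i \<omega>)\<^sup>2) (\<lambda>\<omega>. 0)"
proof -
  let ?\<tau> = "grid T t"
  have \<tau>_in: "?\<tau> n i \<in> {0..T}" for n i using grid_in[OF _ t] T_pos by simp
  have \<tau>: "mono (?\<tau> n)" "range (?\<tau> n) \<subseteq> {0..T}" "?\<tau> n 0 = 0" for n
    using grid_mono T_pos \<tau>_in grid_0 t by auto
  obtain K where K: "\<And>n. simple_integrand_on P F 0 T (K n)"
    and K1: "conv_in_prob P (\<lambda>n \<omega>. LBINT t:{0..T}. (simple_process (K n) t \<omega> - H t \<omega>)\<^sup>2) (\<lambda>\<omega>. 0)"
    and K2: "\<And>t. t \<in> {0..T} \<Longrightarrow> conv_in_prob P (\<lambda>n. simple_integral W (K n) t) (I t)"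
    using I unfolding is_ito_integral_def by blast
  \<comment> \<open>\<open>e\<close> is the error of the simple integral at a grid node and
    \<open>q\<close> is the L2 error of its integrand. For a fixed grid both vanish in probability
    as \<open>m\<close> grows, and the diagonal choice lets \<open>m\<close> depend on the
    grid.\<close>
  define e where "e n m i \<omega> = simple_integral W (K m) (?\<tau> n i) \<omega> - I (?\<tau> n i) \<omega>" for n m i \<omega>
  define q where "q m \<omega> = (LBINT t:{0..T}. (simple_process (K m) t \<omega> - H t \<omega>)\<^sup>2)" for m \<omega>
  have "conv_in_prob P (\<lambda>m \<omega>. \<bar>q m \<omega>\<bar> + \<bar>\<Sum>i\<le>Suc n. \<bar>e n m i \<omega>\<bar>\<bar>) (\<lambda>\<omega>. 0)" for n
  proof (intro conv_in_prob_zero_add conv_in_prob_zero_sum)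
    show "conv_in_prob P q (\<lambda>\<omega>. 0)" using K1 by (simp add: q_def[abs_def])
    fix i
    note c = K2[OF \<tau>_in[of n i]]
    then have "\<And>m. simple_integral W (K m) (?\<tau> n i) \<in> borel_measurable P" "I (?\<tau> n i) \<in> borel_measurable P"
      by (auto simp: conv_in_prob_def)
    from c[unfolded conv_in_prob_minus[OF this]]
    show "conv_in_prob P (\<lambda>m. e n m i) (\<lambda>\<omega>. 0)" unfolding e_def .
  qed simp
  from conv_in_prob_diagonal[of "\<lambda>n m \<omega>. \<bar>q m \<omega>\<bar> + \<bar>\<Sum>i\<le>Suc n. \<bar>e n m i \<omega>\<bar>\<bar>", OF this] obtain m where
    A: "conv_in_prob P (\<lambda>n \<omega>. \<bar>q (m n) \<omega>\<bar> + \<bar>\<Sum>i\<le>Suc n. \<bar>e n (m n) i \<omega>\<bar>\<bar>) (\<lambda>\<omega>. 0)" by blast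
  define A where "A n \<omega> = \<bar>q (m n) \<omega>\<bar> + \<bar>\<Sum>i\<le>Suc n. \<bar>e n (m n) i \<omega>\<bar>\<bar>" for n \<omega>
  have "\<forall>n. \<exists>p N' b k. grid_refinement (K (m n)) (?\<tau> n) (Suc n) p N' b k"
    using ex_grid_refinement[OF K \<tau>] by blast
  then obtain p N' b k where ref: "\<And>n. grid_refinement (K (m n)) (?\<tau> n) (Suc n) (p n) (N' n) (b n) (k n)"
    by metis
  define V where "V n \<omega> = (\<Sum>l<N' n. (g (?\<tau> n (b n l)) \<omega> * (k n l \<omega> - H (?\<tau> n (b n l)) \<omega>))\<^sup>2
      * (p n (Suc l) - p n l))" for n \<omega>
  have p: "range (p n) \<subseteq> {0..T}" "\<And>l. p n l \<le> p n (Suc l)" "\<And>l. l < N' n \<Longrightarrow> k n l \<in> borel_measurable (F (p n l))" for n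
    using ref[of n] unfolding grid_refinement_def by (auto intro: monoD)
  have kP: "k n l \<in> borel_measurable P" if "l < N' n" for n l
    using p(3)[OF that] p(1)[of n] by (intro measurable_F_P) (auto simp: image_subset_iff)
  have gP: "g (?\<tau> n i) \<in> borel_measurable P" and HP: "H (?\<tau> n i) \<in> borel_measurable P"
    and gF: "g (?\<tau> n i) \<in> borel_measurable (F (?\<tau> n i))" and HF: "H (?\<tau> n i) \<in> borel_measurable (F (?\<tau> n i))"
    and MP: "M (?\<tau> n i) \<in> borel_measurable P" and WP: "W (?\<tau> n i) \<in> borel_measurable P" for n i
    using continuous_adaptedD(1,2)[OF g \<tau>_in] continuous_adaptedD(1,2)[OF H \<tau>_in] M(2)[OF \<tau>_in] W_measurable[OF \<tau>_in] by auto
  have V0: "0 \<le> V n \<omega>" for n \<omega>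
    unfolding V_def using p(2) by (intro sum_nonneg mult_nonneg_nonneg) auto
  have V: "conv_in_prob P V (\<lambda>\<omega>. 0)"
  proof (rule conv_in_prob_transfer[OF A[folded A_def]])
    show "V n \<in> borel_measurable P" for n
      unfolding V_def by (intro borel_measurable_sum borel_measurable_times borel_measurable_power
        borel_measurable_diff gP HP kP borel_measurable_const) auto
    show "AE \<omega> in P. \<forall>r. strict_mono r \<longrightarrow> (\<lambda>n. A (r n) \<omega>) \<longlonglongrightarrow> 0 \<longrightarrow> (\<lambda>n. V (r n) \<omega>) \<longlonglongrightarrow> 0"
      using continuous_adaptedD(3)[OF g] continuous_adaptedD(3)[OF H]
    proof eventually_elim
      case (elim \<omega>)
      obtain \<gamma> where \<gamma>: "\<And>s. s \<in> {0..T} \<Longrightarrow> \<bar>g s \<omega>\<bar> \<le> \<gamma>"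
        using continuous_on_Icc_bounded[OF elim(1)] by blast
      obtain \<eta> where \<eta>: "\<eta> \<longlonglongrightarrow> 0"
        "\<And>n i s. s \<in> {?\<tau> n i..?\<tau> n (Suc i)} \<Longrightarrow> \<bar>H s \<omega> - H (?\<tau> n i) \<omega>\<bar> \<le> \<eta> n"
        using grid_oscillation[OF _ t elim(2)] T_pos by (metis less_imp_le)
      have le: "V n \<omega> \<le> \<gamma>\<^sup>2 * (2 * A n \<omega> + 2 * (\<eta> n)\<^sup>2 * T)" for n
      proof -
        have "V n \<omega> \<le> \<gamma>\<^sup>2 * (2 * q (m n) \<omega> + 2 * (\<eta> n)\<^sup>2 * T)"
          unfolding V_def q_def
          by (rule grid_refinement_variance_le[OF ref elim(2), where g = "\<lambda>i. g (?\<tau> n i) \<omega>"]) (use \<eta> \<gamma> \<tau>_in in auto)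
        also have "\<dots> \<le> \<gamma>\<^sup>2 * (2 * A n \<omega> + 2 * (\<eta> n)\<^sup>2 * T)"
        proof -
          have "q (m n) \<omega> \<le> A n \<omega>" unfolding A_def by linarith
          then show ?thesis by (intro mult_left_mono add_right_mono) auto
        qed
        finally show ?thesis .
      qed
      show ?case
      proof (intro allI impI)
        fix r :: "nat \<Rightarrow> nat" assume r: "strict_mono r" and A0: "(\<lambda>n. A (r n) \<omega>) \<longlonglongrightarrow> 0"
        have \<eta>r: "(\<lambda>n. \<eta> (r n)) \<longlonglongrightarrow> 0" using LIMSEQ_subseq_LIMSEQ[OF \<eta>(1) r] by (simp add: o_def)
        show "(\<lambda>n. V (r n) \<omega>) \<longlonglongrightarrow> 0"
        proof (rule tendsto_sandwich[OF _ _ tendsto_const])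
          have "(\<lambda>n. \<gamma>\<^sup>2 * (2 * A (r n) \<omega> + 2 * (\<eta> (r n))\<^sup>2 * T)) \<longlonglongrightarrow> \<gamma>\<^sup>2 * (2 * 0 + 2 * 0\<^sup>2 * T)"
            by (intro tendsto_intros A0 \<eta>r)
          then show "(\<lambda>n. \<gamma>\<^sup>2 * (2 * A (r n) \<omega> + 2 * (\<eta> (r n))\<^sup>2 * T)) \<longlonglongrightarrow> 0" by simp
        qed (use V0 le in auto)
      qed
    qed
  qed simp
  \<comment> \<open>\<open>D\<close> is the remainder with the increment of the simple integral in
    place of that of M, hence accessible to the Lenglart inequality. It differs from
    \<open>R\<close> by an increment of \<open>e\<close>.\<close>
  define D where "D n i \<omega> = simple_integral W (K (m n)) (?\<tau> n (Suc i)) \<omega> - simple_integral W (K (m n)) (?\<tau> n i) \<omega>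
      - H (?\<tau> n i) \<omega> * (W (?\<tau> n (Suc i)) \<omega> - W (?\<tau> n i) \<omega>)" for n i \<omega>
  have SP: "simple_integral W (K (m n)) (?\<tau> n i) \<in> borel_measurable P" for n i
    using K2[OF \<tau>_in[of n i]] by (auto simp: conv_in_prob_def)
  have DP: "D n i \<in> borel_measurable P" for n i
    unfolding D_def by (intro borel_measurable_diff borel_measurable_times HP WP SP)
  have RP: "R n i \<in> borel_measurable P" for n i
    unfolding R_def by (intro borel_measurable_diff borel_measurable_times HP WP MP)
  define SD where "SD n \<omega> = (\<Sum>i<Suc n. g (?\<tau> n i) \<omega> * D n i \<omega>)" for n \<omega>
  define QD where "QD n \<omega> = (\<Sum>i<Suc n. (g (?\<tau> n i) \<omega> * D n i \<omega>)\<^sup>2)" for n \<omega>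
  define SR where "SR n \<omega> = (\<Sum>i<Suc n. g (?\<tau> n i) \<omega> * R n i \<omega>)" for n \<omega>
  define QR where "QR n \<omega> = (\<Sum>i<Suc n. (g (?\<tau> n i) \<omega> * R n i \<omega>)\<^sup>2)" for n \<omega>
  have SP: "SD n \<in> borel_measurable P" "QD n \<in> borel_measurable P"
    "SR n \<in> borel_measurable P" "QR n \<in> borel_measurable P" for n
    unfolding SD_def QD_def SR_def QR_def
    by (intro borel_measurable_sum borel_measurable_times borel_measurable_power gP DP RP)+
  have Q0: "0 \<le> QD n \<omega>" "0 \<le> QR n \<omega>" for n \<omega>
    unfolding QD_def QR_def by (intro sum_nonneg zero_le_power2)+
  note len = grid_refinement_lenglart[OF ref \<tau>(1,2) gF HF, folded D_def V_def]
  have 1: "conv_in_prob P (\<lambda>n \<omega>. (SD n \<omega>)\<^sup>2) (\<lambda>\<omega>. 0)"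
  proof (rule conv_in_prob_dominated[OF V])
    fix n and \<epsilon> \<delta> :: real assume "0 < \<epsilon>" "0 < \<delta>"
    \<comment> \<open>A single label produces the square of the whole sum.\<close>
    from len[OF this, of "{0}" n "\<lambda>_. 0"]
    show "prob {\<omega> \<in> space P. \<epsilon> < \<bar>(SD n \<omega>)\<^sup>2\<bar>} \<le> prob {\<omega> \<in> space P. \<delta> < \<bar>V n \<omega>\<bar>} + \<delta> / \<epsilon>"
      using V0 by (simp add: SD_def lessThan_def)
  qed (intro borel_measurable_power SP)
  have 2: "conv_in_prob P QD (\<lambda>\<omega>. 0)"
  proof (rule conv_in_prob_dominated[OF V])
    fix n and \<epsilon> \<delta> :: real assume pos: "0 < \<epsilon>" "0 < \<delta>"
    \<comment> \<open>Giving every coarse step its own label produces the sum of squares.\<close>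
    have "(\<Sum>j\<in>{..<Suc n}. (\<Sum>i | i < Suc n \<and> i = j. g (?\<tau> n i) \<omega> * D n i \<omega>)\<^sup>2) = QD n \<omega>" for \<omega>
      unfolding QD_def
    proof (rule sum.cong[OF refl])
      fix j assume "j \<in> {..<Suc n}"
      then have "{i. i < Suc n \<and> i = j} = {j}" by auto
      then show "(\<Sum>i | i < Suc n \<and> i = j. g (?\<tau> n i) \<omega> * D n i \<omega>)\<^sup>2 = (g (?\<tau> n j) \<omega> * D n j \<omega>)\<^sup>2" by simp
    qed
    with len[OF pos, of "{..<Suc n}" n "\<lambda>i. i"]
    show "prob {\<omega> \<in> space P. \<epsilon> < \<bar>QD n \<omega>\<bar>} \<le> prob {\<omega> \<in> space P. \<delta> < \<bar>V n \<omega>\<bar>} + \<delta> / \<epsilon>"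
      using V0 Q0 by (simp only: abs_of_nonneg finite_lessThan)
  qed (rule SP)
  \<comment> \<open>The bound \<gamma> on \<open>g\<close> depends on the path but not on
    \<open>n\<close>, which suffices for limits along single paths. The constant 8 is 2 from
    splitting the square times 4 from \<open>sum_increments_le\<close>.\<close>
  have path: "AE \<omega> in P. \<exists>\<gamma>. \<forall>n. \<bar>SR n \<omega>\<bar> \<le> \<bar>SD n \<omega>\<bar> + 2 * \<gamma> * A n \<omega> \<and>
      QR n \<omega> \<le> 2 * QD n \<omega> + 8 * \<gamma>\<^sup>2 * (A n \<omega>)\<^sup>2"
    using continuous_adaptedD(3)[OF g] M(1)
  proof eventually_elim
    case (elim \<omega>)
    obtain \<gamma> where \<gamma>: "0 \<le> \<gamma>" "\<And>s. s \<in> {0..T} \<Longrightarrow> \<bar>g s \<omega>\<bar> \<le> \<gamma>"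
      using continuous_on_Icc_bounded[OF elim(1)] by blast
    have R_eq: "R n i \<omega> = D n i \<omega> - (e n (m n) (Suc i) \<omega> - e n (m n) i \<omega>)" for n i
      using elim(2)[rule_format, OF \<tau>_in[of n i]] elim(2)[rule_format, OF \<tau>_in[of n "Suc i"]]
      by (simp add: R_def D_def e_def)
    have eA: "(\<Sum>i\<le>Suc n. \<bar>e n (m n) i \<omega>\<bar>) \<le> A n \<omega>" for n by (simp add: A_def)
    have e0: "0 \<le> (\<Sum>i\<le>Suc n. \<bar>e n (m n) i \<omega>\<bar>)" for n by (intro sum_nonneg) simp
    show ?case
    proof (intro exI[of _ \<gamma>] conjI allI)
      fix n
      let ?g = "\<lambda>i. g (?\<tau> n i) \<omega>" and ?de = "\<lambda>i. e n (m n) (Suc i) \<omega> - e n (m n) i \<omega>"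
      have "\<bar>SR n \<omega>\<bar> = \<bar>SD n \<omega> - (\<Sum>i<Suc n. ?g i * ?de i)\<bar>"
        unfolding SR_def SD_def sum_subtractf[symmetric] R_eq by (simp only: right_diff_distrib)
      also have "\<dots> \<le> \<bar>SD n \<omega>\<bar> + (\<Sum>i<Suc n. \<bar>?g i * ?de i\<bar>)"
        using sum_abs[of "\<lambda>i. ?g i * ?de i" "{..<Suc n}"] by linarith
      also have "(\<Sum>i<Suc n. \<bar>?g i * ?de i\<bar>) \<le> (\<Sum>i<Suc n. \<gamma> * \<bar>?de i\<bar>)"
        unfolding abs_mult by (intro sum_mono mult_right_mono \<gamma>(2) \<tau>_in) simp
      also have "\<dots> = \<gamma> * (\<Sum>i<Suc n. \<bar>?de i\<bar>)" by (rule sum_distrib_left[symmetric])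
      also have "\<dots> \<le> \<gamma> * (2 * (\<Sum>i\<le>Suc n. \<bar>e n (m n) i \<omega>\<bar>))"
        by (intro mult_left_mono sum_increments_le \<gamma>)
      also have "\<dots> \<le> \<gamma> * (2 * A n \<omega>)" by (intro mult_left_mono eA \<gamma>) simp
      finally show "\<bar>SR n \<omega>\<bar> \<le> \<bar>SD n \<omega>\<bar> + 2 * \<gamma> * A n \<omega>"
        by (simp add: mult_ac)
      have "QR n \<omega> \<le> (\<Sum>i<Suc n. 2 * (?g i * D n i \<omega>)\<^sup>2 + 2 * (\<gamma>\<^sup>2 * (?de i)\<^sup>2))"
        unfolding QR_def
      proof (rule sum_mono)
        fix i
        from power2_add_le[of "?g i * D n i \<omega>" "- (?g i * ?de i)"]
        have "(?g i * R n i \<omega>)\<^sup>2 \<le> 2 * (?g i * D n i \<omega>)\<^sup>2 + 2 * (?g i * ?de i)\<^sup>2"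
          unfolding R_eq right_diff_distrib by (simp only: power2_minus add_uminus_conv_diff)
        moreover have "\<bar>?g i\<bar>\<^sup>2 \<le> \<gamma>\<^sup>2" by (intro power_mono \<gamma>(2) \<tau>_in) simp
        then have "(?g i * ?de i)\<^sup>2 \<le> \<gamma>\<^sup>2 * (?de i)\<^sup>2"
          unfolding power_mult_distrib by (intro mult_right_mono) auto
        ultimately show "(?g i * R n i \<omega>)\<^sup>2 \<le> 2 * (?g i * D n i \<omega>)\<^sup>2 + 2 * (\<gamma>\<^sup>2 * (?de i)\<^sup>2)" by linarith
      qed
      also have "\<dots> = 2 * QD n \<omega> + 2 * \<gamma>\<^sup>2 * (\<Sum>i<Suc n. (?de i)\<^sup>2)"
        by (simp only: QD_def sum.distrib sum_distrib_left mult.assoc)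
      also have "\<dots> \<le> 2 * QD n \<omega> + 2 * \<gamma>\<^sup>2 * (2 * (\<Sum>i\<le>Suc n. \<bar>e n (m n) i \<omega>\<bar>))\<^sup>2"
        by (intro add_left_mono mult_left_mono sum_increments_le) simp
      also have "\<dots> \<le> 2 * QD n \<omega> + 2 * \<gamma>\<^sup>2 * (2 * A n \<omega>)\<^sup>2"
        by (intro add_left_mono mult_left_mono power_mono eA mult_nonneg_nonneg e0) auto
      finally show "QR n \<omega>
          \<le> 2 * QD n \<omega> + 8 * \<gamma>\<^sup>2 * (A n \<omega>)\<^sup>2"
        by (simp add: power_mult_distrib)
    qed
  qed
  have tend: "(\<lambda>n. x (r n)) \<longlonglongrightarrow> 0 \<and> (\<lambda>n. y (r n)) \<longlonglongrightarrow> 0"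
    if "(\<lambda>n. \<bar>x (r n)\<bar> + \<bar>y (r n)\<bar> :: real) \<longlonglongrightarrow> 0" for x y :: "nat \<Rightarrow> real" and r :: "nat \<Rightarrow> nat"
  proof
    show "(\<lambda>n. x (r n)) \<longlonglongrightarrow> 0"
      by (rule tendsto_rabs_zero_cancel, rule tendsto_sandwich[OF _ _ tendsto_const that]) auto
    show "(\<lambda>n. y (r n)) \<longlonglongrightarrow> 0"
      by (rule tendsto_rabs_zero_cancel, rule tendsto_sandwich[OF _ _ tendsto_const that]) auto
  qed
  have "conv_in_prob P SR (\<lambda>\<omega>. 0)"
  proof (rule conv_in_prob_transfer[OF conv_in_prob_zero_add[OF A[folded A_def] 1]])
    show "AE \<omega> in P. \<forall>r. strict_mono r \<longrightarrow>
        (\<lambda>n. \<bar>A (r n) \<omega>\<bar> + \<bar>(SD (r n) \<omega>)\<^sup>2\<bar>) \<longlonglongrightarrow> 0 \<longrightarrow> (\<lambda>n. SR (r n) \<omega>) \<longlonglongrightarrow> 0"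
      using path
    proof eventually_elim
      case (elim \<omega>)
      then obtain \<gamma> where le: "\<And>n. \<bar>SR n \<omega>\<bar> \<le> \<bar>SD n \<omega>\<bar> + 2 * \<gamma> * A n \<omega>" by blast
      show ?case
      proof (intro allI impI)
        fix r :: "nat \<Rightarrow> nat" assume "(\<lambda>n. \<bar>A (r n) \<omega>\<bar> + \<bar>(SD (r n) \<omega>)\<^sup>2\<bar>) \<longlonglongrightarrow> 0"
        then have lim: "(\<lambda>n. A (r n) \<omega>) \<longlonglongrightarrow> 0" "(\<lambda>n. (SD (r n) \<omega>)\<^sup>2) \<longlonglongrightarrow> 0"
          using tend[of "\<lambda>n. A n \<omega>" r "\<lambda>n. (SD n \<omega>)\<^sup>2"] by auto
        from tendsto_real_sqrt[OF lim(2)] have "(\<lambda>n. \<bar>SD (r n) \<omega>\<bar>) \<longlonglongrightarrow> 0" by simp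
        from tendsto_add[OF this tendsto_mult[OF tendsto_const lim(1), of "2 * \<gamma>"]]
        have B: "(\<lambda>n. \<bar>SD (r n) \<omega>\<bar> + 2 * \<gamma> * A (r n) \<omega>) \<longlonglongrightarrow> 0" by simp
        show "(\<lambda>n. SR (r n) \<omega>) \<longlonglongrightarrow> 0"
          by (rule Lim_null_comparison[OF _ B]) (simp add: le)
      qed
    qed
  qed (auto intro: SP)
  then show "conv_in_prob P (\<lambda>n \<omega>. \<Sum>i<Suc n. g (?\<tau> n i) \<omega> * R n i \<omega>) (\<lambda>\<omega>. 0)"
    unfolding SR_def .
  have "conv_in_prob P QR (\<lambda>\<omega>. 0)"
  proof (rule conv_in_prob_transfer[OF conv_in_prob_zero_add[OF A[folded A_def] 2]])
    show "AE \<omega> in P. \<forall>r. strict_mono r \<longrightarrow>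
        (\<lambda>n. \<bar>A (r n) \<omega>\<bar> + \<bar>QD (r n) \<omega>\<bar>) \<longlonglongrightarrow> 0 \<longrightarrow> (\<lambda>n. QR (r n) \<omega>) \<longlonglongrightarrow> 0"
      using path
    proof eventually_elim
      case (elim \<omega>)
      then obtain \<gamma> where le: "\<And>n. QR n \<omega> \<le> 2 * QD n \<omega> + 8 * \<gamma>\<^sup>2 * (A n \<omega>)\<^sup>2" by blast
      show ?case
      proof (intro allI impI)
        fix r :: "nat \<Rightarrow> nat" assume "(\<lambda>n. \<bar>A (r n) \<omega>\<bar> + \<bar>QD (r n) \<omega>\<bar>) \<longlonglongrightarrow> 0"
        then have lim: "(\<lambda>n. A (r n) \<omega>) \<longlonglongrightarrow> 0" "(\<lambda>n. QD (r n) \<omega>) \<longlonglongrightarrow> 0"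
          using tend[of "\<lambda>n. A n \<omega>" r "\<lambda>n. QD n \<omega>"] by auto
        have "(\<lambda>n. 2 * QD (r n) \<omega> + 8 * \<gamma>\<^sup>2 * (A (r n) \<omega>)\<^sup>2) \<longlonglongrightarrow> 2 * 0 + 8 * \<gamma>\<^sup>2 * 0\<^sup>2"
          by (intro tendsto_intros lim)
        then have B: "(\<lambda>n. 2 * QD (r n) \<omega> + 8 * \<gamma>\<^sup>2 * (A (r n) \<omega>)\<^sup>2) \<longlonglongrightarrow> 0" by simp
        show "(\<lambda>n. QR (r n) \<omega>) \<longlonglongrightarrow> 0"
          by (rule tendsto_sandwich[OF _ _ tendsto_const B]) (use le Q0 in auto)
      qed
    qed
  qed (auto intro: SP)
  then show "conv_in_prob P (\<lambda>n \<omega>. \<Sum>i<Suc n. (g (?\<tau> n i) \<omega> * R n i \<omega>)\<^sup>2) (\<lambda>\<omega>. 0)"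
    unfolding QR_def .
qed

end

section \<open>The second-order expansion along a path\<close>

lemma sum_grid_telescope:
  fixes f :: "real \<Rightarrow> real"
  assumes "t \<in> {0..T}"
  shows "(\<Sum>i<Suc n. f (grid T t n (Suc i)) - f (grid T t n i)) = f t - f 0"
  using sum_lessThan_telescope[of "\<lambda>i. f (grid T t n i)" "Suc n"] grid_last[of t T n] grid_0[of t T n] assms
  by (simp del: sum.lessThan_Suc)

lemma sum_grid_steps_le:
  assumes "0 \<le> T" "t \<in> {0..T}"
  shows "(\<Sum>i<Suc n. grid T t n (Suc i) - grid T t n i) \<le> T"
  using sum_grid_telescope[OF assms(2), of "\<lambda>x. x" n] assms by (simp del: sum.lessThan_Suc)

lemma grid_step_nonneg: "0 \<le> T \<Longrightarrow> 0 \<le> grid T t n (Suc i) - grid T t n i"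
  using monoD[OF grid_mono, of T i "Suc i" t n] by simp

lemma riemann_sum_grid:
  fixes \<phi> :: "real \<Rightarrow> real"
  assumes T: "0 \<le> T" and t: "t \<in> {0..T}" and \<phi>: "continuous_on {0..T} \<phi>"
  shows "(\<lambda>n. \<Sum>i<Suc n. \<phi> (grid T t n i) * (grid T t n (Suc i) - grid T t n i)) \<longlonglongrightarrow> (LBINT s:{0..t}. \<phi> s)"
proof -
  let ?\<tau> = "grid T t"
  obtain \<eta> where \<eta>: "\<eta> \<longlonglongrightarrow> 0"
    "\<And>n i s. s \<in> {?\<tau> n i..?\<tau> n (Suc i)} \<Longrightarrow> \<bar>\<phi> s - \<phi> (?\<tau> n i)\<bar> \<le> \<eta> n"
    using grid_oscillation[OF T t \<phi>] by metis
  have step: "0 \<le> ?\<tau> n (Suc i) - ?\<tau> n i" for n i by (rule grid_step_nonneg[OF T])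
  have cont: "continuous_on {a..b} \<phi>" if "0 \<le> a" "b \<le> T" for a b
    by (rule continuous_on_subset[OF \<phi>]) (use that in auto)
  have tin: "0 \<le> ?\<tau> n i" "?\<tau> n i \<le> T" for n i using grid_in[OF T t] by auto
  have int: "(LBINT s:{a..b}. \<phi> s) = integral {a..b} \<phi>" if "0 \<le> a" "b \<le> T" for a b
    by (rule set_borel_integral_eq_integral(2)) (use borel_integrable_atLeastAtMost' cont[OF that] in blast)
  have tele: "(LBINT s:{0..t}. \<phi> s) = (\<Sum>i<Suc n. integral {?\<tau> n i..?\<tau> n (Suc i)} \<phi>)" for n
  proof -
    have "integral {0..?\<tau> n m} \<phi> = (\<Sum>i<m. integral {?\<tau> n i..?\<tau> n (Suc i)} \<phi>)" for m
    proof (induction m)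
      case 0
      then show ?case using grid_0[of t T n] t by simp
    next
      case (Suc m)
      have "integral {0..?\<tau> n m} \<phi> + integral {?\<tau> n m..?\<tau> n (Suc m)} \<phi> = integral {0..?\<tau> n (Suc m)} \<phi>"
        using tin step[of n m] by (intro Henstock_Kurzweil_Integration.integral_combine integrable_continuous_real cont) auto
      then show ?case using Suc by simp
    qed
    from this[of "Suc n"] show ?thesis using grid_last[of t T n] t int[of 0 t] by simp
  qed
  have bound: "\<bar>(\<Sum>i<Suc n. \<phi> (?\<tau> n i) * (?\<tau> n (Suc i) - ?\<tau> n i)) - (LBINT s:{0..t}. \<phi> s)\<bar> \<le> \<eta> n * T" for n
  proof -
    have \<eta>0: "0 \<le> \<eta> n" using \<eta>(2)[of "?\<tau> n 0" n 0] step[of n 0] by auto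
    have "\<bar>(\<Sum>i<Suc n. \<phi> (?\<tau> n i) * (?\<tau> n (Suc i) - ?\<tau> n i)) - (LBINT s:{0..t}. \<phi> s)\<bar>
      \<le> (\<Sum>i<Suc n. \<bar>\<phi> (?\<tau> n i) * (?\<tau> n (Suc i) - ?\<tau> n i) - integral {?\<tau> n i..?\<tau> n (Suc i)} \<phi>\<bar>)"
      unfolding tele[of n] sum_subtractf[symmetric] by (rule sum_abs)
    also have "\<dots> \<le> (\<Sum>i<Suc n. \<eta> n * (?\<tau> n (Suc i) - ?\<tau> n i))"
    proof (rule sum_mono)
      fix i
      let ?a = "?\<tau> n i" and ?b = "?\<tau> n (Suc i)"
      have ab: "?a \<le> ?b" using step[of n i] by simp
      have I: "\<phi> integrable_on {?a..?b}" by (intro integrable_continuous_real cont tin)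
      have "\<phi> ?a * (?b - ?a) - integral {?a..?b} \<phi> = integral {?a..?b} (\<lambda>s. \<phi> ?a - \<phi> s)"
        using ab I by (subst integral_diff) auto
      moreover have "norm (integral {?a..?b} (\<lambda>s. \<phi> ?a - \<phi> s)) \<le> \<eta> n * (?b - ?a)"
        by (rule integral_bound[OF ab]) (auto intro!: continuous_intros cont tin
            simp: abs_minus_commute[of "\<phi> ?a"] \<eta>(2))
      ultimately show "\<bar>\<phi> ?a * (?b - ?a) - integral {?a..?b} \<phi>\<bar> \<le> \<eta> n * (?b - ?a)" by simp
    qed
    also have "\<dots> = \<eta> n * (\<Sum>i<Suc n. ?\<tau> n (Suc i) - ?\<tau> n i)" by (rule sum_distrib_left[symmetric])
    also have "\<dots> \<le> \<eta> n * T" by (intro mult_left_mono sum_grid_steps_le T t \<eta>0)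
    finally show ?thesis .
  qed
  have "(\<lambda>n. \<eta> n * T) \<longlonglongrightarrow> 0" using tendsto_mult[OF \<eta>(1) tendsto_const[of T]] by simp
  then have "(\<lambda>n. (\<Sum>i<Suc n. \<phi> (?\<tau> n i) * (?\<tau> n (Suc i) - ?\<tau> n i)) - (LBINT s:{0..t}. \<phi> s)) \<longlonglongrightarrow> 0"
    by (rule Lim_null_comparison[rotated]) (intro always_eventually allI, simp only: real_norm_def bound)
  then show ?thesis by (simp only: LIM_zero_iff)
qed

text \<open>The move is split into a change of time at the new position \<open>x'\<close> and a
  change of position at the old time \<open>s\<close>. The mean value theorem treats the first and a
  second-order Taylor expansion the second, so only the assumed derivatives occur. Both intermediate
  points stay within distance \<open>d\<close> of \<open>(s, x)\<close>, and the moduli of the time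
  derivative and of the second space derivative on a compact rectangle bound the error.\<close>

lemma C12_taylor:
  assumes u: "C12 T u" and S: "0 \<le> B"
  obtains \<omega> :: "real \<Rightarrow> real" where "\<And>d. 0 \<le> \<omega> d"
    "\<And>D :: nat \<Rightarrow> real. D \<longlonglongrightarrow> 0 \<Longrightarrow> (\<lambda>n. \<omega> (D n)) \<longlonglongrightarrow> 0"
    "\<And>s s' x x' d. 0 \<le> s \<Longrightarrow> s \<le> s' \<Longrightarrow> s' \<le> T \<Longrightarrow> \<bar>x\<bar> \<le> B \<Longrightarrow> \<bar>x'\<bar> \<le> B \<Longrightarrow>
      (s' - s) + \<bar>x' - x\<bar> \<le> d \<Longrightarrow>
      \<bar>u s' x' - u s x - partial_t T u s x * (s' - s) - partial_x u s x * (x' - x)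
        - 1 / 2 * partial_xx u s x * (x' - x)\<^sup>2\<bar> \<le> \<omega> d * ((s' - s) + (x' - x)\<^sup>2)"
proof -
  let ?S = "{0..T} \<times> {-B..B}"
  have c: "compact ?S" by (intro compact_Times compact_Icc)
  have diff: "\<And>t x. t \<in> {0..T} \<Longrightarrow> (\<lambda>s. u s x) differentiable (at t within {0..T})"
    "\<And>t x. t \<in> {0..T} \<Longrightarrow> (\<lambda>y. u t y) differentiable (at x)"
    "\<And>t x. t \<in> {0..T} \<Longrightarrow> (\<lambda>y. partial_x u t y) differentiable (at x)"
    and ct: "continuous_on ({0..T} \<times> UNIV) (\<lambda>(t, x). partial_t T u t x)"
    and cxx: "continuous_on ({0..T} \<times> UNIV) (\<lambda>(t, x). partial_xx u t x)"
    using u unfolding C12_def by auto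
  obtain \<omega>1 where \<omega>1: "\<And>x y d. x \<in> ?S \<Longrightarrow> y \<in> ?S \<Longrightarrow> dist x y \<le> d \<Longrightarrow>
      dist ((\<lambda>(t, x). partial_t T u t x) x) ((\<lambda>(t, x). partial_t T u t x) y) \<le> \<omega>1 d"
    "\<And>d. 0 \<le> \<omega>1 d" "\<And>D :: nat \<Rightarrow> real. D \<longlonglongrightarrow> 0 \<Longrightarrow> (\<lambda>n. \<omega>1 (D n)) \<longlonglongrightarrow> 0"
    using modulus_of_continuity[OF c continuous_on_subset[OF ct]] by (metis Sigma_mono subset_UNIV subset_refl)
  obtain \<omega>2 where \<omega>2: "\<And>x y d. x \<in> ?S \<Longrightarrow> y \<in> ?S \<Longrightarrow> dist x y \<le> d \<Longrightarrow>
      dist ((\<lambda>(t, x). partial_xx u t x) x) ((\<lambda>(t, x). partial_xx u t x) y) \<le> \<omega>2 d"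
    "\<And>d. 0 \<le> \<omega>2 d" "\<And>D :: nat \<Rightarrow> real. D \<longlonglongrightarrow> 0 \<Longrightarrow> (\<lambda>n. \<omega>2 (D n)) \<longlonglongrightarrow> 0"
    using modulus_of_continuity[OF c continuous_on_subset[OF cxx]] by (metis Sigma_mono subset_UNIV subset_refl)
  have dist_le: "dist (a, b) (a', b') \<le> \<bar>a - a'\<bar> + \<bar>b - b'\<bar>" for a b a' b' :: real
    unfolding dist_Pair_Pair dist_real_def by (rule order_trans[OF sqrt_sum_squares_le_sum_abs]) simp
  show thesis
  proof (rule that[of "\<lambda>d. \<omega>1 d + \<omega>2 d"])
    fix s s' x x' d :: real
    assume s: "0 \<le> s" "s \<le> s'" "s' \<le> T" and x: "\<bar>x\<bar> \<le> B" "\<bar>x'\<bar> \<le> B" and d: "(s' - s) + \<bar>x' - x\<bar> \<le> d"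
    have xB: "x \<in> {-B..B}" "x' \<in> {-B..B}" using x by auto
    have time: "\<bar>u s' x' - u s x' - partial_t T u s x * (s' - s)\<bar> \<le> \<omega>1 d * (s' - s)"
    proof (cases "s = s'")
      case False
      then have lt: "s < s'" using s by simp
      \<comment> \<open>Restricting to \<open>{s..s'}\<close> uses the derivative relative to
        \<open>{0..T}\<close>, so the one-sided derivatives at 0 and T cause no difficulty.\<close>
      have der: "((\<lambda>r. u r x') has_derivative (\<lambda>h. h *\<^sub>R partial_t T u r x')) (at r within {s..s'})"
        if "s \<le> r" "r \<le> s'" for r
      proof -
        have "r \<in> {0..T}" using that s by auto
        then have "((\<lambda>r. u r x') has_vector_derivative partial_t T u r x') (at r within {0..T})"
          using diff(1)[of r x'] vector_derivative_works unfolding partial_t_def by blast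
        then show ?thesis unfolding has_vector_derivative_def
          by (rule has_derivative_subset) (use s in auto)
      qed
      obtain r where r: "r \<in> {s<..<s'}" "u s' x' - u s x' = (s' - s) *\<^sub>R partial_t T u r x'"
        using mvt_simple[OF lt der] by blast
      have "dist (r, x') (s, x) \<le> d" using dist_le[of r x' s x] r(1) d by auto
      then have "\<bar>partial_t T u r x' - partial_t T u s x\<bar> \<le> \<omega>1 d"
        using \<omega>1(1)[of "(r, x')" "(s, x)" d] r(1) s xB by (auto simp: dist_real_def)
      then have "\<bar>partial_t T u r x' - partial_t T u s x\<bar> * (s' - s) \<le> \<omega>1 d * (s' - s)"
        using s by (intro mult_right_mono) auto
      moreover have "u s' x' - u s x' - partial_t T u s x * (s' - s)
          = (partial_t T u r x' - partial_t T u s x) * (s' - s)"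
        using r(2) by (simp add: algebra_simps)
      ultimately show ?thesis using s by (simp add: abs_mult)
    qed simp
    have space: "\<bar>u s x' - u s x - partial_x u s x * (x' - x) - 1 / 2 * partial_xx u s x * (x' - x)\<^sup>2\<bar>
        \<le> \<omega>2 d * (x' - x)\<^sup>2"
    proof (cases "x = x'")
      case False
      have st: "s \<in> {0..T}" using s by auto
      define df where "df m = (if m = 0 then u s else if m = (1::nat) then partial_x u s else partial_xx u s)" for m
      have "DERIV (df m) y :> df (Suc m) y" if "m < 2" for m y
      proof -
        have "DERIV (u s) y :> partial_x u s y" unfolding partial_x_def
          using diff(2)[OF st, of y] DERIV_deriv_iff_real_differentiable by blast
        moreover have "DERIV (partial_x u s) y :> partial_xx u s y" unfolding partial_xx_def
          using diff(3)[OF st, of y] DERIV_deriv_iff_real_differentiable by blast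
        moreover have "m = 0 \<or> m = 1" using that by auto
        ultimately show ?thesis by (auto simp: df_def)
      qed
      then have "\<exists>y. (if x' < x then x' < y \<and> y < x else x < y \<and> y < x') \<and>
          u s x' = (\<Sum>m<2. df m x / fact m * (x' - x) ^ m) + df 2 y / fact 2 * (x' - x)\<^sup>2"
        using False by (intro Taylor[where a = "min x x'" and b = "max x x'"]) (auto simp: df_def)
      then obtain y where y: "if x' < x then x' < y \<and> y < x else x < y \<and> y < x'"
        "u s x' = u s x + partial_x u s x * (x' - x) + partial_xx u s y / 2 * (x' - x)\<^sup>2"
        by (auto simp: df_def numeral_2_eq_2)
      have "\<bar>y - x\<bar> \<le> \<bar>x' - x\<bar>" "\<bar>y\<bar> \<le> B" using y(1) x by (auto split: if_splits)
      then have "dist (s, y) (s, x) \<le> d" using dist_le[of s y s x] d s by auto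
      moreover have "y \<in> {-B..B}" using \<open>\<bar>y\<bar> \<le> B\<close> by auto
      ultimately have "\<bar>partial_xx u s y - partial_xx u s x\<bar> \<le> \<omega>2 d"
        using \<omega>2(1)[of "(s, y)" "(s, x)" d] st xB by (auto simp: dist_real_def)
      then have le: "\<bar>partial_xx u s y - partial_xx u s x\<bar> * (x' - x)\<^sup>2 \<le> \<omega>2 d * (x' - x)\<^sup>2"
        by (intro mult_right_mono) auto
      have eq: "u s x' - u s x - partial_x u s x * (x' - x) - 1 / 2 * partial_xx u s x * (x' - x)\<^sup>2
          = 1 / 2 * ((partial_xx u s y - partial_xx u s x) * (x' - x)\<^sup>2)"
        unfolding y(2) by (simp add: field_simps)
      have "\<bar>1 / 2 * ((partial_xx u s y - partial_xx u s x) * (x' - x)\<^sup>2)\<bar>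
          = 1 / 2 * (\<bar>partial_xx u s y - partial_xx u s x\<bar> * (x' - x)\<^sup>2)"
        by (simp add: abs_mult)
      moreover have "0 \<le> \<bar>partial_xx u s y - partial_xx u s x\<bar> * (x' - x)\<^sup>2" by simp
      ultimately show ?thesis unfolding eq using le by linarith
    qed simp
    have "\<omega>1 d * (s' - s) + \<omega>2 d * (x' - x)\<^sup>2 \<le> (\<omega>1 d + \<omega>2 d) * ((s' - s) + (x' - x)\<^sup>2)"
      unfolding distrib_left[of "\<omega>1 d + \<omega>2 d"]
      using \<omega>1(2)[of d] \<omega>2(2)[of d] s by (intro add_mono mult_right_mono) auto
    then show "\<bar>u s' x' - u s x - partial_t T u s x * (s' - s) - partial_x u s x * (x' - x)
        - 1 / 2 * partial_xx u s x * (x' - x)\<^sup>2\<bar> \<le> (\<omega>1 d + \<omega>2 d) * ((s' - s) + (x' - x)\<^sup>2)"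
      using time space by linarith
  next
    show "(\<lambda>n. \<omega>1 (D n) + \<omega>2 (D n)) \<longlonglongrightarrow> 0" if "D \<longlonglongrightarrow> 0" for D :: "nat \<Rightarrow> real"
      using tendsto_add[OF \<omega>1(3)[OF that] \<omega>2(3)[OF that]] by simp
  qed (use \<omega>1(2) \<omega>2(2) in auto)
qed

text \<open>With \<open>\<Delta>m = H \<Delta>w + R\<close> this is the second-order Taylor expansion summed along the grid. The
  hypotheses are the probabilistic limits, taken along one path and a subsequence.\<close>

lemma ito_formula_path:
  fixes m w H :: "real \<Rightarrow> real" and r :: "nat \<Rightarrow> nat"
  assumes T: "0 \<le> T" and t: "t \<in> {0..T}" and u: "C12 T u"
    and m: "continuous_on {0..T} m" and H: "continuous_on {0..T} H" and r: "strict_mono r"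
  defines "\<tau> \<equiv> grid T t"
  defines "dt \<equiv> \<lambda>n i. \<tau> n (Suc i) - \<tau> n i" and "dw \<equiv> \<lambda>n i. w (\<tau> n (Suc i)) - w (\<tau> n i)"
  defines "R \<equiv> \<lambda>n i. m (\<tau> n (Suc i)) - m (\<tau> n i) - H (\<tau> n i) * dw n i"
  assumes R1: "(\<lambda>n. \<Sum>i<Suc (r n). partial_x u (\<tau> (r n) i) (m (\<tau> (r n) i)) * R (r n) i) \<longlonglongrightarrow> 0"
    and R2: "(\<lambda>n. \<Sum>i<Suc (r n). (R (r n) i)\<^sup>2) \<longlonglongrightarrow> 0"
    and Q1: "(\<lambda>n. \<Sum>i<Suc (r n). (partial_xx u (\<tau> (r n) i) (m (\<tau> (r n) i)) * (H (\<tau> (r n) i))\<^sup>2)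
        * ((dw (r n) i)\<^sup>2 - dt (r n) i)) \<longlonglongrightarrow> 0"
    and Q2: "(\<lambda>n. \<Sum>i<Suc (r n). (H (\<tau> (r n) i))\<^sup>2 * ((dw (r n) i)\<^sup>2 - dt (r n) i)) \<longlonglongrightarrow> 0"
  shows "(\<lambda>n. \<Sum>i<Suc (r n). (partial_x u (\<tau> (r n) i) (m (\<tau> (r n) i)) * H (\<tau> (r n) i)) * dw (r n) i)
    \<longlonglongrightarrow> u t (m t) - u 0 (m 0)
      - (LBINT s:{0..t}. partial_t T u s (m s) + 1 / 2 * (H s)\<^sup>2 * partial_xx u s (m s))"
proof -
  have \<tau>_in: "0 \<le> \<tau> n i" "\<tau> n i \<le> T" for n i using grid_in[OF T t] by (auto simp: \<tau>_def)
  have dt0: "0 \<le> dt n i" for n i unfolding dt_def \<tau>_def by (rule grid_step_nonneg[OF T])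
  have dt_sum: "(\<Sum>i<Suc n. dt n i) \<le> T" for n unfolding dt_def \<tau>_def by (rule sum_grid_steps_le[OF T t])
  have comp: "continuous_on {0..T} (\<lambda>s. \<phi> s (m s))" if "continuous_on ({0..T} \<times> UNIV) (\<lambda>(t, x). \<phi> t x)"
    for \<phi> :: "real \<Rightarrow> real \<Rightarrow> real"
  proof -
    have "continuous_on {0..T} (\<lambda>s. (\<lambda>(t, x). \<phi> t x) (s, m s))"
      by (rule continuous_on_compose2[OF that]) (auto intro!: continuous_intros m)
    then show ?thesis by simp
  qed
  have cb: "continuous_on {0..T} (\<lambda>s. partial_t T u s (m s))"
    and cf: "continuous_on {0..T} (\<lambda>s. partial_xx u s (m s))"
    using u unfolding C12_def by (auto intro!: comp)
  obtain B where B: "0 \<le> B" "\<And>s. s \<in> {0..T} \<Longrightarrow> \<bar>m s\<bar> \<le> B" using continuous_on_Icc_bounded[OF m] by blast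
  obtain C where C: "0 \<le> C" "\<And>s. s \<in> {0..T} \<Longrightarrow> \<bar>partial_xx u s (m s)\<bar> \<le> C"
    using continuous_on_Icc_bounded[OF cf] by blast
  obtain L where L: "0 \<le> L" "\<And>s. s \<in> {0..T} \<Longrightarrow> \<bar>H s\<bar> \<le> L" using continuous_on_Icc_bounded[OF H] by blast
  obtain \<eta> where \<eta>: "\<eta> \<longlonglongrightarrow> 0" "\<And>n i s. s \<in> {\<tau> n i..\<tau> n (Suc i)} \<Longrightarrow> \<bar>m s - m (\<tau> n i)\<bar> \<le> \<eta> n"
    using grid_oscillation[OF T t m] unfolding \<tau>_def by metis
  obtain \<omega> where \<omega>: "\<And>d. 0 \<le> \<omega> d"
    "\<And>D :: nat \<Rightarrow> real. D \<longlonglongrightarrow> 0 \<Longrightarrow> (\<lambda>n. \<omega> (D n)) \<longlonglongrightarrow> 0"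
    "\<And>s s' x x' d. 0 \<le> s \<Longrightarrow> s \<le> s' \<Longrightarrow> s' \<le> T \<Longrightarrow> \<bar>x\<bar> \<le> B \<Longrightarrow> \<bar>x'\<bar> \<le> B \<Longrightarrow>
      (s' - s) + \<bar>x' - x\<bar> \<le> d \<Longrightarrow>
      \<bar>u s' x' - u s x - partial_t T u s x * (s' - s) - partial_x u s x * (x' - x)
        - 1 / 2 * partial_xx u s x * (x' - x)\<^sup>2\<bar> \<le> \<omega> d * ((s' - s) + (x' - x)\<^sup>2)"
    using C12_taylor[OF u B(1)] by blast
  define a where "a n i = partial_x u (\<tau> n i) (m (\<tau> n i))" for n i
  define b where "b n i = partial_t T u (\<tau> n i) (m (\<tau> n i))" for n i
  define f where "f n i = partial_xx u (\<tau> n i) (m (\<tau> n i))" for n i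
  define h where "h n i = H (\<tau> n i)" for n i
  define dm where "dm n i = m (\<tau> n (Suc i)) - m (\<tau> n i)" for n i
  define err where "err n i = u (\<tau> n (Suc i)) (m (\<tau> n (Suc i))) - u (\<tau> n i) (m (\<tau> n i))
      - b n i * dt n i - a n i * dm n i - 1 / 2 * f n i * (dm n i)\<^sup>2" for n i
  define VV where "VV n = (\<Sum>i<Suc n. (h n i)\<^sup>2 * (dw n i)\<^sup>2)" for n
  define RR where "RR n = (\<Sum>i<Suc n. (R n i)\<^sup>2)" for n
  \<comment> \<open>The mesh bounds a time step and \<eta> bounds the increment of the path over it,
    so \<open>D n\<close> is an admissible argument of the Taylor modulus for all steps.\<close>
  define D where "D n = T / real (Suc n) + \<eta> n" for n
  have dm: "dm n i = h n i * dw n i + R n i" for n i by (simp add: dm_def R_def h_def)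
  have VV0: "0 \<le> VV n" "0 \<le> RR n" for n unfolding VV_def RR_def by (auto intro!: sum_nonneg simp del: sum.lessThan_Suc)
  have fC: "\<bar>f n i\<bar> \<le> C" for n i using C(2) \<tau>_in by (simp add: f_def)
  have D0: "D \<longlonglongrightarrow> 0" using tendsto_add[OF mesh_tendsto_0[of T] \<eta>(1)] by (simp add: D_def[abs_def])
  then have \<omega>D: "(\<lambda>n. \<omega> (D (r n))) \<longlonglongrightarrow> 0"
    using LIMSEQ_subseq_LIMSEQ[OF D0 r] by (intro \<omega>(2)) (simp add: o_def)
  have RR: "(\<lambda>n. RR (r n)) \<longlonglongrightarrow> 0" using R2 by (simp only: RR_def)
  define q where "q n = (\<Sum>i<Suc n. (h n i)\<^sup>2 * ((dw n i)\<^sup>2 - dt n i))" for n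
  have q: "(\<lambda>n. q (r n)) \<longlonglongrightarrow> 0" using Q2 by (simp only: q_def h_def)
  \<comment> \<open>This is the purpose of \<open>Q2\<close>: along the path, the quadratic
    variation built from \<open>h * dw\<close> stays bounded, because it differs from a sum of
    \<open>h^2 * dt\<close> by a null sequence.\<close>
  have VV_le: "VV n \<le> q n + L\<^sup>2 * T" for n
  proof -
    have "VV n = q n + (\<Sum>i<Suc n. (h n i)\<^sup>2 * dt n i)"
      unfolding VV_def q_def sum.distrib[symmetric] by (intro sum.cong) (auto simp: algebra_simps)
    also have "(\<Sum>i<Suc n. (h n i)\<^sup>2 * dt n i) \<le> (\<Sum>i<Suc n. L\<^sup>2 * dt n i)"
    proof (intro sum_mono mult_right_mono dt0)
      fix i
      have "\<bar>h n i\<bar>\<^sup>2 \<le> L\<^sup>2" using L(2) \<tau>_in by (intro power_mono) (auto simp: h_def)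
      then show "(h n i)\<^sup>2 \<le> L\<^sup>2" by simp
    qed
    also have "\<dots> = L\<^sup>2 * (\<Sum>i<Suc n. dt n i)" by (rule sum_distrib_left[symmetric])
    also have "\<dots> \<le> L\<^sup>2 * T" by (intro mult_left_mono dt_sum) simp
    finally show ?thesis by simp
  qed
  \<comment> \<open>The Taylor error is a vanishing modulus times a bounded quadratic variation. The
    factors 2 arise from the square of \<open>dm = h * dw + R\<close>.\<close>
  have err_le: "\<bar>\<Sum>i<Suc n. err n i\<bar> \<le> \<omega> (D n) * (T + 2 * (q n + L\<^sup>2 * T) + 2 * RR n)" for n
  proof -
    have "\<bar>\<Sum>i<Suc n. err n i\<bar> \<le> (\<Sum>i<Suc n. \<omega> (D n) * (dt n i + 2 * ((h n i)\<^sup>2 * (dw n i)\<^sup>2) + 2 * (R n i)\<^sup>2))"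
    proof (rule order_trans[OF sum_abs], rule sum_mono)
      fix i
      have "\<bar>dm n i\<bar> \<le> \<eta> n" using \<eta>(2)[of "\<tau> n (Suc i)" n i] dt0[of n i] by (simp add: dm_def dt_def)
      moreover have "dt n i \<le> T / real (Suc n)" unfolding dt_def \<tau>_def by (rule grid_step[OF T])
      ultimately have "dt n i + \<bar>dm n i\<bar> \<le> D n" by (simp add: D_def)
      then have "\<bar>err n i\<bar> \<le> \<omega> (D n) * (dt n i + (dm n i)\<^sup>2)"
        unfolding err_def a_def b_def f_def dm_def dt_def
        using \<tau>_in dt0[of n i] B(2) by (intro \<omega>(3)) (auto simp: dt_def)
      also have "\<dots> \<le> \<omega> (D n) * (dt n i + 2 * ((h n i)\<^sup>2 * (dw n i)\<^sup>2) + 2 * (R n i)\<^sup>2)"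
      proof (intro mult_left_mono \<omega>(1))
        from power2_add_le[of "h n i * dw n i" "R n i"]
        show "dt n i + (dm n i)\<^sup>2 \<le> dt n i + 2 * ((h n i)\<^sup>2 * (dw n i)\<^sup>2) + 2 * (R n i)\<^sup>2"
          unfolding dm by (simp add: power_mult_distrib)
      qed
      finally show "\<bar>err n i\<bar> \<le> \<omega> (D n) * (dt n i + 2 * ((h n i)\<^sup>2 * (dw n i)\<^sup>2) + 2 * (R n i)\<^sup>2)" .
    qed
    also have "\<dots> = \<omega> (D n) * ((\<Sum>i<Suc n. dt n i) + 2 * VV n + 2 * RR n)"
      unfolding VV_def RR_def by (simp only: sum.distrib sum_distrib_left[symmetric])
    also have "\<dots> \<le> \<omega> (D n) * (T + 2 * (q n + L\<^sup>2 * T) + 2 * RR n)"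
      by (intro mult_left_mono add_mono dt_sum VV_le order_refl \<omega>(1)) simp
    finally show ?thesis .
  qed
  have E: "(\<lambda>n. \<Sum>i<Suc (r n). err (r n) i) \<longlonglongrightarrow> 0"
  proof -
    have "(\<lambda>n. \<omega> (D (r n)) * (T + 2 * (q (r n) + L\<^sup>2 * T) + 2 * RR (r n))) \<longlonglongrightarrow> 0 * (T + 2 * (0 + L\<^sup>2 * T) + 2 * 0)"
      by (intro tendsto_intros \<omega>D q RR)
    then have "(\<lambda>n. \<omega> (D (r n)) * (T + 2 * (q (r n) + L\<^sup>2 * T) + 2 * RR (r n))) \<longlonglongrightarrow> 0" by (simp only: mult_zero_left)
    then show ?thesis
      by (rule Lim_null_comparison[rotated]) (intro always_eventually allI, simp only: real_norm_def err_le)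
  qed
  \<comment> \<open>By Cauchy-Schwarz the mixed term is at most the root of a bounded quadratic
    variation times the root of the vanishing sum of squared remainders.\<close>
  have cross_le: "\<bar>\<Sum>i<Suc n. f n i * (2 * (h n i * dw n i * R n i) + (R n i)\<^sup>2)\<bar>
      \<le> C * (2 * (sqrt (\<bar>q n\<bar> + L\<^sup>2 * T) * sqrt (RR n)) + RR n)" for n
  proof -
    have "\<bar>\<Sum>i<Suc n. f n i * (2 * (h n i * dw n i * R n i) + (R n i)\<^sup>2)\<bar>
      \<le> (\<Sum>i<Suc n. C * (2 * (\<bar>h n i * dw n i\<bar> * \<bar>R n i\<bar>) + (R n i)\<^sup>2))"
    proof (rule order_trans[OF sum_abs], rule sum_mono)
      fix i
      have "\<bar>2 * (h n i * dw n i * R n i) + (R n i)\<^sup>2\<bar> \<le> 2 * (\<bar>h n i * dw n i\<bar> * \<bar>R n i\<bar>) + (R n i)\<^sup>2"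
        by (rule order_trans[OF abs_triangle_ineq]) (simp add: abs_mult)
      then show "\<bar>f n i * (2 * (h n i * dw n i * R n i) + (R n i)\<^sup>2)\<bar>
          \<le> C * (2 * (\<bar>h n i * dw n i\<bar> * \<bar>R n i\<bar>) + (R n i)\<^sup>2)"
        unfolding abs_mult[of "f n i"] by (intro mult_mono fC C) auto
    qed
    also have "\<dots> = C * (2 * (\<Sum>i<Suc n. \<bar>h n i * dw n i\<bar> * \<bar>R n i\<bar>) + RR n)"
      unfolding RR_def by (simp only: sum.distrib sum_distrib_left[symmetric])
    also have "\<dots> \<le> C * (2 * (sqrt (\<bar>q n\<bar> + L\<^sup>2 * T) * sqrt (RR n)) + RR n)"
    proof (intro mult_left_mono add_right_mono C)
      have "(\<Sum>i<Suc n. \<bar>h n i * dw n i\<bar> * \<bar>R n i\<bar>)\<^sup>2 \<le> (\<Sum>i<Suc n. \<bar>h n i * dw n i\<bar>\<^sup>2) * (\<Sum>i<Suc n. \<bar>R n i\<bar>\<^sup>2)"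
        by (rule Cauchy_Schwarz_ineq_sum)
      also have "\<dots> = VV n * RR n" by (simp only: VV_def RR_def power2_abs power_mult_distrib)
      finally have "(\<Sum>i<Suc n. \<bar>h n i * dw n i\<bar> * \<bar>R n i\<bar>) \<le> sqrt (VV n * RR n)"
        by (rule real_le_rsqrt)
      also have "\<dots> \<le> sqrt (\<bar>q n\<bar> + L\<^sup>2 * T) * sqrt (RR n)"
        unfolding real_sqrt_mult using VV_le[of n] by (intro mult_right_mono real_sqrt_le_mono) (auto simp: VV0)
      finally show "(\<Sum>i<Suc n. \<bar>h n i * dw n i\<bar> * \<bar>R n i\<bar>) \<le> sqrt (\<bar>q n\<bar> + L\<^sup>2 * T) * sqrt (RR n)" .
    qed simp
    finally show ?thesis .
  qed
  have X: "(\<lambda>n. \<Sum>i<Suc (r n). f (r n) i * (2 * (h (r n) i * dw (r n) i * R (r n) i) + (R (r n) i)\<^sup>2)) \<longlonglongrightarrow> 0"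
  proof -
    have "(\<lambda>n. C * (2 * (sqrt (\<bar>q (r n)\<bar> + L\<^sup>2 * T) * sqrt (RR (r n))) + RR (r n)))
        \<longlonglongrightarrow> C * (2 * (sqrt (\<bar>0\<bar> + L\<^sup>2 * T) * sqrt 0) + 0)"
      by (intro tendsto_intros q RR)
    then have "(\<lambda>n. C * (2 * (sqrt (\<bar>q (r n)\<bar> + L\<^sup>2 * T) * sqrt (RR (r n))) + RR (r n))) \<longlonglongrightarrow> 0"
      by (simp only: real_sqrt_zero mult_zero_right add_0_right)
    then show ?thesis
      by (rule Lim_null_comparison[rotated]) (intro always_eventually allI, simp only: real_norm_def cross_le)
  qed
  let ?\<beta> = "\<lambda>s. partial_t T u s (m s) + 1 / 2 * (H s)\<^sup>2 * partial_xx u s (m s)"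
  have "(\<lambda>n. \<Sum>i<Suc n. ?\<beta> (\<tau> n i) * dt n i) \<longlonglongrightarrow> (LBINT s:{0..t}. ?\<beta> s)"
    unfolding dt_def \<tau>_def by (rule riemann_sum_grid[OF T t]) (intro continuous_intros cb cf H)
  from LIMSEQ_subseq_LIMSEQ[OF this r]
  have I: "(\<lambda>n. \<Sum>i<Suc (r n). ?\<beta> (\<tau> (r n) i) * dt (r n) i) \<longlonglongrightarrow> (LBINT s:{0..t}. ?\<beta> s)" by (simp only: o_def)
  let ?SB = "\<lambda>n. \<Sum>i<Suc n. ?\<beta> (\<tau> n i) * dt n i"
  let ?SE = "\<lambda>n. \<Sum>i<Suc n. err n i"
  let ?SA = "\<lambda>n. \<Sum>i<Suc n. a n i * R n i"
  let ?SF = "\<lambda>n. \<Sum>i<Suc n. (f n i * (h n i)\<^sup>2) * ((dw n i)\<^sup>2 - dt n i)"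
  let ?SX = "\<lambda>n. \<Sum>i<Suc n. f n i * (2 * (h n i * dw n i * R n i) + (R n i)\<^sup>2)"
  \<comment> \<open>In the second-order term the square of \<open>h * dw + R\<close> is split into
    \<open>h^2 * dt\<close>, which joins the time derivative to form the drift, the centred part
    \<open>h^2 * (dw^2 - dt)\<close>, and the terms containing \<open>R\<close>.\<close>
  have main: "(\<Sum>i<Suc n. (a n i * h n i) * dw n i) = u t (m t) - u 0 (m 0)
      - ?SB n - ?SE n - ?SA n - 1 / 2 * ?SF n - 1 / 2 * ?SX n" for n
  proof -
    have "u t (m t) - u 0 (m 0) = (\<Sum>i<Suc n. u (\<tau> n (Suc i)) (m (\<tau> n (Suc i))) - u (\<tau> n i) (m (\<tau> n i)))"
      unfolding \<tau>_def by (rule sum_grid_telescope[OF t, of "\<lambda>s. u s (m s)", symmetric])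
    also have "\<dots> = (\<Sum>i<Suc n. (a n i * h n i) * dw n i + ?\<beta> (\<tau> n i) * dt n i + err n i + a n i * R n i
      + 1 / 2 * ((f n i * (h n i)\<^sup>2) * ((dw n i)\<^sup>2 - dt n i))
      + 1 / 2 * (f n i * (2 * (h n i * dw n i * R n i) + (R n i)\<^sup>2)))"
    proof (rule sum.cong[OF refl])
      fix i
      have "u (\<tau> n (Suc i)) (m (\<tau> n (Suc i))) - u (\<tau> n i) (m (\<tau> n i))
          = err n i + b n i * dt n i + a n i * dm n i + 1 / 2 * f n i * (dm n i)\<^sup>2" by (simp add: err_def)
      also have "\<dots> = err n i + b n i * dt n i + a n i * (h n i * dw n i + R n i)
          + 1 / 2 * f n i * (h n i * dw n i + R n i)\<^sup>2" unfolding dm ..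
      also have "\<dots> = (a n i * h n i) * dw n i + (b n i + 1 / 2 * (h n i)\<^sup>2 * f n i) * dt n i + err n i + a n i * R n i
      + 1 / 2 * ((f n i * (h n i)\<^sup>2) * ((dw n i)\<^sup>2 - dt n i))
      + 1 / 2 * (f n i * (2 * (h n i * dw n i * R n i) + (R n i)\<^sup>2))"
        by (simp add: power2_eq_square field_simps)
      finally show "u (\<tau> n (Suc i)) (m (\<tau> n (Suc i))) - u (\<tau> n i) (m (\<tau> n i))
        = (a n i * h n i) * dw n i + ?\<beta> (\<tau> n i) * dt n i + err n i + a n i * R n i
        + 1 / 2 * ((f n i * (h n i)\<^sup>2) * ((dw n i)\<^sup>2 - dt n i))
        + 1 / 2 * (f n i * (2 * (h n i * dw n i * R n i) + (R n i)\<^sup>2))"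
        unfolding b_def f_def h_def .
    qed
    finally show ?thesis unfolding sum.distrib sum_distrib_left[symmetric] by linarith
  qed
  have "(\<lambda>n. u t (m t) - u 0 (m 0)
      - ?SB (r n) - ?SE (r n) - ?SA (r n) - 1 / 2 * ?SF (r n) - 1 / 2 * ?SX (r n))
    \<longlonglongrightarrow> u t (m t) - u 0 (m 0) - (LBINT s:{0..t}. ?\<beta> s) - 0 - 0 - 1 / 2 * 0 - 1 / 2 * 0"
    using R1 Q1 by (intro tendsto_diff tendsto_mult tendsto_const I E X) (simp_all only: a_def f_def h_def)
  then show ?thesis
    unfolding main[symmetric] by (simp only: a_def h_def mult_zero_right diff_zero)
qed

section \<open>Ito's formula\<close>

context wiener
begin

lemma continuous_adapted_const: "continuous_adapted (\<lambda>_ _. c)"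
  unfolding continuous_adapted_def adapted_on_def by auto

lemma continuous_adapted_add:
  "continuous_adapted X \<Longrightarrow> continuous_adapted Y \<Longrightarrow> continuous_adapted (\<lambda>t \<omega>. X t \<omega> + Y t \<omega>)"
  unfolding continuous_adapted_def adapted_on_def
  by (auto intro!: borel_measurable_add) (auto elim!: AE_mp intro!: AE_I2 continuous_on_add)

section \<open>Joint measurability, time integrals and quadratic variation\<close>

text \<open>Setting the process to zero on the paths that are not continuous changes it on a null
  set, which belongs to every \<open>F t\<close>. The modified process is continuous everywhere and
  is a limit of its values at times rounded down.\<close>

lemma continuous_adapted_progressive:
  assumes X: "continuous_adapted X"
  shows "progressive_on P F 0 T X"
proof -
  let ?\<Omega> = "{\<omega> \<in> space P. continuous_on {0..T} (\<lambda>t. X t \<omega>)}"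
  define Y where "Y s \<omega> = indicator ?\<Omega> \<omega> * X s \<omega>" for s \<omega>
  have "{\<omega> \<in> space P. \<not> continuous_on {0..T} (\<lambda>t. X t \<omega>)} \<in> null_sets P"
    using continuous_adaptedD(3)[OF X] unfolding AE_iff_null_sets .
  then have "space (F t) - {\<omega> \<in> space P. \<not> continuous_on {0..T} (\<lambda>t. X t \<omega>)} \<in> sets (F t)" for t
    by (intro sets.compl_sets null_sets_F)
  moreover have "space P - {\<omega> \<in> space P. \<not> continuous_on {0..T} (\<lambda>t. X t \<omega>)} = ?\<Omega>" by auto
  ultimately have \<Omega>: "?\<Omega> \<in> sets (F t)" for t by simp
  have Y_meas: "Y s \<in> borel_measurable (F t)" if "0 \<le> s" "s \<le> t" "t \<le> T" for s t
    unfolding Y_def using \<Omega>[of t] measurable_F_mono[OF continuous_adaptedD(1)[OF X]] that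
    by (intro borel_measurable_times borel_measurable_indicator) auto
  have Y_cont: "continuous_on {0..T} (\<lambda>t. Y t \<omega>)" for \<omega>
    by (cases "\<omega> \<in> ?\<Omega>") (auto simp: Y_def)
  have XY: "AE \<omega> in P. \<forall>t\<in>{0..T}. X t \<omega> = Y t \<omega>"
    using continuous_adaptedD(3)[OF X] AE_space by eventually_elim (simp add: Y_def)
  have Y_joint: "(\<lambda>(s, \<omega>). Y s \<omega>) \<in> borel_measurable (restrict_space borel {0..t} \<Otimes>\<^sub>M F t)"
    if t: "t \<in> {0..T}" for t
  proof -
    let ?N = "restrict_space borel {0..t} \<Otimes>\<^sub>M F t"
    \<comment> \<open>Rounding down means that only the past is used. The cap at t keeps every
      rounded time admissible, even for indices that no \<open>s\<close> in \<open>{0..t}\<close>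
      attains, so countably many measurable pieces can be glued.\<close>
    define q where "q n s = min t (real (nat \<lfloor>real (Suc n) * s\<rfloor>) / real (Suc n))" for n s
    show ?thesis
    proof (rule borel_measurable_LIMSEQ_real[where u = "\<lambda>n p. Y (q n (fst p)) (snd p)"])
      fix n
      have "(\<lambda>p. (\<lambda>i p. Y (min t (real i / real (Suc n))) (snd p)) (nat \<lfloor>real (Suc n) * fst p\<rfloor>) p) \<in> borel_measurable ?N"
      proof (rule measurable_compose_countable[where f = "\<lambda>i p. Y (min t (real i / real (Suc n))) (snd p)"])
        show "(\<lambda>p. Y (min t (real i / real (Suc n))) (snd p)) \<in> borel_measurable ?N" for i :: nat
          by (rule measurable_compose[OF measurable_snd Y_meas]) (use t in auto)
        have "(\<lambda>s. nat \<lfloor>real (Suc n) * s\<rfloor>) \<in> measurable (restrict_space borel {0..t}) (count_space UNIV)"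
          by (rule measurable_restrict_space1) measurable
        then show "(\<lambda>p. nat \<lfloor>real (Suc n) * fst p\<rfloor>) \<in> measurable ?N (count_space UNIV)"
          by (rule measurable_compose[OF measurable_fst])
      qed
      then show "(\<lambda>p. Y (q n (fst p)) (snd p)) \<in> borel_measurable ?N" by (simp add: q_def)
    next
      fix p assume "p \<in> space ?N"
      then obtain s \<omega> where p: "p = (s, \<omega>)" "0 \<le> s" "s \<le> t" by (auto simp: space_pair_measure space_restrict_space)
      have q_le: "q n s \<le> s" "s - 1 / real (Suc n) \<le> q n s" "0 \<le> q n s" for n
      proof -
        have "0 \<le> \<lfloor>real (Suc n) * s\<rfloor>" using p by simp
        then have nf: "real (nat \<lfloor>real (Suc n) * s\<rfloor>) = real_of_int \<lfloor>real (Suc n) * s\<rfloor>" by simp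
        have "real_of_int \<lfloor>real (Suc n) * s\<rfloor> \<le> real (Suc n) * s" "real (Suc n) * s - 1 \<le> real_of_int \<lfloor>real (Suc n) * s\<rfloor>"
          by linarith+
        then have "real_of_int \<lfloor>real (Suc n) * s\<rfloor> / real (Suc n) \<le> s"
          "s - 1 / real (Suc n) \<le> real_of_int \<lfloor>real (Suc n) * s\<rfloor> / real (Suc n)"
          using divide_right_mono[of "real_of_int \<lfloor>real (Suc n) * s\<rfloor>" "real (Suc n) * s" "real (Suc n)"]
            divide_right_mono[of "real (Suc n) * s - 1" "real_of_int \<lfloor>real (Suc n) * s\<rfloor>" "real (Suc n)"]
          by (simp_all add: diff_divide_distrib del: of_nat_Suc)
        moreover have "0 \<le> real_of_int \<lfloor>real (Suc n) * s\<rfloor> / real (Suc n)" using p by simp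
        moreover have "0 \<le> 1 / real (Suc n)" by simp
        ultimately show "q n s \<le> s" "s - 1 / real (Suc n) \<le> q n s" "0 \<le> q n s"
          using p unfolding q_def nf by linarith+
      qed
      have q: "(\<lambda>n. q n s) \<longlonglongrightarrow> s"
      proof (rule tendsto_sandwich[OF _ _ _ tendsto_const])
        show "(\<lambda>n. s - 1 / real (Suc n)) \<longlonglongrightarrow> s"
          using tendsto_diff[OF tendsto_const[of s] mesh_tendsto_0[of 1]] by simp
      qed (use q_le in auto)
      have "(\<lambda>n. Y (q n s) \<omega>) \<longlonglongrightarrow> Y s \<omega>"
        by (rule continuous_on_tendsto_compose[OF Y_cont q])
          (use p t q_le in \<open>auto intro!: always_eventually intro: order_trans[OF q_le(1)]\<close>)
      then show "(\<lambda>n. Y (q n (fst p)) (snd p)) \<longlonglongrightarrow> (case p of (s, \<omega>) \<Rightarrow> Y s \<omega>)" by (simp add: p)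
    qed
  qed
  show ?thesis
    unfolding progressive_on_def using XY Y_joint by (intro exI[of _ Y] conjI ballI)
qed

lemma simple_process_jointly_measurable:
  assumes "simple_integrand_on P F 0 T K"
  shows "(\<lambda>(s, \<omega>). simple_process K s \<omega>) \<in> borel_measurable (restrict_space borel {0..T} \<Otimes>\<^sub>M F T)"
  using assms
proof (induction K)
  case Nil
  then show ?case by (simp add: simple_process_def)
next
  case (Cons a K)
  obtain r s h where a: "a = (r, s, h)" by (cases a)
  have prems: "simple_integrand_on P F 0 T K" "r \<le> T" "h \<in> borel_measurable (F r)"
    using Cons.prems unfolding a simple_integrand_on_Cons by auto
  have "h \<in> borel_measurable (F T)" by (rule measurable_F_mono[OF prems(3,2)])
  then have h: "(\<lambda>p. h (snd p)) \<in> borel_measurable (restrict_space borel {0..T} \<Otimes>\<^sub>M F T)"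
    by (rule measurable_compose[OF measurable_snd])
  have "(indicator {r<..s} :: real \<Rightarrow> real) \<in> borel_measurable (restrict_space borel {0..T})"
    by (rule measurable_restrict_space1) simp
  then have i: "(\<lambda>p. indicator {r<..s} (fst p) :: real) \<in> borel_measurable (restrict_space borel {0..T} \<Otimes>\<^sub>M F T)"
    by (rule measurable_compose[OF measurable_fst])
  from borel_measurable_add[OF borel_measurable_times[OF h i] Cons.IH[OF prems(1), unfolded case_prod_unfold]]
  show ?case unfolding a simple_process_Cons case_prod_unfold .
qed

text \<open>Measurability of an integral over time needs joint measurability, which holds for the
  progressive version \<open>H'\<close>. Completeness carries the result over to
  \<open>H\<close>.\<close>

lemma simple_process_error_measurable:
  assumes K: "simple_integrand_on P F 0 T K" and H: "progressive_on P F 0 T H"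
  shows "(\<lambda>\<omega>. LBINT s:{0..T}. (simple_process K s \<omega> - H s \<omega>)\<^sup>2) \<in> borel_measurable P"
proof -
  obtain H' where prog: "\<forall>t\<in>{0..T}. (\<lambda>(s, \<omega>). H' s \<omega>) \<in> borel_measurable (restrict_space borel {0..t} \<Otimes>\<^sub>M F t)"
    and eq: "AE \<omega> in P. \<forall>t\<in>{0..T}. H t \<omega> = H' t \<omega>"
    using H unfolding progressive_on_def by blast
  have H': "(\<lambda>(s, \<omega>). H' s \<omega>) \<in> borel_measurable (restrict_space borel {0..T} \<Otimes>\<^sub>M F T)"
    by (rule bspec[OF prog]) (use T_pos in simp)
  let ?L = "restrict_space lborel {0..T}"
  have "(\<lambda>p. (simple_process K (fst p) (snd p) - H' (fst p) (snd p))\<^sup>2)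
      \<in> borel_measurable (restrict_space borel {0..T} \<Otimes>\<^sub>M F T)"
    using simple_process_jointly_measurable[OF K] H'
    by (intro borel_measurable_power borel_measurable_diff) (simp_all add: case_prod_unfold)
  also have "borel_measurable (restrict_space borel {0..T} \<Otimes>\<^sub>M F T)
      = (borel_measurable (?L \<Otimes>\<^sub>M F T) :: (real \<times> 'a \<Rightarrow> real) set)"
    by (intro measurable_cong_sets sets_pair_measure_cong sets_restrict_space_cong) auto
  finally have "(\<lambda>p. (simple_process K (fst p) (snd p) - H' (fst p) (snd p))\<^sup>2) \<in> borel_measurable (?L \<Otimes>\<^sub>M F T)" .
  from measurable_compose[OF measurable_pair_swap' this]
  have "(\<lambda>(\<omega>, s). (simple_process K s \<omega> - H' s \<omega>)\<^sup>2) \<in> borel_measurable (F T \<Otimes>\<^sub>M ?L)"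
    by (simp add: case_prod_unfold)
  moreover have "sigma_finite_measure ?L"
    by (rule sigma_finite_measure_restrict_space) (auto intro: lborel.sigma_finite_measure_axioms)
  ultimately have "(\<lambda>\<omega>. \<integral>s. (simple_process K s \<omega> - H' s \<omega>)\<^sup>2 \<partial>?L) \<in> borel_measurable (F T)"
    by (intro sigma_finite_measure.borel_measurable_lebesgue_integral) auto
  then have "(\<lambda>\<omega>. LBINT s:{0..T}. (simple_process K s \<omega> - H' s \<omega>)\<^sup>2) \<in> borel_measurable (F T)"
    by (simp add: integral_restrict_space set_lebesgue_integral_def)
  then have "(\<lambda>\<omega>. LBINT s:{0..T}. (simple_process K s \<omega> - H' s \<omega>)\<^sup>2) \<in> borel_measurable P"
    by (rule measurable_F_P) simp
  then show ?thesis
  proof (rule measurable_P_AE_cong)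
    show "AE \<omega> in P. (LBINT s:{0..T}. (simple_process K s \<omega> - H s \<omega>)\<^sup>2)
        = (LBINT s:{0..T}. (simple_process K s \<omega> - H' s \<omega>)\<^sup>2)"
      using eq
    proof eventually_elim
      case (elim \<omega>)
      show ?case by (rule set_lebesgue_integral_cong) (use elim in auto)
    qed
  qed
qed

text \<open>Riemann sums over the grid stopped at t involve times up to t only and converge on every
  continuous path.\<close>

lemma time_integral_adapted:
  assumes X: "continuous_adapted X" and t: "t \<in> {0..T}"
  shows "(\<lambda>\<omega>. LBINT s:{0..t}. X s \<omega>) \<in> borel_measurable (F t)"
proof (rule measurable_F_AE_LIMSEQ)
  show "(\<lambda>\<omega>. \<Sum>i<Suc n. X (grid T t n i) \<omega> * (grid T t n (Suc i) - grid T t n i)) \<in> borel_measurable (F t)" for n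
  proof (intro borel_measurable_sum borel_measurable_times borel_measurable_const)
    fix i
    have "grid T t n i \<in> {0..T}" using grid_in[OF _ t] T_pos by simp
    from measurable_F_mono[OF continuous_adaptedD(1)[OF X this] grid_le]
    show "X (grid T t n i) \<in> borel_measurable (F t)" .
  qed
  show "AE \<omega> in P. (\<lambda>n. \<Sum>i<Suc n. X (grid T t n i) \<omega> * (grid T t n (Suc i) - grid T t n i))
      \<longlonglongrightarrow> (LBINT s:{0..t}. X s \<omega>)"
    using continuous_adaptedD(3)[OF X]
  proof eventually_elim
    case (elim \<omega>)
    show ?case by (rule riemann_sum_grid[OF _ t elim]) (use T_pos in simp)
  qed
qed

text \<open>The accumulated variance is at most \<open>2 * \<gamma>^2 * T\<close> times the mesh on
  a path where \<open>g\<close> is bounded by \<gamma>. It vanishes pathwise, and the Lenglart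
  inequality passes this on to the sum.\<close>

lemma square_increment_remainder:
  assumes g: "continuous_adapted g" and t: "t \<in> {0..T}"
  shows "conv_in_prob P (\<lambda>n \<omega>. \<Sum>i<Suc n. g (grid T t n i) \<omega> *
    ((W (grid T t n (Suc i)) \<omega> - W (grid T t n i) \<omega>)\<^sup>2 - (grid T t n (Suc i) - grid T t n i))) (\<lambda>\<omega>. 0)"
proof -
  let ?\<tau> = "grid T t"
  have T0: "0 \<le> T" using T_pos by simp
  have \<tau>_in: "?\<tau> n i \<in> {0..T}" for n i using grid_in[OF T0 t] .
  have \<tau>: "mono (?\<tau> n)" "range (?\<tau> n) \<subseteq> {0..T}" for n using grid_mono[OF T0] \<tau>_in by auto
  have gP: "g (?\<tau> n i) \<in> borel_measurable P" and gF: "g (?\<tau> n i) \<in> borel_measurable (F (?\<tau> n i))"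
    and WP: "W (?\<tau> n i) \<in> borel_measurable P" for n i
    using continuous_adaptedD(1,2)[OF g \<tau>_in] W_measurable[OF \<tau>_in] by auto
  define dt where "dt n i = ?\<tau> n (Suc i) - ?\<tau> n i" for n i
  define Y where "Y n \<omega> = (\<Sum>i<Suc n. g (?\<tau> n i) \<omega> * ((W (?\<tau> n (Suc i)) \<omega> - W (?\<tau> n i) \<omega>)\<^sup>2 - dt n i))" for n \<omega>
  define V where "V n \<omega> = (\<Sum>i<Suc n. (g (?\<tau> n i) \<omega>)\<^sup>2 * (2 * (dt n i)\<^sup>2))" for n \<omega>
  have dt: "0 \<le> dt n i" "dt n i \<le> T / real (Suc n)" for n i
    unfolding dt_def by (rule grid_step_nonneg[OF T0], rule grid_step[OF T0])
  have V0: "0 \<le> V n \<omega>" for n \<omega> unfolding V_def by (intro sum_nonneg) simp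
  have YP: "Y n \<in> borel_measurable P" for n
    unfolding Y_def by (intro borel_measurable_sum borel_measurable_times borel_measurable_diff
      borel_measurable_power gP WP borel_measurable_const)
  have V: "conv_in_prob P V (\<lambda>\<omega>. 0)"
  proof (rule conv_in_prob_AE_zero)
    show "V n \<in> borel_measurable P" for n
      unfolding V_def by (intro borel_measurable_sum borel_measurable_times borel_measurable_power gP borel_measurable_const)
    show "AE \<omega> in P. (\<lambda>n. V n \<omega>) \<longlonglongrightarrow> 0"
      using continuous_adaptedD(3)[OF g]
    proof eventually_elim
      case (elim \<omega>)
      obtain \<gamma> where \<gamma>: "\<And>s. s \<in> {0..T} \<Longrightarrow> \<bar>g s \<omega>\<bar> \<le> \<gamma>"
        using continuous_on_Icc_bounded[OF elim] by blast
      have le: "V n \<omega> \<le> \<gamma>\<^sup>2 * (2 * (T / real (Suc n) * T))" for n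
      proof -
        have "V n \<omega> \<le> (\<Sum>i<Suc n. \<gamma>\<^sup>2 * (2 * (T / real (Suc n) * dt n i)))"
          unfolding V_def
        proof (intro sum_mono mult_mono)
          fix i
          have "\<bar>g (?\<tau> n i) \<omega>\<bar>\<^sup>2 \<le> \<gamma>\<^sup>2" by (intro power_mono \<gamma> \<tau>_in) simp
          then show "(g (?\<tau> n i) \<omega>)\<^sup>2 \<le> \<gamma>\<^sup>2" by simp
          show "(dt n i)\<^sup>2 \<le> T / real (Suc n) * dt n i"
            unfolding power2_eq_square by (intro mult_right_mono dt)
        qed auto
        also have "\<dots> = \<gamma>\<^sup>2 * (2 * (T / real (Suc n) * (\<Sum>i<Suc n. dt n i)))"
          by (simp only: sum_distrib_left)
        also have "\<dots> \<le> \<gamma>\<^sup>2 * (2 * (T / real (Suc n) * T))"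
          unfolding dt_def using T0 by (intro mult_left_mono sum_grid_steps_le[OF T0 t]) auto
        finally show ?thesis .
      qed
      have B: "(\<lambda>n. \<gamma>\<^sup>2 * (2 * (T / real (Suc n) * T))) \<longlonglongrightarrow> 0"
        using tendsto_mult[OF tendsto_const[of "\<gamma>\<^sup>2 * 2 * T"] mesh_tendsto_0[of T]] by (simp add: mult_ac)
      show ?case by (rule tendsto_sandwich[OF _ _ tendsto_const B]) (use V0 le in auto)
    qed
  qed
  have "conv_in_prob P (\<lambda>n \<omega>. (Y n \<omega>)\<^sup>2) (\<lambda>\<omega>. 0)"
  proof (rule conv_in_prob_dominated[OF V])
    fix n and \<epsilon> \<delta> :: real assume pos: "0 < \<epsilon>" "0 < \<delta>"
    interpret noise_sequence P "\<lambda>l. F (?\<tau> n l)"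
      "\<lambda>l \<omega>. (W (?\<tau> n (Suc l)) \<omega> - W (?\<tau> n l) \<omega>)\<^sup>2 - (?\<tau> n (Suc l) - ?\<tau> n l)"
      "\<lambda>l. 2 * (?\<tau> n (Suc l) - ?\<tau> n l)\<^sup>2" "Suc n"
      by (rule brownian_square_noise[OF \<tau>])
    from lenglart[of "\<lambda>i. g (?\<tau> n i)", OF gF pos, of "{0}" "\<lambda>_. 0"]
    show "prob {\<omega> \<in> space P. \<epsilon> < \<bar>(Y n \<omega>)\<^sup>2\<bar>} \<le> prob {\<omega> \<in> space P. \<delta> < \<bar>V n \<omega>\<bar>} + \<delta> / \<epsilon>"
      unfolding abs_of_nonneg[OF V0] abs_of_nonneg[OF zero_le_power2] unfolding Y_def V_def dt_def
      by (simp add: lessThan_def)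
  qed (intro borel_measurable_power YP)
  then have "conv_in_prob P Y (\<lambda>\<omega>. 0)"
  proof (rule conv_in_prob_transfer)
    show "AE \<omega> in P. \<forall>r. strict_mono r \<longrightarrow> (\<lambda>n. (Y (r n) \<omega>)\<^sup>2) \<longlonglongrightarrow> 0 \<longrightarrow> (\<lambda>n. Y (r n) \<omega>) \<longlonglongrightarrow> 0"
    proof (intro AE_I2 allI impI)
      fix \<omega> and r :: "nat \<Rightarrow> nat" assume "(\<lambda>n. (Y (r n) \<omega>)\<^sup>2) \<longlonglongrightarrow> 0"
      from tendsto_real_sqrt[OF this] show "(\<lambda>n. Y (r n) \<omega>) \<longlonglongrightarrow> 0"
        by (simp add: tendsto_rabs_zero_iff)
    qed
  qed (use YP in auto)
  then show ?thesis unfolding Y_def dt_def .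
qed

section \<open>Step-function approximation of a continuous adapted integrand\<close>

text \<open>Truncation makes the values of the integrand bounded; along a fixed path it is inactive for
  large \<open>n\<close>.\<close>

definition step_integrand :: "(real \<Rightarrow> 'a \<Rightarrow> real) \<Rightarrow> nat \<Rightarrow> 'a simple_integrand" where
  "step_integrand X n = map (\<lambda>i. (grid T T n i, grid T T n (Suc i),
     \<lambda>\<omega>. max (- real n) (min (real n) (X (grid T T n i) \<omega>)))) [0..<Suc n]"

lemma simple_integrand_step_integrand:
  assumes X: "continuous_adapted X"
  shows "simple_integrand_on P F 0 T (step_integrand X n)"
proof -
  have T0: "0 \<le> T" using T_pos by simp
  have in_T: "0 \<le> grid T T n i" "grid T T n i \<le> T" for i using grid_in[OF T0, of T n i] T0 by auto
  have meas: "(\<lambda>\<omega>. max (- real n) (min (real n) (X (grid T T n i) \<omega>))) \<in> borel_measurable (F (grid T T n i))" for i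
    using continuous_adaptedD(1)[OF X, of "grid T T n i"] in_T by (intro borel_measurable_max borel_measurable_min) auto
  show ?thesis
    unfolding simple_integrand_on_def
  proof
    fix x assume "x \<in> set (step_integrand X n)"
    then obtain i where x: "x = (grid T T n i, grid T T n (Suc i),
        \<lambda>\<omega>. max (- real n) (min (real n) (X (grid T T n i) \<omega>)))"
      unfolding step_integrand_def by auto
    show "case x of (r, s, h) \<Rightarrow> 0 \<le> r \<and> r \<le> s \<and> s \<le> T \<and> h \<in> borel_measurable (F r) \<and>
        (\<exists>C. \<forall>\<omega>\<in>space P. \<bar>h \<omega>\<bar> \<le> C)"
      unfolding x prod.case
    proof (intro conjI in_T meas exI[of _ "real n"] ballI)
      show "grid T T n i \<le> grid T T n (Suc i)" using grid_step_nonneg[OF T0, of T n i] by simp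
    qed auto
  qed
qed

lemma step_integrand_eq:
  assumes B: "\<And>s. s \<in> {0..T} \<Longrightarrow> \<bar>X s \<omega>\<bar> \<le> real n" and t: "t \<in> {0..T}"
  shows "simple_integral W (step_integrand X n) t \<omega>
      = (\<Sum>i<Suc n. X (grid T t n i) \<omega> * (W (grid T t n (Suc i)) \<omega> - W (grid T t n i) \<omega>))"
    and "simple_process (step_integrand X n) s \<omega>
      = (\<Sum>i<Suc n. X (grid T T n i) \<omega> * indicator {grid T T n i<..grid T T n (Suc i)} s)"
proof -
  have T0: "0 \<le> T" using T_pos by simp
  have in_T: "grid T T n i \<in> {0..T}" for i using grid_in[OF T0, of T n i] T0 by auto
  have clamp: "max (- real n) (min (real n) (X (grid T T n i) \<omega>)) = X (grid T T n i) \<omega>" for i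
    using B[OF in_T[of i]] by auto
  have min_grid: "min (grid T T n i) t = grid T t n i" for i using t by (auto simp: grid_def min_def)
  have list: "sum_list (map f [0..<Suc n]) = (\<Sum>i<Suc n. f i)" for f :: "nat \<Rightarrow> real"
    by (simp only: interv_sum_list_conv_sum_set_nat set_upt atLeast0LessThan)
  show "simple_process (step_integrand X n) s \<omega>
      = (\<Sum>i<Suc n. X (grid T T n i) \<omega> * indicator {grid T T n i<..grid T T n (Suc i)} s)"
    unfolding simple_process_def step_integrand_def map_map o_def prod.case clamp list ..
  have "simple_integral W (step_integrand X n) t \<omega>
      = (\<Sum>i<Suc n. X (grid T T n i) \<omega> * (W (grid T t n (Suc i)) \<omega> - W (grid T t n i) \<omega>))"
    unfolding simple_integral_def step_integrand_def map_map o_def prod.case clamp list min_grid ..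
  also have "\<dots> = (\<Sum>i<Suc n. X (grid T t n i) \<omega> * (W (grid T t n (Suc i)) \<omega> - W (grid T t n i) \<omega>))"
  proof (rule sum.cong[OF refl])
    fix i
    show "X (grid T T n i) \<omega> * (W (grid T t n (Suc i)) \<omega> - W (grid T t n i) \<omega>)
        = X (grid T t n i) \<omega> * (W (grid T t n (Suc i)) \<omega> - W (grid T t n i) \<omega>)"
    proof (cases "grid T T n i \<le> t")
      case True
      then show ?thesis using min_grid[of i] by (simp add: min_def)
    next
      \<comment> \<open>For a node beyond t the stopped grid evaluates the integrand at t, which is
        harmless because the Brownian increment there is zero.\<close>
      case False
      then have "grid T t n i = t" "grid T t n (Suc i) = t"
        using min_grid[of i] min_grid[of "Suc i"] grid_step_nonneg[OF T0, of T n i] by (auto simp: min_def)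
      then show ?thesis by simp
    qed
  qed
  finally show "simple_integral W (step_integrand X n) t \<omega>
      = (\<Sum>i<Suc n. X (grid T t n i) \<omega> * (W (grid T t n (Suc i)) \<omega> - W (grid T t n i) \<omega>))" .
qed

lemma step_integrand_conv:
  assumes X: "continuous_adapted X"
  shows "conv_in_prob P (\<lambda>n \<omega>. LBINT s:{0..T}. (simple_process (step_integrand X n) s \<omega> - X s \<omega>)\<^sup>2) (\<lambda>\<omega>. 0)"
proof (rule conv_in_prob_AE_zero)
  show "(\<lambda>\<omega>. LBINT s:{0..T}. (simple_process (step_integrand X n) s \<omega> - X s \<omega>)\<^sup>2) \<in> borel_measurable P" for n
    by (rule simple_process_error_measurable[OF simple_integrand_step_integrand[OF X] continuous_adapted_progressive[OF X]])
  have T0: "0 \<le> T" and TT: "T \<in> {0..T}" using T_pos by auto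
  show "AE \<omega> in P. (\<lambda>n. LBINT s:{0..T}. (simple_process (step_integrand X n) s \<omega> - X s \<omega>)\<^sup>2) \<longlonglongrightarrow> 0"
    using continuous_adaptedD(3)[OF X]
  proof eventually_elim
    case (elim \<omega>)
    obtain B where B: "\<And>s. s \<in> {0..T} \<Longrightarrow> \<bar>X s \<omega>\<bar> \<le> B" using continuous_on_Icc_bounded[OF elim] by blast
    obtain \<eta> where \<eta>: "\<eta> \<longlonglongrightarrow> 0"
      "\<And>n i s. s \<in> {grid T T n i..grid T T n (Suc i)} \<Longrightarrow> \<bar>X s \<omega> - X (grid T T n i) \<omega>\<bar> \<le> \<eta> n"
      using grid_oscillation[OF T0 TT elim] by metis
    let ?E = "\<lambda>n. LBINT s:{0..T}. (simple_process (step_integrand X n) s \<omega> - X s \<omega>)\<^sup>2"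
    have le: "?E n \<le> (\<eta> n)\<^sup>2 * T" if n: "B \<le> real n" for n
    proof -
      have B': "\<bar>X s \<omega>\<bar> \<le> real n" if "s \<in> {0..T}" for s using B[OF that] n by simp
      have pt: "(simple_process (step_integrand X n) s \<omega> - X s \<omega>)\<^sup>2 \<le> (\<eta> n)\<^sup>2" if s: "0 < s" "s \<le> T" for s
      proof -
        let ?i = "\<lambda>i. indicator {grid T T n i<..grid T T n (Suc i)} s :: real"
        have one: "(\<Sum>i<Suc n. ?i i) = 1"
          unfolding sum_indicator_grid[OF grid_mono[OF T0]] using s T0
          by (simp only: grid_0[OF T0] grid_last[OF order_refl]) (simp add: indicator_def)
        have "simple_process (step_integrand X n) s \<omega> - X s \<omega>
            = (\<Sum>i<Suc n. X (grid T T n i) \<omega> * ?i i) - X s \<omega> * (\<Sum>i<Suc n. ?i i)"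
          using step_integrand_eq(2)[of X \<omega> n, OF B' TT] by (simp only: one mult_1_right)
        also have "\<dots> = (\<Sum>i<Suc n. (X (grid T T n i) \<omega> - X s \<omega>) * ?i i)"
          by (simp only: sum_distrib_left sum_subtractf[symmetric] left_diff_distrib)
        also have "\<bar>\<dots>\<bar> \<le> (\<Sum>i<Suc n. \<eta> n * ?i i)"
        proof (rule order_trans[OF sum_abs], rule sum_mono)
          fix i
          show "\<bar>(X (grid T T n i) \<omega> - X s \<omega>) * ?i i\<bar> \<le> \<eta> n * ?i i"
            using \<eta>(2)[of s n i] by (auto simp: indicator_def abs_minus_commute)
        qed
        also have "\<dots> = \<eta> n" by (simp only: sum_distrib_left[symmetric] one mult_1_right)
        finally have "\<bar>simple_process (step_integrand X n) s \<omega> - X s \<omega>\<bar> \<le> \<eta> n" .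
        then have "\<bar>simple_process (step_integrand X n) s \<omega> - X s \<omega>\<bar>\<^sup>2 \<le> (\<eta> n)\<^sup>2" by (intro power_mono) auto
        then show ?thesis by simp
      qed
      have "?E n \<le> (LBINT s:{0..T}. (\<eta> n)\<^sup>2)"
      proof (rule set_integral_mono_AE)
        show "set_integrable lborel {0..T} (\<lambda>s. (simple_process (step_integrand X n) s \<omega> - X s \<omega>)\<^sup>2)"
          by (rule set_integrable_simple_process_diff[OF elim])
        show "set_integrable lborel {0..T} (\<lambda>s. (\<eta> n)\<^sup>2)"
          by (intro set_integrable_const) (auto simp: emeasure_lborel_Icc_eq)
        \<comment> \<open>The time 0 lies in none of the left-open grid intervals, so the pointwise
          bound is available only on \<open>(0, T]\<close>.\<close>
        show "AE s\<in>{0..T} in lborel. (simple_process (step_integrand X n) s \<omega> - X s \<omega>)\<^sup>2 \<le> (\<eta> n)\<^sup>2"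
          using AE_lborel_singleton[of 0] by eventually_elim (auto intro!: pt)
      qed
      also have "\<dots> = (\<eta> n)\<^sup>2 * T" using T0 by (simp add: set_integral_const)
      finally show ?thesis .
    qed
    show ?case
    proof (rule tendsto_sandwich[OF _ _ tendsto_const])
      show "(\<lambda>n. (\<eta> n)\<^sup>2 * T) \<longlonglongrightarrow> 0"
        using tendsto_mult[OF tendsto_power[OF \<eta>(1), of 2] tendsto_const[of T]] by simp
      show "\<forall>\<^sub>F n in sequentially. ?E n \<le> (\<eta> n)\<^sup>2 * T"
        using filterlim_real_sequentially[unfolded filterlim_at_top, rule_format, of B]
        by eventually_elim (rule le)
      show "\<forall>\<^sub>F n in sequentially. 0 \<le> ?E n"
        by (auto intro!: always_eventually Bochner_Integration.integral_nonneg simp: set_lebesgue_integral_def)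
    qed
  qed
qed


section \<open>Ito's formula for a driftless process with continuous integrand\<close>

lemma ito_formula:
  assumes M: "has_ito_differential P F W 0 T M (\<lambda>t \<omega>. 0) H" and H: "continuous_adapted H" and u: "C12 T u"
  shows "has_ito_differential P F W 0 T (\<lambda>t \<omega>. u t (M t \<omega>))
    (\<lambda>t \<omega>. partial_t T u t (M t \<omega>) + 1 / 2 * (H t \<omega>)\<^sup>2 * partial_xx u t (M t \<omega>))
    (\<lambda>t \<omega>. partial_x u t (M t \<omega>) * H t \<omega>)"
proof -
  have T0: "0 \<le> T" using T_pos by simp
  obtain I where I: "is_ito_integral P F W 0 T H I"
    and MI: "AE \<omega> in P. \<forall>t\<in>{0..T}. M t \<omega> = M 0 \<omega> + (LBINT s:{0..t}. 0) + I t \<omega>"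
    using M unfolding has_ito_differential_def by blast
  have MI: "AE \<omega> in P. \<forall>t\<in>{0..T}. M t \<omega> = M 0 \<omega> + I t \<omega>"
    using MI by (simp add: set_lebesgue_integral_def)
  have cM: "continuous_adapted M" using M unfolding has_ito_differential_def continuous_adapted_def by blast
  note comp = continuous_adapted_comp[OF cM]
  have cu: "continuous_adapted (\<lambda>t \<omega>. u t (M t \<omega>))"
    and ct: "continuous_adapted (\<lambda>t \<omega>. partial_t T u t (M t \<omega>))"
    and cx: "continuous_adapted (\<lambda>t \<omega>. partial_x u t (M t \<omega>))"
    and cxx: "continuous_adapted (\<lambda>t \<omega>. partial_xx u t (M t \<omega>))"
    using u unfolding C12_def by (auto intro!: comp)
  define \<beta> where "\<beta> t \<omega> = partial_t T u t (M t \<omega>) + 1 / 2 * (H t \<omega>)\<^sup>2 * partial_xx u t (M t \<omega>)" for t \<omega>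
  define \<sigma> where "\<sigma> t \<omega> = partial_x u t (M t \<omega>) * H t \<omega>" for t \<omega>
  define J where "J t \<omega> = u t (M t \<omega>) - u 0 (M 0 \<omega>) - (LBINT s:{0..t}. \<beta> s \<omega>)" for t \<omega>
  have cH2: "continuous_adapted (\<lambda>t \<omega>. (H t \<omega>)\<^sup>2)"
    using continuous_adapted_mult[OF H H] by (simp add: power2_eq_square)
  have c\<beta>: "continuous_adapted \<beta>"
    unfolding \<beta>_def[abs_def]
    by (intro continuous_adapted_add continuous_adapted_mult continuous_adapted_const ct cxx cH2)
  have c\<sigma>: "continuous_adapted \<sigma>" unfolding \<sigma>_def[abs_def] by (rule continuous_adapted_mult[OF cx H])
  have J_F: "J t \<in> borel_measurable (F t)" if t: "t \<in> {0..T}" for t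
  proof -
    have "(\<lambda>\<omega>. u 0 (M 0 \<omega>)) \<in> borel_measurable (F t)"
      by (rule measurable_F_mono[OF continuous_adaptedD(1)[OF cu]]) (use t T0 in auto)
    then show ?thesis
      unfolding J_def using continuous_adaptedD(1)[OF cu t] time_integral_adapted[OF c\<beta> t]
      by (intro borel_measurable_diff)
  qed
  have J_P: "J t \<in> borel_measurable P" if "t \<in> {0..T}" for t
    by (rule measurable_F_P[OF J_F[OF that]]) (use that in simp)
  have J_cont: "AE \<omega> in P. continuous_on {0..T} (\<lambda>t. J t \<omega>)"
    using continuous_adaptedD(3)[OF cu] continuous_adaptedD(3)[OF c\<beta>]
  proof eventually_elim
    case (elim \<omega>)
    have "continuous_on {0..T} (\<lambda>t. integral {0..t} (\<lambda>s. \<beta> s \<omega>))"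
      by (rule indefinite_integral_continuous_1[OF integrable_continuous_real[OF elim(2)]])
    then have "continuous_on {0..T} (\<lambda>t. LBINT s:{0..t}. \<beta> s \<omega>)"
    proof (rule continuous_on_eq)
      fix t assume "t \<in> {0..T}"
      then show "integral {0..t} (\<lambda>s. \<beta> s \<omega>) = (LBINT s:{0..t}. \<beta> s \<omega>)"
      by (intro set_borel_integral_eq_integral(2)[symmetric] borel_integrable_atLeastAtMost'
          continuous_on_subset[OF elim(2)]) auto
    qed
    then show ?case unfolding J_def by (intro continuous_intros elim(1))
  qed
  have sq_int: "AE \<omega> in P. set_integrable lborel {0..T} (\<lambda>t. (\<sigma> t \<omega>)\<^sup>2)"
    using continuous_adaptedD(3)[OF c\<sigma>]
    by eventually_elim (intro borel_integrable_atLeastAtMost' continuous_on_power)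
  have \<beta>_int: "AE \<omega> in P. set_integrable lborel {0..T} (\<lambda>t. \<beta> t \<omega>)"
    using continuous_adaptedD(3)[OF c\<beta>] by eventually_elim (rule borel_integrable_atLeastAtMost')
  have conv: "conv_in_prob P (\<lambda>n. simple_integral W (step_integrand \<sigma> n) t) (J t)" if t: "t \<in> {0..T}" for t
  proof -
    let ?\<tau> = "grid T t"
    have \<tau>_in: "?\<tau> n i \<in> {0..T}" for n i using grid_in[OF T0 t] .
    define dw where "dw n i \<omega> = W (?\<tau> n (Suc i)) \<omega> - W (?\<tau> n i) \<omega>" for n i \<omega>
    define dt where "dt n i = ?\<tau> n (Suc i) - ?\<tau> n i" for n i
    define R where "R n i \<omega> = M (?\<tau> n (Suc i)) \<omega> - M (?\<tau> n i) \<omega> - H (?\<tau> n i) \<omega> * dw n i \<omega>" for n i \<omega>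
    \<comment> \<open>These are the four hypotheses of the pathwise expansion. The second is the
      remainder lemma with constant weight 1, the third and fourth are weighted quadratic
      variations.\<close>
    define X where "X j n \<omega> = (if j = (0::nat) then \<Sum>i<Suc n. partial_x u (?\<tau> n i) (M (?\<tau> n i) \<omega>) * R n i \<omega>
      else if j = 1 then \<Sum>i<Suc n. (1 * R n i \<omega>)\<^sup>2
      else if j = 2 then \<Sum>i<Suc n. (partial_xx u (?\<tau> n i) (M (?\<tau> n i) \<omega>) * (H (?\<tau> n i) \<omega>)\<^sup>2) * ((dw n i \<omega>)\<^sup>2 - dt n i)
      else \<Sum>i<Suc n. (H (?\<tau> n i) \<omega>)\<^sup>2 * ((dw n i \<omega>)\<^sup>2 - dt n i))" for j n \<omega>
    note rem = ito_integral_remainder[OF I H _ MI continuous_adaptedD(2)[OF cM] t, folded dw_def, folded R_def]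
    note sq = square_increment_remainder[OF _ t, folded dw_def dt_def]
    have X: "conv_in_prob P (X j) (\<lambda>\<omega>. 0)" for j
    proof -
      consider "j = 0" | "j = 1" | "j = 2" | "j > 2" by linarith
      then show ?thesis
      proof cases
        case 1
        then show ?thesis using rem(1)[OF cx] by (simp add: X_def[abs_def] del: sum.lessThan_Suc)
      next
        case 2
        then show ?thesis using rem(2)[OF continuous_adapted_const[of 1]]
          by (simp add: X_def[abs_def] del: sum.lessThan_Suc)
      next
        case 3
        then show ?thesis using sq[OF continuous_adapted_mult[OF cxx cH2]]
          by (simp add: X_def[abs_def] del: sum.lessThan_Suc)
      next
        case 4
        then show ?thesis using sq[OF cH2] by (simp add: X_def[abs_def] del: sum.lessThan_Suc)
      qed
    qed
    show ?thesis
    \<comment> \<open>One dominating sequence for all four remainders yields a common subsequence,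
      on which the expansion is a statement about a single path.\<close>
    proof (rule conv_in_prob_transfer[OF conv_in_prob_zero_sum[of "{..<4}" X]])
      have "simple_integral W K t \<in> borel_measurable P" if "simple_integrand_on P F 0 T K" for K
        using that
      proof (induction K)
        case (Cons a K)
        obtain r s h where a: "a = (r, s, h)" by (cases a)
        have rs: "0 \<le> r" "r \<le> s" "s \<le> T" "h \<in> borel_measurable (F r)" "simple_integrand_on P F 0 T K"
          using Cons.prems unfolding a simple_integrand_on_Cons by auto
        have "h \<in> borel_measurable P" by (rule measurable_F_P[OF rs(4)]) (use rs in simp)
        moreover have "W (min s t) \<in> borel_measurable P" "W (min r t) \<in> borel_measurable P"
          using rs t by (auto intro!: W_measurable simp: min_def)
        ultimately have "(\<lambda>\<omega>. h \<omega> * (W (min s t) \<omega> - W (min r t) \<omega>) + simple_integral W K t \<omega>) \<in> borel_measurable P"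
          by (intro borel_measurable_add borel_measurable_times borel_measurable_diff Cons.IH rs(5))
        then show ?case unfolding a simple_integral_Cons[abs_def] .
      qed (simp add: simple_integral_def[abs_def])
      then show "simple_integral W (step_integrand \<sigma> n) t \<in> borel_measurable P" for n
        using simple_integrand_step_integrand[OF c\<sigma>] by blast
      show "AE \<omega> in P. \<forall>r. strict_mono r \<longrightarrow> (\<lambda>n. \<Sum>j<4. \<bar>X j (r n) \<omega>\<bar>) \<longlonglongrightarrow> 0 \<longrightarrow>
          (\<lambda>n. simple_integral W (step_integrand \<sigma> (r n)) t \<omega>) \<longlonglongrightarrow> J t \<omega>"
        using continuous_adaptedD(3)[OF cM] continuous_adaptedD(3)[OF H] continuous_adaptedD(3)[OF c\<sigma>]
      proof eventually_elim
        case (elim \<omega>)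
        show ?case
        proof (intro allI impI)
          fix r :: "nat \<Rightarrow> nat" assume r: "strict_mono r" and lim: "(\<lambda>n. \<Sum>j<4. \<bar>X j (r n) \<omega>\<bar>) \<longlonglongrightarrow> 0"
          have Xj: "(\<lambda>n. X j (r n) \<omega>) \<longlonglongrightarrow> 0" if "j < 4" for j
          proof (rule Lim_null_comparison[OF _ lim], intro always_eventually allI)
            fix n
            show "norm (X j (r n) \<omega>) \<le> (\<Sum>j<4. \<bar>X j (r n) \<omega>\<bar>)"
              unfolding real_norm_def using that
              by (intro member_le_sum[of j "{..<4}" "\<lambda>j. \<bar>X j (r n) \<omega>\<bar>"]) auto
          qed
          have "(\<lambda>n. \<Sum>i<Suc (r n). (partial_x u (?\<tau> (r n) i) (M (?\<tau> (r n) i) \<omega>) * H (?\<tau> (r n) i) \<omega>)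
              * (W (?\<tau> (r n) (Suc i)) \<omega> - W (?\<tau> (r n) i) \<omega>))
            \<longlonglongrightarrow> u t (M t \<omega>) - u 0 (M 0 \<omega>)
              - (LBINT s:{0..t}. partial_t T u s (M s \<omega>) + 1 / 2 * (H s \<omega>)\<^sup>2 * partial_xx u s (M s \<omega>))"
          proof (rule ito_formula_path[OF T0 t u elim(1,2) r, of "\<lambda>s. W s \<omega>"])
          qed (use Xj[of 0] Xj[of 1] Xj[of 2] Xj[of 3] in
              \<open>simp_all add: X_def R_def dw_def dt_def del: sum.lessThan_Suc\<close>)
          then have main: "(\<lambda>n. \<Sum>i<Suc (r n). \<sigma> (?\<tau> (r n) i) \<omega> * (W (?\<tau> (r n) (Suc i)) \<omega> - W (?\<tau> (r n) i) \<omega>)) \<longlonglongrightarrow> J t \<omega>"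
            unfolding J_def \<sigma>_def \<beta>_def .
          obtain B where B: "\<And>s. s \<in> {0..T} \<Longrightarrow> \<bar>\<sigma> s \<omega>\<bar> \<le> B" using continuous_on_Icc_bounded[OF elim(3)] by blast
          have "\<forall>\<^sub>F n in sequentially. B \<le> real n"
            using filterlim_real_sequentially[unfolded filterlim_at_top] by blast
          then have "\<forall>\<^sub>F n in sequentially. B \<le> real (r n)"
            using filterlim_subseq[OF r] unfolding filterlim_iff by blast
          then have "\<forall>\<^sub>F n in sequentially. (\<Sum>i<Suc (r n). \<sigma> (?\<tau> (r n) i) \<omega> * (W (?\<tau> (r n) (Suc i)) \<omega> - W (?\<tau> (r n) i) \<omega>))
              = simple_integral W (step_integrand \<sigma> (r n)) t \<omega>"
          proof eventually_elim
            case (elim n)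
            have "\<bar>\<sigma> s \<omega>\<bar> \<le> real (r n)" if "s \<in> {0..T}" for s using B[OF that] elim by simp
            from step_integrand_eq(1)[of \<sigma> \<omega> "r n", OF this t] show ?case by simp
          qed
          then show "(\<lambda>n. simple_integral W (step_integrand \<sigma> (r n)) t \<omega>) \<longlonglongrightarrow> J t \<omega>"
            by (rule Lim_transform_eventually[OF main])
        qed
      qed
    qed (use X J_P[OF t] in auto)
  qed
  have "is_ito_integral P F W 0 T \<sigma> J"
    unfolding is_ito_integral_def adapted_on_def
    by (intro conjI ballI allI exI[of _ "step_integrand \<sigma>"] continuous_adapted_progressive[OF c\<sigma>] sq_int J_F J_cont
      simple_integrand_step_integrand[OF c\<sigma>] step_integrand_conv[OF c\<sigma>] conv)
  moreover have "AE \<omega> in P. \<forall>t\<in>{0..T}. u t (M t \<omega>) = u 0 (M 0 \<omega>) + (LBINT s:{0..t}. \<beta> s \<omega>) + J t \<omega>"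
    by (simp add: J_def)
  ultimately have "has_ito_differential P F W 0 T (\<lambda>t \<omega>. u t (M t \<omega>)) \<beta> \<sigma>"
    unfolding has_ito_differential_def
    by (intro conjI exI[of _ J] cu[unfolded continuous_adapted_def, THEN conjunct1]
      continuous_adaptedD(3)[OF cu] continuous_adapted_progressive[OF c\<beta>] \<beta>_int)
  then show ?thesis unfolding \<beta>_def[abs_def] \<sigma>_def[abs_def] .
qed

end

theorem theorem5p1:
  fixes P :: "'a measure" and T :: real and W M X :: "real \<Rightarrow> 'a \<Rightarrow> real"
    and F :: "real \<Rightarrow> 'a measure"
    and f :: "real \<Rightarrow> real \<Rightarrow> real \<Rightarrow> real \<Rightarrow> real" and \<xi> :: "'a \<Rightarrow> real"
    and S :: "'a solution_class"
    and \<nu> u :: "real \<Rightarrow> real \<Rightarrow> real"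
  assumes "prob_space P" and "complete_measure P" and "0 < T"
    and "brownian_motion P T W"
    and F_eq: "F = augmented_filtration P W"
    and "well_posed P F T f \<xi> X"
    and "unique_implicit_volatility T (specialization f) \<nu>"
    and "canonical_nbm P F W T f S M"
    and "volatility_sde_solution P F W T \<nu> M"
    and "C12 T u"
  shows "has_ito_differential P F W 0 T
           (\<lambda>t \<omega>. u t (M t \<omega>))
           (\<lambda>t \<omega>. nbm_generator T \<nu> u t (M t \<omega>))
           (\<lambda>t \<omega>. partial_x u t (M t \<omega>) * \<nu> t (M t \<omega>))"
proof -
  interpret wiener P T W F
    using assms(1-5) by (intro wiener.intro wiener_axioms.intro)
  have M: "has_ito_differential P F W 0 T M (\<lambda>t \<omega>. 0) (\<lambda>t \<omega>. \<nu> t (M t \<omega>))"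
    using assms(9) unfolding volatility_sde_solution_def by blast
  then have "continuous_adapted M"
    unfolding has_ito_differential_def continuous_adapted_def by blast
  \<comment> \<open>Continuity of \<nu> carries path continuity from M to the integrand, which
    brings the equation within the scope of \<open>ito_formula\<close>.\<close>
  then have "continuous_adapted (\<lambda>t \<omega>. \<nu> t (M t \<omega>))"
    by (rule continuous_adapted_comp) (rule implicit_volatility_continuous_on[OF assms(7)])
  from ito_formula[OF M this assms(10)] show ?thesis unfolding nbm_generator_def .
qed

end
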